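(* Consider a processor-sharing queue with inter-arrival times $X_{\mathrm{PS}}$ and job lengths $J_{\mathrm{PS}}$ with support $[\alpha_{\mathrm{PS}},\beta_{\mathrm{PS}}]$ and load factor less than one, and an infinite-server queue with inter-arrival times $X_{\mathrm{INF}}$ and service times $T_{\mathrm{INF}}$ whose support has lower endpoint $\alpha_{\mathrm{INF}}$. If $$X_{\mathrm{PS}}\le_{st}X_{\mathrm{INF}},\qquad J_{\mathrm{PS}}\ge_{st}T_{\mathrm{INF}},\qquad \alpha_{\mathrm{PS}}\le\alpha_{\mathrm{INF}},$$ then $$\rho_{\mathrm{PS}}\ge\rho_{\mathrm{INF}},\qquad \mathbb{P}[B_{\mathrm{PS}}=1]\le\mathbb{P}[B_{\mathrm{INF}}=1],\qquad P^{\mathrm{RAND}}_{\mathrm{PS}}\le P^{\mathrm{RAND}}_{\mathrm{INF}}.$$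
   Context: **Queues.** In both queues the inter-arrival times $X(1),X(2),\dots$ are i.i.d. positive with a continuous pdf. In the (egalitarian) processor-sharing queue a server of unit capacity is shared equally: whenever $n$ jobs are present, each is served at rate $1/n$. Its job lengths (amounts of service required) $J_{\mathrm{PS}}(i)$ are i.i.d. positive with a pdf and independent of the arrivals. Its sojourn time $T_{\mathrm{PS}}(i)$ is the time the $i$-th job spends in the system, and its load factor is $\rho_{\mathrm{PS}}=\mathbb{E}[J_{\mathrm{PS}}]/\mathbb{E}[X_{\mathrm{PS}}]$. In the infinite-server ($GI/GI/\infty$) queue every arrival is served immediately. Its service times $T_{\mathrm{INF}}(i)$ are i.i.d. positive with a continuous pdf and independent of the arrivals, and its load factor is $\rho_{\mathrm{INF}}=\mathbb{E}[T_{\mathrm{INF}}]/\mathbb{E}[X_{\mathrm{INF}}]$. Below, $T(i)$ denotes the sojourn time $T_{\mathrm{PS}}(i)$ or the service time $T_{\mathrm{INF}}(i)$, and $f_T$ its pdf; unsubscripted symbols refer to either queue, and subscripts PS and INF indicate which one. **Busy period.** Consider a typical busy period: the first arrival finds an empty queue at time $Y(1)=0$. The arrival times are $Y(i+1)=Y(i)+X(i)$, and job $i$ departs at time $Y(i)+T(i)$. The busy period ends the first time the queue becomes empty. $B$ is the number of arrivals in it. **Matching.** Let $D(1)<\dots<D(B)$ be the ordered departure times in the busy period. The true matching $\pi^t$ is the permutation of $\{1,\dots,B\}$ with $T(i)=D(\pi^t(i))-Y(i)$. Given $B=b$, a permutation $\pi$ of $\{1,\dots,b\}$ is a valid matching if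 $\prod_{i=1}^b f_{T}[D(\pi(i))-Y(i)]>0$. The random matching rule picks $\pi^{\mathrm{RAND}}$ uniformly among all valid matchings, given the arrival and departure times in the busy period. Its tracking accuracy is $P^{\mathrm{RAND}}=\sum_{b=1}^\infty\mathbb{P}[\pi^{\mathrm{RAND}}=\pi^t,\ B=b]$. **Stochastic order.** $Z_1\ge_{st}Z_2$ (equivalently $Z_2\le_{st}Z_1$) means $\mathbb{E}[\phi(Z_1)]\ge\mathbb{E}[\phi(Z_2)]$ for all increasing $\phi$ for which the expectations exist. *)

theory Defs
  imports "HOL-Probability.Probability"
begin

text \<open>
  Jobs are numbered from 0, so \<open>X n\<close> is the time between the arrivals of jobs \<open>n\<close> and \<open>n + 1\<close>,
  and a busy period with \<open>b\<close> arrivals consists of the jobs in \<open>{..<b}\<close>.  In the deterministic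
  definitions \<open>x\<close>, \<open>j\<close> and \<open>t\<close> are realizations of the sequences of inter-arrival times, job
  lengths and sojourn (or service) times.
\<close>

definition arrival :: "(nat \<Rightarrow> real) \<Rightarrow> nat \<Rightarrow> real" where
  "arrival x n = (\<Sum>k<n. x k)"

definition departure :: "(nat \<Rightarrow> real) \<Rightarrow> (nat \<Rightarrow> real) \<Rightarrow> nat \<Rightarrow> real" where
  "departure x t i = arrival x i + t i"

definition jobs_present :: "(nat \<Rightarrow> real) \<Rightarrow> (nat \<Rightarrow> real) \<Rightarrow> real \<Rightarrow> nat set" where
  "jobs_present x t s = {k. arrival x k \<le> s \<and> s < departure x t k}"

text \<open>
  The equation says that each job receives service at rate \<open>1 / n\<close> while \<open>n\<close> jobs are present,
  and leaves when the service received equals its length.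
\<close>

definition processor_sharing_path ::
    "(nat \<Rightarrow> real) \<Rightarrow> (nat \<Rightarrow> real) \<Rightarrow> (nat \<Rightarrow> real) \<Rightarrow> bool" where
  "processor_sharing_path x j t \<longleftrightarrow>
     (\<forall>i. ((\<lambda>s. 1 / real (card (jobs_present x t s))) has_integral j i)
            {arrival x i..departure x t i})"

text \<open>
  The number of arrivals in the busy period started by job 0: the queue first empties between
  the arrivals of jobs \<open>b - 1\<close> and \<open>b\<close>, for the least possible \<open>b\<close>.  It is \<open>\<infinity>\<close> if the queue
  never empties.
\<close>

definition busy_arrivals :: "(nat \<Rightarrow> real) \<Rightarrow> (nat \<Rightarrow> real) \<Rightarrow> enat" where
  "busy_arrivals x t = Inf (enat ` {b. 1 \<le> b \<and> (\<forall>i<b. departure x t i \<le> arrival x b)})"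

definition ordered_departure :: "nat \<Rightarrow> (nat \<Rightarrow> real) \<Rightarrow> (nat \<Rightarrow> real) \<Rightarrow> nat \<Rightarrow> real" where
  "ordered_departure b x t k = sort (map (departure x t) [0..<b]) ! k"

definition true_matching :: "nat \<Rightarrow> (nat \<Rightarrow> real) \<Rightarrow> (nat \<Rightarrow> real) \<Rightarrow> nat \<Rightarrow> nat" where
  "true_matching b x t =
     (THE p. p permutes {..<b} \<and> (\<forall>i<b. t i = ordered_departure b x t (p i) - arrival x i))"

definition valid_matchings ::
    "(real \<Rightarrow> real) \<Rightarrow> nat \<Rightarrow> (nat \<Rightarrow> real) \<Rightarrow> (nat \<Rightarrow> real) \<Rightarrow> (nat \<Rightarrow> nat) set" where
  "valid_matchings f b x t =
     {p. p permutes {..<b} \<and> (\<Prod>i<b. f (ordered_departure b x t (p i) - arrival x i)) > 0}"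

text \<open>
  The conditional law of the random matching, given the arrival and departure times in a busy
  period with \<open>b\<close> arrivals.
\<close>

definition random_matching ::
    "(real \<Rightarrow> real) \<Rightarrow> nat \<Rightarrow> (nat \<Rightarrow> real) \<Rightarrow> (nat \<Rightarrow> real) \<Rightarrow> (nat \<Rightarrow> nat) pmf" where
  "random_matching f b x t = pmf_of_set (valid_matchings f b x t)"

definition rand_accuracy ::
    "'a measure \<Rightarrow> (real \<Rightarrow> real) \<Rightarrow> (nat \<Rightarrow> 'a \<Rightarrow> real) \<Rightarrow> (nat \<Rightarrow> 'a \<Rightarrow> real) \<Rightarrow> ennreal" where
  "rand_accuracy M f X T =
     (\<Sum>n. let b = Suc n in
        \<integral>\<^sup>+ \<omega>. (let x = (\<lambda>i. X i \<omega>); t = (\<lambda>i. T i \<omega>) in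
                if busy_arrivals x t = enat b
                then ennreal (pmf (random_matching f b x t) (true_matching b x t)) else 0) \<partial>M)"

definition prob_busy_one ::
    "'a measure \<Rightarrow> (nat \<Rightarrow> 'a \<Rightarrow> real) \<Rightarrow> (nat \<Rightarrow> 'a \<Rightarrow> real) \<Rightarrow> real" where
  "prob_busy_one M X T = measure M {\<omega> \<in> space M. busy_arrivals (\<lambda>i. X i \<omega>) (\<lambda>i. T i \<omega>) = 1}"

definition positive_with_pdf :: "'a measure \<Rightarrow> ('a \<Rightarrow> real) \<Rightarrow> (real \<Rightarrow> real) \<Rightarrow> bool" where
  "positive_with_pdf M Z f \<longleftrightarrow>
     (\<forall>x. 0 \<le> f x) \<and> (\<forall>x\<le>0. f x = 0) \<and> distributed M lborel Z (\<lambda>x. ennreal (f x))"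

text \<open>
  The independence of the joint family over \<open>nat + nat\<close> means that each of the two sequences
  consists of independent variables and that the sequences are independent of each other.
  The pdf \<open>f\<close> of the inter-arrival times vanishes on the nonpositive reals; as for the
  exponential law, it need only be continuous on the positive half-line.
\<close>

definition queue_input ::
    "'a measure \<Rightarrow> (nat \<Rightarrow> 'a \<Rightarrow> real) \<Rightarrow> (nat \<Rightarrow> 'a \<Rightarrow> real) \<Rightarrow> (real \<Rightarrow> real) \<Rightarrow> (real \<Rightarrow> real) \<Rightarrow> bool"
  where
  "queue_input M X S f g \<longleftrightarrow>
     prob_space M \<and>
     (\<forall>i. positive_with_pdf M (X i) f) \<and> continuous_on {0<..} f \<and>
     (\<forall>i. positive_with_pdf M (S i) g) \<and>
     prob_space.indep_vars M (\<lambda>_. borel) (case_sum X S) (UNIV :: (nat + nat) set)"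

definition processor_sharing_queue ::
    "'a measure \<Rightarrow> (nat \<Rightarrow> 'a \<Rightarrow> real) \<Rightarrow> (nat \<Rightarrow> 'a \<Rightarrow> real) \<Rightarrow> (nat \<Rightarrow> 'a \<Rightarrow> real) \<Rightarrow>
      (real \<Rightarrow> real) \<Rightarrow> (real \<Rightarrow> real) \<Rightarrow> bool" where
  "processor_sharing_queue M X J T f g \<longleftrightarrow>
     queue_input M X J f g \<and>
     (\<forall>i. T i \<in> borel_measurable M) \<and>
     (AE \<omega> in M. processor_sharing_path (\<lambda>i. X i \<omega>) (\<lambda>i. J i \<omega>) (\<lambda>i. T i \<omega>))"

definition infinite_server_queue ::
    "'a measure \<Rightarrow> (nat \<Rightarrow> 'a \<Rightarrow> real) \<Rightarrow> (nat \<Rightarrow> 'a \<Rightarrow> real) \<Rightarrow> (real \<Rightarrow> real) \<Rightarrow> (real \<Rightarrow> real) \<Rightarrow> bool"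
  where
  "infinite_server_queue M X T f g \<longleftrightarrow> queue_input M X T f g \<and> continuous_on {0<..} g"

text \<open>
  In the processor-sharing queue started empty the sojourn times are not identically distributed.
  \<open>f_T\<close> is a pdf of the sojourn time of a typical job, that is, of the steady-state law
  \<open>A \<mapsto> E (number of i < B with T i \<in> A) / E B\<close>, where \<open>B\<close> is the number of arrivals in a
  busy period.  The mean of \<open>B\<close> is finite when the load factor is less than one.
\<close>

definition typical_sojourn_pdf ::
    "'a measure \<Rightarrow> (nat \<Rightarrow> 'a \<Rightarrow> real) \<Rightarrow> (nat \<Rightarrow> 'a \<Rightarrow> real) \<Rightarrow> (real \<Rightarrow> real) \<Rightarrow> bool" where
  "typical_sojourn_pdf M X T f \<longleftrightarrow>
     f \<in> borel_measurable borel \<and> (\<forall>x. 0 \<le> f x) \<and>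
     (\<forall>A\<in>sets borel.
        (\<integral>\<^sup>+ \<omega>. (\<Sum>i. if enat i < busy_arrivals (\<lambda>k. X k \<omega>) (\<lambda>k. T k \<omega>)
                     then indicator A (T i \<omega>) else 0) \<partial>M) =
        (\<integral>\<^sup>+ \<omega>. ennreal_of_enat (busy_arrivals (\<lambda>k. X k \<omega>) (\<lambda>k. T k \<omega>)) \<partial>M) *
        (\<integral>\<^sup>+ x. ennreal (f x) * indicator A x \<partial>lborel))"

definition load_factor ::
    "'a measure \<Rightarrow> (nat \<Rightarrow> 'a \<Rightarrow> real) \<Rightarrow> (nat \<Rightarrow> 'a \<Rightarrow> real) \<Rightarrow> ennreal" where
  "load_factor M X S = (\<integral>\<^sup>+ \<omega>. ennreal (S 0 \<omega>) \<partial>M) / (\<integral>\<^sup>+ \<omega>. ennreal (X 0 \<omega>) \<partial>M)"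

definition law_support :: "'a measure \<Rightarrow> ('a \<Rightarrow> real) \<Rightarrow> real set" where
  "law_support M Z = {x. \<forall>e>0. measure M {\<omega> \<in> space M. \<bar>Z \<omega> - x\<bar> < e} > 0}"

definition st_le ::
    "'a measure \<Rightarrow> ('a \<Rightarrow> real) \<Rightarrow> 'b measure \<Rightarrow> ('b \<Rightarrow> real) \<Rightarrow> bool" where
  "st_le M Z N W \<longleftrightarrow>
     (\<forall>\<phi> :: real \<Rightarrow> real. mono \<phi> \<and> integrable M (\<lambda>\<omega>. \<phi> (Z \<omega>)) \<and> integrable N (\<lambda>\<omega>. \<phi> (W \<omega>)) \<longrightarrow>
        (\<integral>\<omega>. \<phi> (Z \<omega>) \<partial>M) \<le> (\<integral>\<omega>. \<phi> (W \<omega>) \<partial>N))"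

end

theory Submission
  imports Defs
begin

text \<open>
  Count the assignments \<open>p\<close> of departures to arrivals in the busy period with
  \<open>departure (p i) - arrival i \<ge> \<alpha>\<close>.  This count grows, and the busy period gets longer, when gaps
  shrink and sojourn times (all at least \<open>\<alpha>\<close>) grow.  A job spends at least its length in the
  processor-sharing queue, so quantile coupling of the inputs shows that the expected reciprocal
  count is at most that of the infinite-server queue.  There every valid matching is counted, as
  service times are at least \<open>\<alpha>' \<ge> \<alpha>\<close>.

  It remains to see that in the processor-sharing queue every counted matching is valid, that is,
  \<open>f_T\<close> is positive at the relevant differences almost surely.  If gaps can be shorter than
  \<open>\<beta>\<close>, then work can build up, and since the load is below one it can also drain, so a job may
  find arbitrarily little or arbitrarily much work; by continuity its sojourn time reaches every
  subset of \<open>(\<alpha>, \<infinity>)\<close> of positive measure, and \<open>f_T > 0\<close> almost everywhere there.  Otherwise every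
  busy period has a single job.
\<close>

section \<open>Independent families of real random variables\<close>

text \<open>Sojourn times in the processor-sharing queue are dependent, each a function of many
  inputs, so they cannot be coupled with independent service times. Only the inputs are coupled: on
  the processor-sharing side the sojourn times are first replaced by the smaller job lengths on the
  same sample path, which leaves two families of independent variables to compare. The hard point is
  the positivity of \<open>f_T\<close>. This pdf is determined only up to null sets and is not known
  to be continuous, so two facts are needed: the differences of departure and arrival times avoid
  every Lebesgue null set, and above \<open>\<alpha>\<close> the zeros of \<open>f_T\<close> form a
  null set. For the second, the path equation gives sojourn times only implicitly;
  \<open>vtime\<close> and \<open>sojourn_upto\<close> make them explicit Lipschitz functions of
  finitely many inputs. The input that is varied is a gap: gaps have a continuous density, positive
  on an interval, whereas job lengths have just some pdf, and their support only says that they come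
  close to each point between the bounds with positive probability.\<close>

lemma nn_integral_PiM_law:
  fixes Z :: "'i \<Rightarrow> 'a \<Rightarrow> real"
  assumes M: "prob_space M" and ind: "prob_space.indep_vars M (\<lambda>_. borel) Z UNIV"
    and g: "g \<in> borel_measurable (PiM UNIV (\<lambda>_. borel))"
  shows "(\<integral>\<^sup>+\<omega>. g (\<lambda>s. Z s \<omega>) \<partial>M) = (\<integral>\<^sup>+z. g z \<partial>PiM UNIV (\<lambda>s. distr M borel (Z s)))"
proof -
  interpret prob_space M by fact
  have Z: "Z s \<in> borel_measurable M" for s
    using ind by (auto simp: indep_vars_def)
  have "distr M (PiM UNIV (\<lambda>_. borel)) (\<lambda>\<omega>. \<lambda>s\<in>UNIV. Z s \<omega>) = PiM UNIV (\<lambda>s. distr M borel (Z s))"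
    using ind Z by (subst (asm) indep_vars_iff_distr_eq_PiM) auto
  then have "(\<integral>\<^sup>+z. g z \<partial>PiM UNIV (\<lambda>s. distr M borel (Z s))) =
      (\<integral>\<^sup>+z. g z \<partial>distr M (PiM UNIV (\<lambda>_. borel)) (\<lambda>\<omega>. \<lambda>s\<in>UNIV. Z s \<omega>))"
    by simp
  also have "\<dots> = (\<integral>\<^sup>+\<omega>. g (\<lambda>s\<in>UNIV. Z s \<omega>) \<partial>M)"
    by (rule nn_integral_distr) (use Z g in \<open>auto intro!: measurable_restrict\<close>)
  finally show ?thesis by (simp add: restrict_UNIV)
qed

text \<open>Quantile coupling. Both families are realized on one product of copies of the uniform
  law on (0, 1), coordinate \<open>s\<close> through the quantile functions of \<open>Z s\<close>
  and \<open>W s\<close>. The smaller distribution function has the larger quantile function, so the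
  coordinates are ordered pointwise, and by \<open>nn_integral_PiM_law\<close> the integrals are
  unchanged.\<close>

lemma nn_integral_mono_coupling:
  fixes Z :: "'i \<Rightarrow> 'a \<Rightarrow> real" and W :: "'i \<Rightarrow> 'b \<Rightarrow> real"
  assumes M: "prob_space M" and N: "prob_space N"
    and indZ: "prob_space.indep_vars M (\<lambda>_. borel) Z UNIV"
    and indW: "prob_space.indep_vars N (\<lambda>_. borel) W UNIV"
    and le: "\<And>s c. measure N {\<omega>\<in>space N. W s \<omega> \<le> c} \<le> measure M {\<omega>\<in>space M. Z s \<omega> \<le> c}"
    and g: "g \<in> borel_measurable (PiM UNIV (\<lambda>_. borel))"
    and mono: "\<And>z w. (\<And>s. z s \<le> w s) \<Longrightarrow> g z \<le> g w"
  shows "(\<integral>\<^sup>+\<omega>. g (\<lambda>s. Z s \<omega>) \<partial>M) \<le> (\<integral>\<^sup>+\<omega>. g (\<lambda>s. W s \<omega>) \<partial>N)"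
proof -
  interpret M: prob_space M by fact
  interpret N: prob_space N by fact
  have Z[measurable]: "Z s \<in> borel_measurable M" for s
    using indZ by (auto simp: M.indep_vars_def)
  have W[measurable]: "W s \<in> borel_measurable N" for s
    using indW by (auto simp: N.indep_vars_def)
  define \<mu> where "\<mu> s = distr M borel (Z s)" for s
  define \<nu> where "\<nu> s = distr N borel (W s)" for s
  interpret \<mu>: cdf_distribution "\<mu> s" for s
    unfolding cdf_distribution_def \<mu>_def by (intro M.real_distribution_distr) simp
  interpret \<nu>: cdf_distribution "\<nu> s" for s
    unfolding cdf_distribution_def \<nu>_def by (intro N.real_distribution_distr) simp
  define U :: "real measure" where "U = restrict_space lborel {0<..<1}"
  interpret U: prob_space U
    by (auto simp add: U_def emeasure_restrict_space space_restrict_space intro!: prob_spaceI)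
  define P where "P = PiM (UNIV :: 'i set) (\<lambda>_. U)"
  interpret P: prob_space P
    unfolding P_def by (intro prob_space_PiM U.prob_space_axioms)
  have cdf_le: "cdf (\<nu> s) c \<le> cdf (\<mu> s) c" for s c
    using le[of s c] by (simp add: cdf_def2 \<mu>_def \<nu>_def measure_distr vimage_def Int_def conj_commute)
  define qZ where "qZ s u = Inf {x. u \<le> cdf (\<mu> s) x}" for s u
  define qW where "qW s u = Inf {x. u \<le> cdf (\<nu> s) x}" for s u
  have sU: "space U = {0<..<1}"
    by (simp add: U_def space_restrict_space)
  have q_le: "qZ s u \<le> qW s u" if "u \<in> space U" for s u
  proof -
    have u: "0 < u" "u < 1" using that sU by auto
    have "u \<le> cdf (\<nu> s) (qW s u)"
      using \<nu>.pseudoinverse[OF u] unfolding qW_def by blast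
    then have "u \<le> cdf (\<mu> s) (qW s u)" using cdf_le order_trans by blast
    then show ?thesis using \<mu>.pseudoinverse[OF u] unfolding qZ_def by blast
  qed
  have seq: "sets U = sets (restrict_space borel {0<..<1})"
    unfolding U_def by (intro sets_restrict_space_cong) simp
  have mqZ[measurable]: "qZ s \<in> borel_measurable U" for s
    unfolding qZ_def measurable_cong_sets[OF seq refl] by (rule \<mu>.measurable_CI)
  have mqW[measurable]: "qW s \<in> borel_measurable U" for s
    unfolding qW_def measurable_cong_sets[OF seq refl] by (rule \<nu>.measurable_CI)
  have dZ: "distr U borel (qZ s) = \<mu> s" for s
    unfolding U_def qZ_def by (rule \<mu>.distr_I_eq_M)
  have dW: "distr U borel (qW s) = \<nu> s" for s
    unfolding U_def qW_def by (rule \<nu>.distr_I_eq_M)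
  have coord: "P.indep_vars (\<lambda>_. U) (\<lambda>s \<omega>. \<omega> s) (UNIV :: 'i set)"
  proof (subst P.indep_vars_iff_distr_eq_PiM)
    show "distr P (PiM UNIV (\<lambda>_. U)) (\<lambda>x. \<lambda>i\<in>UNIV. x i) = PiM UNIV (\<lambda>i. distr P U (\<lambda>\<omega>. \<omega> i))"
      unfolding P_def
      by (simp add: distr_PiM_component[OF U.prob_space_axioms] restrict_UNIV distr_id)
  qed (auto simp: P_def)
  have comp: "distr P U (\<lambda>\<omega>. \<omega> s) = U" for s
    unfolding P_def by (rule distr_PiM_component) (auto intro: U.prob_space_axioms)
  have mc[measurable]: "(\<lambda>\<omega>. \<omega> s) \<in> measurable P U" for s
    unfolding P_def by simp
  have iZ: "P.indep_vars (\<lambda>_. borel) (\<lambda>s \<omega>. qZ s (\<omega> s)) UNIV"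
    by (rule P.indep_vars_compose2[OF coord]) simp
  have iW: "P.indep_vars (\<lambda>_. borel) (\<lambda>s \<omega>. qW s (\<omega> s)) UNIV"
    by (rule P.indep_vars_compose2[OF coord]) simp
  have lZ: "distr P borel (\<lambda>\<omega>. qZ s (\<omega> s)) = \<mu> s" for s
    using distr_distr[OF mqZ[of s] mc[of s]] unfolding comp dZ comp_def by simp
  have lW: "distr P borel (\<lambda>\<omega>. qW s (\<omega> s)) = \<nu> s" for s
    using distr_distr[OF mqW[of s] mc[of s]] unfolding comp dW comp_def by simp
  have "(\<integral>\<^sup>+\<omega>. g (\<lambda>s. Z s \<omega>) \<partial>M) = (\<integral>\<^sup>+\<omega>. g (\<lambda>s. qZ s (\<omega> s)) \<partial>P)"
    unfolding nn_integral_PiM_law[OF M indZ g] nn_integral_PiM_law[OF P.prob_space_axioms iZ g] lZ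
    by (simp add: \<mu>_def)
  also have "\<dots> \<le> (\<integral>\<^sup>+\<omega>. g (\<lambda>s. qW s (\<omega> s)) \<partial>P)"
    by (intro nn_integral_mono mono q_le) (auto simp: P_def space_PiM PiE_def)
  also have "\<dots> = (\<integral>\<^sup>+\<omega>. g (\<lambda>s. W s \<omega>) \<partial>N)"
    unfolding nn_integral_PiM_law[OF N indW g] nn_integral_PiM_law[OF P.prob_space_axioms iW g] lW
    by (simp add: \<nu>_def)
  finally show ?thesis .
qed

text \<open>Coordinate \<open>a\<close> may be resampled: it is independent of the remaining ones,
  so the joint law is a product and Fubini's theorem for null sets applies.\<close>

lemma AE_indep_vars_update:
  fixes Z :: "'i \<Rightarrow> 'a \<Rightarrow> real"
  assumes M: "prob_space M" and ind: "prob_space.indep_vars M (\<lambda>_. borel) Z UNIV"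
    and Q: "Measurable.pred (PiM UNIV (\<lambda>_. borel)) Q"
  shows "(AE \<omega> in M. Q (\<lambda>s. Z s \<omega>)) \<longleftrightarrow>
         (AE \<omega> in M. AE y in distr M borel (Z a). Q ((\<lambda>s. Z s \<omega>)(a := y)))"
proof -
  interpret prob_space M by fact
  have Z[measurable]: "Z s \<in> borel_measurable M" for s
    using ind by (auto simp: indep_vars_def)
  define R where "R = PiM (UNIV - {a}) (\<lambda>_::'i. borel :: real measure)"
  define r where "r \<omega> = (\<lambda>s\<in>UNIV - {a}. Z s \<omega>)" for \<omega>
  define y where "y \<omega> = (\<lambda>s\<in>{a}. Z s \<omega>)" for \<omega>
  have mr[measurable]: "r \<in> measurable M R"
    unfolding r_def R_def by (rule measurable_restrict) simp
  \<comment> \<open>A product over a singleton index set, the form that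
    \<open>indep_var_restrict\<close> provides; \<open>G\<close> below reassembles the two
    pieces.\<close>
  define B where "B = PiM {a} (\<lambda>_::'i. borel :: real measure)"
  have my[measurable]: "y \<in> measurable M B"
    unfolding y_def B_def by (rule measurable_restrict) simp
  have iv: "indep_var R r B y"
    unfolding R_def r_def y_def B_def by (rule indep_var_restrict[OF ind]) auto
  have my_a[measurable]: "(\<lambda>u. u a) \<in> borel_measurable B"
    unfolding B_def by simp
  define D where "D = distr M R r"
  define L where "L = distr M B y"
  interpret D: prob_space D unfolding D_def by (rule prob_space_distr) simp
  interpret L: prob_space L unfolding L_def by (rule prob_space_distr) simp
  interpret DL: pair_prob_space D L ..
  have eq: "D \<Otimes>\<^sub>M L = distr M (R \<Otimes>\<^sub>M B) (\<lambda>\<omega>. (r \<omega>, y \<omega>))"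
    using indep_var_distribution_eq[THEN iffD1, OF iv] unfolding D_def L_def by simp
  define G where "G q = (\<lambda>s. if s = a then snd q a else fst q s)" for q :: "('i \<Rightarrow> real) \<times> ('i \<Rightarrow> real)"
  have G: "G \<in> measurable (R \<Otimes>\<^sub>M B) (PiM UNIV (\<lambda>_. borel))"
  proof (rule measurable_PiM_single')
    fix i :: 'i
    show "(\<lambda>q. G q i) \<in> borel_measurable (R \<Otimes>\<^sub>M B)"
      unfolding G_def R_def by (cases "i = a") auto
  qed auto
  have QG: "Measurable.pred (R \<Otimes>\<^sub>M B) (\<lambda>q. Q (G q))"
    using measurable_compose[OF G Q] .
  have sDL: "sets (D \<Otimes>\<^sub>M L) = sets (R \<Otimes>\<^sub>M B)"
    unfolding D_def L_def by simp
  have QG': "Measurable.pred (D \<Otimes>\<^sub>M L) (\<lambda>q. Q (G q))"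
    using QG measurable_cong_sets[OF sDL refl] by blast
  have G1: "G (r \<omega>, y \<omega>) = (\<lambda>s. Z s \<omega>)" for \<omega>
    by (auto simp: G_def r_def y_def)
  have G2: "G (r \<omega>, u) = (\<lambda>s. Z s \<omega>)(a := u a)" for \<omega> u
    by (auto simp: G_def r_def)
  have "(AE \<omega> in M. Q (\<lambda>s. Z s \<omega>)) \<longleftrightarrow> (AE q in D \<Otimes>\<^sub>M L. Q (G q))"
    unfolding eq using QG by (subst AE_distr_iff) (auto simp: G1 pred_def)
  also have "\<dots> \<longleftrightarrow> (AE p in D. AE u in L. Q (G (p, u)))"
    using DL.AE_pair_iff[of "\<lambda>x y. Q (G (x, y))"] QG' by (simp add: pred_def)
  also have "\<dots> \<longleftrightarrow> (AE \<omega> in M. AE u in L. Q (G (r \<omega>, u)))"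
  proof -
    have "{p \<in> space R. AE u in L. Q (G (p, u))} \<in> sets R"
    proof -
      have S: "{q\<in>space (R \<Otimes>\<^sub>M L). \<not> Q (G q)} \<in> sets (R \<Otimes>\<^sub>M L)"
      proof -
        have "Measurable.pred (R \<Otimes>\<^sub>M L) (\<lambda>q. Q (G q))"
          using QG measurable_cong_sets[of "R \<Otimes>\<^sub>M L" "R \<Otimes>\<^sub>M B"] unfolding L_def by auto
        then have "Measurable.pred (R \<Otimes>\<^sub>M L) (\<lambda>q. \<not> Q (G q))" by measurable
        then show ?thesis by (simp add: pred_def)
      qed
      note m = L.measurable_emeasure_Pair[OF S]
      have "{p \<in> space R. AE u in L. Q (G (p, u))} = {p \<in> space R.
          emeasure L (Pair p -` {q\<in>space (R \<Otimes>\<^sub>M L). \<not> Q (G q)}) = 0}"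
      proof (intro Collect_cong conj_cong refl)
        fix p assume p: "p \<in> space R"
        have "(\<lambda>u. (p, u)) \<in> measurable L (R \<Otimes>\<^sub>M L)" using p by simp
        from measurable_sets[OF this S]
        have "{u\<in>space L. \<not> Q (G (p, u))} \<in> sets L"
          using p by (simp add: vimage_def Int_def space_pair_measure conj_commute)
        then show "(AE u in L. Q (G (p, u))) \<longleftrightarrow>
          emeasure L (Pair p -` {q\<in>space (R \<Otimes>\<^sub>M L). \<not> Q (G q)}) = 0"
          using p by (subst AE_iff_measurable[OF _ refl]) (auto simp: space_pair_measure intro!: arg_cong2[where f=emeasure])
      qed
      then show ?thesis using m by simp
    qed
    then show ?thesis unfolding D_def by (subst AE_distr_iff) auto
  qed
  also have "\<dots> \<longleftrightarrow> (AE \<omega> in M. AE y in distr M borel (Z a). Q ((\<lambda>s. Z s \<omega>)(a := y)))"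
  proof -
    have "(AE v in L. Q (G (r \<omega>, v))) \<longleftrightarrow> (AE u in distr M borel (Z a). Q ((\<lambda>s. Z s \<omega>)(a := u)))" for \<omega>
    proof -
      have "distr M borel (Z a) = distr L borel (\<lambda>u. u a)"
        unfolding L_def by (subst distr_distr) (auto simp: comp_def y_def)
      moreover have "Measurable.pred borel (\<lambda>u. Q ((\<lambda>s. Z s \<omega>)(a := u)))"
      proof -
        have "(\<lambda>u. (\<lambda>s. Z s \<omega>)(a := u)) \<in> measurable borel (PiM UNIV (\<lambda>_. borel))"
          by (rule measurable_PiM_single') (auto simp: fun_upd_def)
        from measurable_compose[OF this Q] show ?thesis .
      qed
      ultimately show ?thesis
        unfolding G2 by (simp only:, subst AE_distr_iff) (auto simp: pred_def L_def)
    qed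
    then show ?thesis by simp
  qed
  finally show ?thesis .
qed

lemma prob_indep_box_pos:
  fixes Z :: "'i \<Rightarrow> 'a \<Rightarrow> real"
  assumes M: "prob_space M" and ind: "prob_space.indep_vars M (\<lambda>_. borel) Z UNIV"
    and S: "finite S" and A: "\<And>s. s \<in> S \<Longrightarrow> A s \<in> sets borel"
    and pos: "\<And>s. s \<in> S \<Longrightarrow> 0 < measure M {\<omega>\<in>space M. Z s \<omega> \<in> A s}"
  shows "0 < measure M {\<omega>\<in>space M. \<forall>s\<in>S. Z s \<omega> \<in> A s}"
proof (cases "S = {}")
  case True
  interpret prob_space M by fact
  show ?thesis using True by (simp add: prob_space)
next
  case False
  interpret prob_space M by fact
  have eq: "Z s -` A s \<inter> space M = {\<omega>\<in>space M. Z s \<omega> \<in> A s}" for s by auto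
  have "prob (\<Inter>s\<in>S. Z s -` A s \<inter> space M) = (\<Prod>s\<in>S. prob (Z s -` A s \<inter> space M))"
    by (rule indep_varsD[OF ind False S]) (use A in auto)
  also have "\<dots> > 0" unfolding eq by (intro prod_pos pos) auto
  also have "(\<Inter>s\<in>S. Z s -` A s \<inter> space M) = {\<omega>\<in>space M. \<forall>s\<in>S. Z s \<omega> \<in> A s}"
    using False by auto
  finally show ?thesis .
qed

section \<open>Processor-sharing paths\<close>

lemma arrival_0 [simp]: "arrival x 0 = 0"
  by (simp add: arrival_def)

lemma arrival_Suc: "arrival x (Suc n) = arrival x n + x n"
  by (simp add: arrival_def)

lemma arrival_diff: "i \<le> k \<Longrightarrow> arrival x k - arrival x i = (\<Sum>l\<in>{i..<k}. x l)"
  unfolding arrival_def by (simp add: sum_diff_nat_ivl lessThan_atLeast0)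

lemma arrival_strict_mono:
  assumes "\<And>i. 0 < x i"
  shows "strict_mono (arrival x)"
  unfolding strict_mono_Suc_iff using assms by (simp add: arrival_Suc)

text \<open>The case \<open>n = 0\<close>, with \<open>1 / 0 = 0\<close>, covers the value that
  \<open>card\<close> takes on infinite sets.\<close>

lemma inverse_of_nat_le_1: "1 / real n \<le> 1"
  by (cases n) auto

text \<open>Replaces the infimum by finitely many comparisons of departure and arrival times, from
  which measurability and monotonicity of the busy period can be read off.\<close>

lemma less_busy_arrivals_iff:
  "enat k < busy_arrivals x t \<longleftrightarrow> (\<forall>b. 1 \<le> b \<and> b \<le> k \<longrightarrow> (\<exists>i<b. arrival x b < departure x t i))"
  (is "_ \<longleftrightarrow> ?R")
proof -
  let ?A = "{b. 1 \<le> b \<and> (\<forall>i<b. departure x t i \<le> arrival x b)}"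
  have R: "?R \<longleftrightarrow> (\<forall>b\<in>?A. k < b)"
    unfolding mem_Collect_eq Ball_def not_le[symmetric] by blast
  show ?thesis
  proof
    assume k: "enat k < busy_arrivals x t"
    have "k < b" if "b \<in> ?A" for b
    proof -
      have "busy_arrivals x t \<le> enat b"
        unfolding busy_arrivals_def using that by (intro Inf_lower) auto
      with k have "enat k < enat b" by (rule less_le_trans)
      then show ?thesis by simp
    qed
    then show ?R using R by blast
  next
    assume ?R
    then have "\<forall>b\<in>?A. k < b" using R by blast
    then have "enat (Suc k) \<le> busy_arrivals x t"
      unfolding busy_arrivals_def by (intro Inf_greatest) auto
    then show "enat k < busy_arrivals x t"
      by (rule less_le_trans[rotated]) simp
  qed
qed

lemma busy_arrivals_eq_iff:
  "busy_arrivals x t = enat b \<longleftrightarrow>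
     1 \<le> b \<and> (\<forall>i<b. departure x t i \<le> arrival x b) \<and>
     (\<forall>b'<b. 1 \<le> b' \<longrightarrow> (\<exists>i<b'. arrival x b' < departure x t i))"
proof (cases b)
  case 0
  have "enat 0 < busy_arrivals x t" by (subst less_busy_arrivals_iff) simp
  then show ?thesis using 0 by auto
next
  case (Suc k)
  have "busy_arrivals x t = enat b \<longleftrightarrow> enat k < busy_arrivals x t \<and> \<not> enat b < busy_arrivals x t"
  proof
    assume "enat k < busy_arrivals x t \<and> \<not> enat b < busy_arrivals x t"
    then have "enat b \<le> busy_arrivals x t" "busy_arrivals x t \<le> enat b"
      using Suc ileI1[of "enat k"] by (auto simp: eSuc_enat)
    then show "busy_arrivals x t = enat b" by simp
  qed (use Suc in auto)
  also have "\<dots> \<longleftrightarrow> (\<forall>b'. 1 \<le> b' \<and> b' \<le> k \<longrightarrow> (\<exists>i<b'. arrival x b' < departure x t i)) \<and>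
      \<not> (\<exists>i<b. arrival x b < departure x t i)"
  proof -
    have "1 \<le> b' \<and> b' \<le> b \<longleftrightarrow> 1 \<le> b' \<and> b' \<le> k \<or> b' = b" for b'
      using Suc by auto
    then show ?thesis unfolding less_busy_arrivals_iff by blast
  qed
  also have "\<dots> \<longleftrightarrow> 1 \<le> b \<and> (\<forall>i<b. departure x t i \<le> arrival x b) \<and>
     (\<forall>b'<b. 1 \<le> b' \<longrightarrow> (\<exists>i<b'. arrival x b' < departure x t i))"
  proof -
    have "b' \<le> k \<longleftrightarrow> b' < b" for b' using Suc by auto
    moreover have "1 \<le> b" using Suc by simp
    ultimately show ?thesis unfolding not_less[symmetric] by blast
  qed
  finally show ?thesis .
qed

text \<open>Before the arrival of job \<open>k\<close>, take the last arrival \<open>i\<close> up to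
  time \<open>s\<close>. The busy period does not end at the arrival of job \<open>Suc i\<close>, so
  some job up to \<open>i\<close> is still present then, hence also at \<open>s\<close>.\<close>

lemma no_idle_before_departure:
  assumes x: "\<And>i. 0 < x i" and k: "enat k < busy_arrivals x t"
    and s: "0 \<le> s" "s < departure x t k"
  shows "\<exists>i. arrival x i \<le> s \<and> s < departure x t i"
proof (cases "arrival x k \<le> s")
  case False
  note mono = strict_monoD[OF arrival_strict_mono[of x, OF x]]
  let ?P = "\<lambda>i. arrival x i \<le> s"
  have bd: "\<forall>i. ?P i \<longrightarrow> i \<le> k"
    using False mono by (metis linorder_not_less order_less_le_trans less_imp_le)
  define i where "i = (GREATEST i. ?P i)"
  have i: "?P i" unfolding i_def
    by (rule GreatestI_nat[of ?P 0 k]) (use s bd in auto)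
  have "\<not> ?P (Suc i)"
    using Greatest_le_nat[of ?P "Suc i" k] bd unfolding i_def by auto
  moreover have "i \<noteq> k" using i False by auto
  ultimately obtain i' where "i' < Suc i" "arrival x (Suc i) < departure x t i'"
    using k[unfolded less_busy_arrivals_iff, rule_format, of "Suc i"] bd i by force
  moreover have "arrival x i' \<le> arrival x i"
    using mono[of i' i] \<open>i' < Suc i\<close> by (cases "i' = i") auto
  ultimately show ?thesis using i \<open>\<not> ?P (Suc i)\<close> by (intro exI[of _ i']) auto
qed (use s in auto)

text \<open>\<open>processor_sharing_path\<close> does not mention the sign of \<open>t i\<close>;
  if it were not positive, the integral over an empty or one-point interval would be 0 and not the
  positive length.\<close>

lemma sojourn_pos:
  assumes path: "processor_sharing_path x j t" and j: "\<And>i. 0 < j i"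
  shows "0 < t i"
proof (rule ccontr)
  assume "\<not> 0 < t i"
  then have "departure x t i \<le> arrival x i" by (simp add: departure_def)
  moreover have h: "((\<lambda>s. 1 / real (card (jobs_present x t s))) has_integral j i) {arrival x i..departure x t i}"
    using path by (auto simp: processor_sharing_path_def)
  ultimately have "((\<lambda>s. 1 / real (card (jobs_present x t s))) has_integral 0) {arrival x i..departure x t i}"
    by (intro has_integral_null_real) auto
  from has_integral_unique[OF h this] j[of i] show False by simp
qed

lemma length_le_sojourn:
  assumes path: "processor_sharing_path x j t" and j: "\<And>i. 0 < j i"
  shows "j i \<le> t i"
proof -
  have h: "((\<lambda>s. 1 / real (card (jobs_present x t s))) has_integral j i) {arrival x i..departure x t i}"
    using path by (auto simp: processor_sharing_path_def)
  have c: "((\<lambda>_. 1) has_integral t i) {arrival x i..departure x t i}"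
    using has_integral_const_real[of "1::real" "arrival x i" "departure x t i"] sojourn_pos[OF path j, of i]
    by (simp add: departure_def)
  show ?thesis
    by (rule has_integral_le[OF h c]) (rule inverse_of_nat_le_1)
qed

section \<open>The virtual clock of a path\<close>

text \<open>
  \<open>v s\<close> is the service that a job present throughout \<open>[0, s]\<close> receives, so a job arriving at \<open>a\<close>
  leaves when \<open>v\<close> reaches \<open>v a + j i\<close>.  The last clause is work conservation: as long as the server
  does not idle, the service handed out up to \<open>s\<close> is \<open>s\<close>.
\<close>

definition virtual_clock ::
    "(nat \<Rightarrow> real) \<Rightarrow> (nat \<Rightarrow> real) \<Rightarrow> (nat \<Rightarrow> real) \<Rightarrow> nat \<Rightarrow> real \<Rightarrow> (real \<Rightarrow> real) \<Rightarrow> bool" where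
  "virtual_clock x j t m H v \<longleftrightarrow>
     v 0 = 0 \<and>
     (\<forall>s s'. 0 \<le> s \<longrightarrow> s \<le> s' \<longrightarrow> s' \<le> H \<longrightarrow> v s \<le> v s') \<and>
     (\<forall>i. departure x t i \<le> H \<longrightarrow> v (departure x t i) = v (arrival x i) + j i) \<and>
     (\<forall>i s. arrival x i \<le> s \<longrightarrow> s \<le> H \<longrightarrow> s \<le> departure x t i \<longrightarrow> v s \<le> v (arrival x i) + j i) \<and>
     (\<forall>s. 0 \<le> s \<longrightarrow> s \<le> H \<longrightarrow> (\<Sum>i | i < m \<and> arrival x i \<le> s. min (j i) (v s - v (arrival x i))) = s)"

lemma virtual_clockD:
  assumes "virtual_clock x j t m H v"
  shows "v 0 = 0"
    "\<And>s s'. 0 \<le> s \<Longrightarrow> s \<le> s' \<Longrightarrow> s' \<le> H \<Longrightarrow> v s \<le> v s'"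
    "\<And>i. departure x t i \<le> H \<Longrightarrow> v (departure x t i) = v (arrival x i) + j i"
    "\<And>i s. arrival x i \<le> s \<Longrightarrow> s \<le> H \<Longrightarrow> s \<le> departure x t i \<Longrightarrow> v s \<le> v (arrival x i) + j i"
    "\<And>s. 0 \<le> s \<Longrightarrow> s \<le> H \<Longrightarrow> (\<Sum>i | i < m \<and> arrival x i \<le> s. min (j i) (v s - v (arrival x i))) = s"
  using assms unfolding virtual_clock_def by blast+

text \<open>The clock is the integral of the service rate \<open>1 / n\<close>. Integrating the sum
  of the service rates of all jobs gives work conservation, since that sum is 1 as long as some job
  is present.\<close>

lemma virtual_clock_exists:
  fixes x j t :: "nat \<Rightarrow> real"
  assumes path: "processor_sharing_path x j t"
    and x: "\<And>i. 0 < x i" and j: "\<And>i. 0 < j i"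
    and k: "enat k < busy_arrivals x t" and H: "0 \<le> H" "H \<le> arrival x m" "H \<le> departure x t k"
  shows "\<exists>v. virtual_clock x j t m H v"
proof -
  let ?a = "arrival x" and ?d = "departure x t"
  have busy: "\<exists>i. ?a i \<le> s \<and> s < ?d i" if "0 \<le> s" "s < H" for s
    using no_idle_before_departure[of x k t s, OF x k] that H by simp
  note am = strict_monoD[OF arrival_strict_mono[of x, OF x]]
  have a0: "0 \<le> ?a i" for i
    using am[of 0 i] by (cases "i = 0") auto
  have t0: "0 < t i" for i by (rule sojourn_pos[OF path j])
  have ad: "?a i < ?d i" for i using t0[of i] by (simp add: departure_def)
  define r where "r s = 1 / real (card (jobs_present x t s))" for s
  have r0: "0 \<le> r s" for s by (simp add: r_def)
  have hr: "(r has_integral j i) {?a i..?d i}" for i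
    using path by (auto simp: processor_sharing_path_def r_def[abs_def])
  have lt_m: "i < m" if "?a i \<le> s" "s < H" for i s
  proof (rule ccontr)
    assume "\<not> i < m"
    then have "?a m \<le> ?a i" using am[of m i] by (cases "m = i") auto
    then show False using that H by simp
  qed
  \<comment> \<open>Before \<open>H\<close> only jobs below \<open>m\<close> have arrived, so
    \<open>r\<close> agrees there with this reciprocal of a step function, which is measurable and
    bounded.\<close>
  define q where "q s = 1 / (\<Sum>i<m. indicator {?a i..<?d i} s :: real)" for s
  have sum_ind: "(\<Sum>i<m. indicator {?a i..<?d i} s :: real) = real (card {i. i < m \<and> ?a i \<le> s \<and> s < ?d i})" for s
  proof -
    have "(\<Sum>i<m. indicator {?a i..<?d i} s :: real) = (\<Sum>i\<in>{i\<in>{..<m}. s \<in> {?a i..<?d i}}. 1)"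
      unfolding indicator_def of_bool_def by (subst sum.inter_filter) auto
    also have "\<dots> = real (card {i. i < m \<and> ?a i \<le> s \<and> s < ?d i})"
      unfolding sum_constant by (auto intro!: arg_cong[where f=card])
    finally show ?thesis .
  qed
  have rq: "r s = q s" if "s < H" for s
  proof -
    have "jobs_present x t s = {i. i < m \<and> ?a i \<le> s \<and> s < ?d i}"
      unfolding jobs_present_def using lt_m that by auto
    then have "real (card (jobs_present x t s)) = (\<Sum>i<m. indicator {?a i..<?d i} s)"
      using sum_ind by simp
    then show ?thesis by (simp add: r_def q_def)
  qed
  have qb: "\<bar>q s\<bar> \<le> 1" for s
  proof -
    note sum_ind[of s]
    then show ?thesis unfolding q_def using inverse_of_nat_le_1 by simp
  qed
  have "set_integrable lborel {0..H} q"
    unfolding set_integrable_def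
  proof (rule Bochner_Integration.integrable_bound)
    show "integrable lborel (\<lambda>s. indicator {0..H} s *\<^sub>R (1::real))"
      using H by (simp add: integrable_real_indicator)
    show "(\<lambda>s. indicator {0..H} s *\<^sub>R q s) \<in> borel_measurable lborel"
      unfolding q_def by measurable
  qed (use qb in \<open>auto simp: indicator_def\<close>)
  then have "q integrable_on {0..H}" by (rule set_borel_integral_eq_integral)
  then have rH: "r integrable_on {0..H}"
    by (rule integrable_spike_finite[of "{H}", rotated 2]) (auto intro: rq)
  have rint: "r integrable_on {a..b}" if "0 \<le> a" "b \<le> H" for a b
    by (rule integrable_on_subinterval[OF rH]) (use that in auto)
  define v where "v s = integral {0..s} r" for s
  have vdiff: "v b - v a = integral {a..b} r" if "0 \<le> a" "a \<le> b" "b \<le> H" for a b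
    using Henstock_Kurzweil_Integration.integral_combine[of 0 a b r] that rint[of 0 b]
    by (simp add: v_def)
  have v0: "v 0 = 0" by (simp add: v_def)
  have vmono: "v s \<le> v s'" if "0 \<le> s" "s \<le> s'" "s' \<le> H" for s s'
    using vdiff[OF that] integral_nonneg[of r "{s..s'}"] rint[of s s'] that r0 by auto
  have vd: "v (?d i) = v (?a i) + j i" if "?d i \<le> H" for i
    using vdiff[of "?a i" "?d i"] a0 ad[of i] that integral_unique[OF hr[of i]] by simp
  have vle: "v s \<le> v (?a i) + j i" if "?a i \<le> s" "s \<le> H" "s \<le> ?d i" for i s
  proof -
    have "integral {?a i..s} r \<le> integral {?a i..?d i} r"
      by (rule integral_subset_le) (use that a0 hr[of i] rint in \<open>auto simp: r0\<close>)
    then show ?thesis using vdiff[of "?a i" s] a0[of i] that integral_unique[OF hr[of i]] by simp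
  qed
  have work: "(\<Sum>i | i < m \<and> ?a i \<le> s. min (j i) (v s - v (?a i))) = s" if s: "0 \<le> s" "s \<le> H" for s
  proof -
    let ?I = "{i. i < m \<and> ?a i \<le> s}"
    have "((\<lambda>u. if u \<in> {?a i..min (?d i) s} then r u else 0) has_integral
        min (j i) (v s - v (?a i))) {0..s}" if i: "i \<in> ?I" for i
    proof -
      have "integral {?a i..min (?d i) s} r = min (j i) (v s - v (?a i))"
      proof (cases "?d i \<le> s")
        case True
        then show ?thesis
          using vd[of i] vmono[of "?d i" s] s integral_unique[OF hr[of i]] ad[of i] a0[of i] by simp
      next
        case False
        then show ?thesis using vle[of i s] s i vdiff[of "?a i" s] a0[of i] by simp
      qed
      moreover have "r integrable_on {?a i..min (?d i) s}"
        using a0 s by (intro rint) auto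
      ultimately have "(r has_integral min (j i) (v s - v (?a i))) {?a i..min (?d i) s}"
        using integrable_integral by metis
      then show ?thesis
        by (subst has_integral_restrict) (use a0[of i] s in auto)
    qed
    then have 1: "((\<lambda>u. \<Sum>i\<in>?I. if u \<in> {?a i..min (?d i) s} then r u else 0) has_integral
        (\<Sum>i\<in>?I. min (j i) (v s - v (?a i)))) {0..s}"
      by (intro has_integral_sum) auto
    \<comment> \<open>The rates of the jobs present add up to 1. Departure times and
      \<open>s\<close> are exceptional because the intervals are closed on the right, while a job is
      absent at its departure.\<close>
    have 2: "((\<lambda>u. \<Sum>i\<in>?I. if u \<in> {?a i..min (?d i) s} then r u else 0) has_integral s) {0..s}"
    proof (rule has_integral_spike_finite)
      show "finite (insert s (?d ` ?I))" by simp
      show "((\<lambda>_. 1) has_integral s) {0..s}"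
        using has_integral_const_real[of "1::real" 0 s] s by simp
      fix u assume u: "u \<in> {0..s} - insert s (?d ` ?I)"
      then have us: "u < s" by auto
      have eq: "jobs_present x t u = {i \<in> ?I. u \<in> {?a i..min (?d i) s}}"
        unfolding jobs_present_def using u us lt_m[of _ u] s by force
      obtain i where "i \<in> jobs_present x t u"
        using busy[of u] u us s by (auto simp: jobs_present_def)
      moreover have "finite (jobs_present x t u)" unfolding eq by simp
      ultimately have "card (jobs_present x t u) \<noteq> 0" by auto
      then have "real (card (jobs_present x t u)) * r u = 1" by (simp add: r_def)
      moreover have "(\<Sum>i\<in>?I. if u \<in> {?a i..min (?d i) s} then r u else 0) = real (card (jobs_present x t u)) * r u"
        unfolding eq by (subst sum.inter_filter[symmetric]) auto
      ultimately show "(\<Sum>i\<in>?I. if u \<in> {?a i..min (?d i) s} then r u else 0) = 1" by simp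
    qed
    from has_integral_unique[OF 1 2] show ?thesis .
  qed
  have "virtual_clock x j t m H v"
    unfolding virtual_clock_def using v0 vmono vd vle work by blast
  then show ?thesis by blast
qed

section \<open>Clock and sojourn time as functions of the input\<close>

definition served :: "(nat \<Rightarrow> real) \<Rightarrow> (nat \<Rightarrow> real) \<Rightarrow> nat \<Rightarrow> real \<Rightarrow> real" where
  "served j a l v = (\<Sum>i<l. min (j i) (v - a i))"

lemma served_mono: "u \<le> v \<Longrightarrow> served j a l u \<le> served j a l v"
  unfolding served_def by (intro sum_mono) auto

lemma served_le: "served j a l v \<le> (\<Sum>i<l. j i)"
  unfolding served_def by (intro sum_mono) auto

text \<open>An unfinished job contributes slope 1, and no other term decreases. The terms of
  \<open>served\<close> are not cut off at 0, so this holds even below the starting value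
  \<open>a i\<close>.\<close>

lemma served_slope:
  assumes "u \<le> v" "i < l" "v \<le> a i + j i"
  shows "v - u \<le> served j a l v - served j a l u"
proof -
  have "v - u = (\<Sum>k<l. if k = i then v - u else 0)" using assms by (simp add: sum.delta)
  also have "\<dots> \<le> (\<Sum>k<l. min (j k) (v - a k) - min (j k) (u - a k))"
    by (intro sum_mono) (use assms in auto)
  finally show ?thesis by (simp add: served_def sum_subtractf)
qed

lemma served_inj:
  assumes "served j a l u = served j a l v" "i < l" "u \<le> a i + j i" "i' < l" "v \<le> a i' + j i'"
  shows "u = v"
proof (cases "u \<le> v")
  case True
  then show ?thesis using served_slope[of u v i' l a j] assms by simp
next
  case False
  then show ?thesis using served_slope[of v u i l a j] assms by simp
qed

text \<open>
  \<open>busy_time x j l\<close> and \<open>vtime x j l\<close> are the busy time of the server and the virtual clock at the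
  arrival of job \<open>l\<close>, computed from the input alone.  The virtual clock stops while the server
  idles, which keeps \<open>vtime\<close> well defined beyond the first busy period.
\<close>

fun busy_time :: "(nat \<Rightarrow> real) \<Rightarrow> (nat \<Rightarrow> real) \<Rightarrow> nat \<Rightarrow> real" where
  "busy_time x j 0 = 0"
| "busy_time x j (Suc l) = min (busy_time x j l + x l) (\<Sum>i<Suc l. j i)"

fun vtime :: "(nat \<Rightarrow> real) \<Rightarrow> (nat \<Rightarrow> real) \<Rightarrow> nat \<Rightarrow> real" where
  "vtime x j l = Inf {v. 0 \<le> v \<and> busy_time x j l \<le> (\<Sum>i<l. min (j i) (v - vtime x j i))}"

declare vtime.simps [simp del]

lemma vtime_served: "vtime x j l = Inf {v. 0 \<le> v \<and> busy_time x j l \<le> served j (vtime x j) l v}"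
  by (subst vtime.simps) (simp add: served_def)

text \<open>Job \<open>k\<close> leaves when the clock shows \<open>vtime x j k + j k\<close>. The
  sum is the service that jobs below \<open>K\<close> have received by then; without idling this is
  the departure time. Jobs from \<open>K\<close> on are ignored, which is correct if job
  \<open>k\<close> leaves before job \<open>K\<close> arrives.\<close>

definition sojourn_upto :: "(nat \<Rightarrow> real) \<Rightarrow> (nat \<Rightarrow> real) \<Rightarrow> nat \<Rightarrow> nat \<Rightarrow> real" where
  "sojourn_upto x j K k =
     (\<Sum>i<K. max 0 (min (j i) (vtime x j k + j k - vtime x j i))) - arrival x k"

lemma busy_time_le_work: "busy_time x j l \<le> (\<Sum>i<l. j i)"
  by (cases l) auto

lemma vtime_0 [simp]: "vtime x j 0 = 0"
proof -
  have "{v::real. 0 \<le> v} = {0..}" by auto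
  then show ?thesis by (subst vtime_served) (simp add: served_def)
qed

text \<open>The infimum is attained and solves the equation exactly: \<open>served\<close> is
  continuous, and its slope is at least 1 until every job is finished. The facts are proved together
  because the induction step uses the monotonicity and the exact value for the previous job.\<close>

lemma vtime_spec:
  assumes x: "\<And>i. 0 \<le> x i" and j: "\<And>i. 0 \<le> j i"
  shows "served j (vtime x j) l (vtime x j l) = busy_time x j l \<and>
         (\<forall>i\<le>l. vtime x j i \<le> vtime x j l) \<and>
         (l \<noteq> 0 \<longrightarrow> (\<exists>i<l. vtime x j l \<le> vtime x j i + j i)) \<and>
         {v. 0 \<le> v \<and> busy_time x j l \<le> served j (vtime x j) l v} = {vtime x j l..}"
proof (induction l)
  case 0
  show ?case by (auto simp: served_def)
next
  case (Suc n)
  let ?V = "vtime x j" and ?Z = "busy_time x j"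
  let ?G = "served j ?V (Suc n)"
  let ?S = "{v. 0 \<le> v \<and> ?Z (Suc n) \<le> ?G v}"
  have Vn: "?V i \<le> ?V n" if "i \<le> n" for i using Suc.IH that by blast
  have V0: "0 \<le> ?V n" using Vn[of 0] by simp
  \<comment> \<open>The reading at which all jobs up to \<open>n\<close> are finished; there
    \<open>served\<close> is the total work, an upper bound of \<open>busy_time\<close>.\<close>
  define M where "M = Max ((\<lambda>i. ?V i + j i) ` {..n})"
  have M: "?V i + j i \<le> M" if "i \<le> n" for i
    unfolding M_def using that by (intro Max_ge) auto
  obtain i0 where i0: "i0 \<le> n" "M = ?V i0 + j i0"
  proof -
    have "M \<in> (\<lambda>i. ?V i + j i) ` {..n}" unfolding M_def by (rule Max_in) auto
    then show ?thesis using that by auto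
  qed
  have "?G M = (\<Sum>i<Suc n. j i)"
    unfolding served_def using M by (intro sum.cong) (auto simp: less_Suc_eq_le min_def algebra_simps)
  then have GM: "?Z (Suc n) \<le> ?G M" by simp
  \<comment> \<open>Job \<open>n\<close> has received nothing at its own arrival.\<close>
  have "?G (?V n) = served j ?V n (?V n) + min (j n) 0" by (simp add: served_def)
  also have "\<dots> = ?Z n" using Suc.IH j[of n] by simp
  also have "\<dots> \<le> ?Z (Suc n)"
    using busy_time_le_work[of x j n] x[of n] j[of n] by simp
  finally have Gn: "?G (?V n) \<le> ?Z (Suc n)" .
  have nM: "?V n \<le> M" using M[of n] j[of n] by simp
  have cont: "continuous_on UNIV ?G"
    unfolding served_def by (intro continuous_intros)
  obtain v where v: "?V n \<le> v" "v \<le> M" "?G v = ?Z (Suc n)"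
    using IVT'[of ?G "?V n" "?Z (Suc n)" M] Gn GM nM continuous_on_subset[OF cont] by auto
  have S: "?S = {v..}"
  proof (intro set_eqI iffI)
    fix w assume w: "w \<in> ?S"
    show "w \<in> {v..}"
    proof (rule ccontr)
      assume "w \<notin> {v..}"
      then have "w < v" by simp
      then have "v - w \<le> ?G v - ?G w"
        using v i0 by (intro served_slope[of _ _ i0]) auto
      then show False using w v \<open>w < v\<close> by simp
    qed
  next
    fix w assume "w \<in> {v..}"
    then show "w \<in> ?S" using served_mono[of v w j ?V "Suc n"] v V0 by auto
  qed
  have eq: "?V (Suc n) = v"
    unfolding vtime_served[of x j "Suc n"] S by simp
  have "\<forall>i\<le>Suc n. ?V i \<le> ?V (Suc n)"
    using Vn v(1) unfolding eq by (auto simp: le_Suc_eq eq intro: order_trans)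
  then show ?case using v i0 S unfolding eq by auto
qed

lemma
  assumes "\<And>i. 0 \<le> x i" and "\<And>i. 0 \<le> j i"
  shows served_vtime: "served j (vtime x j) l (vtime x j l) = busy_time x j l"
    and vtime_mono: "i \<le> l \<Longrightarrow> vtime x j i \<le> vtime x j l"
    and vtime_le_finish: "l \<noteq> 0 \<Longrightarrow> \<exists>i<l. vtime x j l \<le> vtime x j i + j i"
    and vtime_le_iff: "vtime x j l \<le> v \<longleftrightarrow> 0 \<le> v \<and> busy_time x j l \<le> served j (vtime x j) l v"
  using vtime_spec[where x=x and j=j and l=l, OF assms] by (auto simp: set_eq_iff)

section \<open>Lipschitz dependence on the input\<close>

lemma busy_time_lipschitz:
  assumes "\<And>i. i < l \<Longrightarrow> \<bar>x i - x' i\<bar> \<le> d" "\<And>i. i < l \<Longrightarrow> \<bar>j i - j' i\<bar> \<le> d"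
  shows "\<bar>busy_time x j l - busy_time x' j' l\<bar> \<le> real l * d"
  using assms
proof (induction l)
  case (Suc l)
  have "\<bar>busy_time x j l - busy_time x' j' l\<bar> \<le> real l * d" using Suc by auto
  moreover have "\<bar>x l - x' l\<bar> \<le> d" using Suc.prems by auto
  moreover have "\<bar>(\<Sum>i<Suc l. j i) - (\<Sum>i<Suc l. j' i)\<bar> \<le> real (Suc l) * d"
  proof -
    have "\<bar>(\<Sum>i<Suc l. j i) - (\<Sum>i<Suc l. j' i)\<bar> \<le> (\<Sum>i<Suc l. \<bar>j i - j' i\<bar>)"
      unfolding sum_subtractf[symmetric] by (rule sum_abs)
    also have "\<dots> \<le> (\<Sum>i<Suc l. d)" using Suc.prems by (intro sum_mono) auto
    finally show ?thesis by simp
  qed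
  moreover have "real (Suc l) * d = real l * d + d" by (simp add: algebra_simps)
  ultimately show ?case unfolding busy_time.simps by linarith
qed simp

lemma abs_min_diff_le: "\<bar>min a b - min a' b'\<bar> \<le> \<bar>a - a'\<bar> + \<bar>b - b'\<bar>" for a b :: real
  by (auto simp: min_def)

lemma abs_max_0_diff_le: "\<bar>max 0 a - max 0 b\<bar> \<le> \<bar>a - b\<bar>" for a b :: real
  by (auto simp: max_def)

definition input_lipschitz ::
    "nat \<Rightarrow> ((nat \<Rightarrow> real) \<Rightarrow> (nat \<Rightarrow> real) \<Rightarrow> real) \<Rightarrow> real \<Rightarrow> bool" where
  "input_lipschitz n F C \<longleftrightarrow>
     (\<forall>x j x' j' d. (\<forall>i. 0 \<le> x i \<and> 0 \<le> j i \<and> 0 \<le> x' i \<and> 0 \<le> j' i) \<longrightarrow>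
        (\<forall>i<n. \<bar>x i - x' i\<bar> \<le> d \<and> \<bar>j i - j' i\<bar> \<le> d) \<longrightarrow> \<bar>F x j - F x' j'\<bar> \<le> C * d)"

lemma input_lipschitzD:
  "input_lipschitz n F C \<Longrightarrow> \<forall>i. 0 \<le> x i \<and> 0 \<le> j i \<and> 0 \<le> x' i \<and> 0 \<le> j' i \<Longrightarrow>
    \<forall>i<n. \<bar>x i - x' i\<bar> \<le> d \<and> \<bar>j i - j' i\<bar> \<le> d \<Longrightarrow> \<bar>F x j - F x' j'\<bar> \<le> C * d"
  unfolding input_lipschitz_def by blast

text \<open>Since \<open>served\<close> has slope at least 1, the error of its solution
  \<open>vtime\<close> is at most the error of \<open>busy_time\<close> plus that of
  \<open>served\<close> at a fixed argument, and the latter is controlled by earlier values of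
  \<open>vtime\<close>. The slope bound needs an unfinished job, which exists on the side with the
  larger clock; the other case follows by symmetry.\<close>

lemma vtime_lipschitz: "\<exists>C\<ge>0. input_lipschitz l (\<lambda>x j. vtime x j l) C"
proof (induction l rule: less_induct)
  case (less l)
  then have "\<forall>i\<in>{..<l}. \<exists>C. 0 \<le> C \<and> input_lipschitz i (\<lambda>x j. vtime x j i) C" by blast
  from bchoice[OF this] obtain c where c: "\<And>i. i < l \<Longrightarrow> 0 \<le> c i"
    and cl: "\<And>i. i < l \<Longrightarrow> input_lipschitz i (\<lambda>x j. vtime x j i) (c i)" by blast
  define C where "C = real l + (\<Sum>i<l. c i + 1)"
  have one_sided: "vtime x j l - vtime x' j' l \<le> C * d"
    if pos: "\<forall>i. 0 \<le> x i \<and> 0 \<le> j i \<and> 0 \<le> x' i \<and> 0 \<le> j' i"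
      and d: "\<forall>i<l. \<bar>x i - x' i\<bar> \<le> d \<and> \<bar>j i - j' i\<bar> \<le> d" for x j x' j' d
  proof (cases "l = 0 \<or> vtime x j l \<le> vtime x' j' l")
    case True
    \<comment> \<open>For \<open>l = 0\<close> the number \<open>d\<close> is arbitrary, even
      negative, but then \<open>C = 0\<close>.\<close>
    have "0 \<le> C * d"
    proof (cases "l = 0")
      case False
      then have "0 \<le> d" using d[rule_format, of 0] by auto
      then show ?thesis unfolding C_def using c by (intro mult_nonneg_nonneg add_nonneg_nonneg sum_nonneg) auto
    qed (simp add: C_def)
    moreover have "vtime x j l - vtime x' j' l \<le> 0" using True by auto
    ultimately show ?thesis by linarith
  next
    case False
    let ?v = "vtime x j l" and ?v' = "vtime x' j' l"
    obtain i where i: "i < l" "?v \<le> vtime x j i + j i"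
      using vtime_le_finish[of x j l] False pos by auto
    have "?v - ?v' \<le> served j (vtime x j) l ?v - served j (vtime x j) l ?v'"
      using False i by (intro served_slope[of _ _ i]) auto
    also have "served j (vtime x j) l ?v = busy_time x j l"
      using pos by (intro served_vtime) auto
    also have "busy_time x j l - served j (vtime x j) l ?v' =
        (busy_time x j l - busy_time x' j' l) +
        (served j' (vtime x' j') l ?v' - served j (vtime x j) l ?v')"
      using served_vtime[of x' j' l] pos by auto
    also have "busy_time x j l - busy_time x' j' l \<le> real l * d"
      using busy_time_lipschitz[of l x x' d j j'] d by fastforce
    also have "served j' (vtime x' j') l ?v' - served j (vtime x j) l ?v' \<le> (\<Sum>i<l. (c i + 1) * d)"
      unfolding served_def sum_subtractf[symmetric]
    proof (intro sum_mono)
      fix i assume "i \<in> {..<l}"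
      then have "\<bar>vtime x j i - vtime x' j' i\<bar> \<le> c i * d" "\<bar>j i - j' i\<bar> \<le> d"
        using input_lipschitzD[OF cl[of i] pos, of d] d by auto
      then show "min (j' i) (?v' - vtime x' j' i) - min (j i) (?v' - vtime x j i) \<le> (c i + 1) * d"
        using abs_min_diff_le[of "j' i" "?v' - vtime x' j' i" "j i" "?v' - vtime x j i"]
        by (simp add: algebra_simps abs_minus_commute)
    qed
    also have "real l * d + (\<Sum>i<l. (c i + 1) * d) = C * d"
      by (simp add: C_def algebra_simps sum_distrib_left)
    finally show ?thesis by simp
  qed
  have "0 \<le> C" unfolding C_def using c by (intro add_nonneg_nonneg sum_nonneg) auto
  moreover have "\<bar>vtime x j l - vtime x' j' l\<bar> \<le> C * d"
    if pos: "\<forall>i. 0 \<le> x i \<and> 0 \<le> j i \<and> 0 \<le> x' i \<and> 0 \<le> j' i"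
      and d: "\<forall>i<l. \<bar>x i - x' i\<bar> \<le> d \<and> \<bar>j i - j' i\<bar> \<le> d" for x j x' j' d
  proof -
    have "vtime x j l - vtime x' j' l \<le> C * d" by (rule one_sided[OF pos d])
    moreover have "vtime x' j' l - vtime x j l \<le> C * d"
      using pos d by (intro one_sided) (auto simp: abs_minus_commute)
    ultimately show ?thesis by linarith
  qed
  ultimately show ?case unfolding input_lipschitz_def by blast
qed

lemma sojourn_upto_lipschitz:
  assumes k: "k < K"
  shows "\<exists>C>0. input_lipschitz K (\<lambda>x j. sojourn_upto x j K k) C"
proof -
  have "\<forall>i. \<exists>C. 0 \<le> C \<and> input_lipschitz i (\<lambda>x j. vtime x j i) C" using vtime_lipschitz by blast
  from choice[OF this] obtain c where c: "\<And>i. 0 \<le> c i"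
    and cl: "\<And>i. input_lipschitz i (\<lambda>x j. vtime x j i) (c i)" by blast
  \<comment> \<open>The final 1 makes \<open>C\<close> positive; \<open>sojourn_hits\<close> divides
    by it.\<close>
  define C where "C = (\<Sum>i<K. c k + c i + 2) + real k + 1"
  have "0 < C" unfolding C_def using c by (intro add_nonneg_pos add_nonneg_nonneg sum_nonneg) auto
  moreover have "\<bar>sojourn_upto x j K k - sojourn_upto x' j' K k\<bar> \<le> C * d"
    if pos: "\<forall>i. 0 \<le> x i \<and> 0 \<le> j i \<and> 0 \<le> x' i \<and> 0 \<le> j' i"
      and d: "\<forall>i<K. \<bar>x i - x' i\<bar> \<le> d \<and> \<bar>j i - j' i\<bar> \<le> d" for x j x' j' d
  proof -
    have d0: "0 \<le> d" using d[rule_format, OF k] by auto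
    have lip: "\<bar>vtime x j i - vtime x' j' i\<bar> \<le> c i * d" if "i < K" for i
      using input_lipschitzD[OF cl[of i] pos, of d] d that by auto
    let ?f = "\<lambda>x j i. max 0 (min (j i) (vtime x j k + j k - vtime x j i))"
    have "\<bar>(\<Sum>i<K. ?f x j i) - (\<Sum>i<K. ?f x' j' i)\<bar> \<le> (\<Sum>i<K. \<bar>?f x j i - ?f x' j' i\<bar>)"
      unfolding sum_subtractf[symmetric] by (rule sum_abs)
    also have "\<dots> \<le> (\<Sum>i<K. (c k + c i + 2) * d)"
    proof (intro sum_mono)
      fix i assume i: "i \<in> {..<K}"
      have eq: "(c k + c i + 2) * d = c k * d + c i * d + d + d" by (simp add: algebra_simps)
      have v: "\<bar>vtime x j k - vtime x' j' k\<bar> \<le> c k * d" "\<bar>vtime x j i - vtime x' j' i\<bar> \<le> c i * d"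
        using lip i k by auto
      have j: "\<bar>j i - j' i\<bar> \<le> d" "\<bar>j k - j' k\<bar> \<le> d" using d i k by auto
      have "\<bar>?f x j i - ?f x' j' i\<bar> \<le>
          \<bar>min (j i) (vtime x j k + j k - vtime x j i) - min (j' i) (vtime x' j' k + j' k - vtime x' j' i)\<bar>"
        by (rule abs_max_0_diff_le)
      also have "\<dots> \<le> \<bar>j i - j' i\<bar> +
          \<bar>(vtime x j k + j k - vtime x j i) - (vtime x' j' k + j' k - vtime x' j' i)\<bar>"
        by (rule abs_min_diff_le)
      also have "\<dots> \<le> d + (c k * d + d + c i * d)"
        using v j by (intro add_mono) (auto simp: abs_le_iff)
      finally show "\<bar>?f x j i - ?f x' j' i\<bar> \<le> (c k + c i + 2) * d"
        unfolding eq by simp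
    qed
    also have "\<dots> = (\<Sum>i<K. c k + c i + 2) * d" by (simp add: sum_distrib_right)
    finally have 1: "\<bar>(\<Sum>i<K. ?f x j i) - (\<Sum>i<K. ?f x' j' i)\<bar> \<le> (\<Sum>i<K. c k + c i + 2) * d" .
    have "\<bar>arrival x k - arrival x' k\<bar> \<le> (\<Sum>i<k. \<bar>x i - x' i\<bar>)"
      unfolding arrival_def sum_subtractf[symmetric] by (rule sum_abs)
    also have "\<dots> \<le> (\<Sum>i<k. d)" using d k by (intro sum_mono) auto
    finally have 2: "\<bar>arrival x k - arrival x' k\<bar> \<le> real k * d" by simp
    have "C * d = (\<Sum>i<K. c k + c i + 2) * d + real k * d + d"
      by (simp add: C_def algebra_simps)
    then show ?thesis using 1 2 d0 unfolding sojourn_upto_def by linarith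
  qed
  ultimately show ?thesis unfolding input_lipschitz_def by blast
qed

section \<open>Measurability in the input\<close>

lemma busy_time_measurable:
  assumes [measurable]: "\<And>i. (\<lambda>\<omega>. x \<omega> i) \<in> borel_measurable M" "\<And>i. (\<lambda>\<omega>. j \<omega> i) \<in> borel_measurable M"
  shows "(\<lambda>\<omega>. busy_time (x \<omega>) (j \<omega>) l) \<in> borel_measurable M"
  by (induction l) auto

text \<open>\<open>vtime_le_iff\<close> describes the sublevel sets through earlier clock values, so
  the infimum itself is avoided.\<close>

lemma vtime_measurable:
  assumes [measurable]: "\<And>i. (\<lambda>\<omega>. x \<omega> i) \<in> borel_measurable M" "\<And>i. (\<lambda>\<omega>. j \<omega> i) \<in> borel_measurable M"
    and pos: "\<And>\<omega> i. 0 \<le> x \<omega> i" "\<And>\<omega> i. 0 \<le> j \<omega> i"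
  shows "(\<lambda>\<omega>. vtime (x \<omega>) (j \<omega>) l) \<in> borel_measurable M"
proof (induction l rule: less_induct)
  case (less l)
  have [measurable]: "(\<lambda>\<omega>. busy_time (x \<omega>) (j \<omega>) l) \<in> borel_measurable M"
    by (rule busy_time_measurable) auto
  have [measurable]: "(\<lambda>\<omega>. served (j \<omega>) (vtime (x \<omega>) (j \<omega>)) l v) \<in> borel_measurable M" for v
    unfolding served_def using less by (intro borel_measurable_sum borel_measurable_min borel_measurable_diff) auto
  show ?case
    unfolding borel_measurable_iff_le by (subst vtime_le_iff) (use pos in auto)
qed

lemma sojourn_upto_measurable:
  assumes [measurable]: "\<And>i. (\<lambda>\<omega>. x \<omega> i) \<in> borel_measurable M" "\<And>i. (\<lambda>\<omega>. j \<omega> i) \<in> borel_measurable M"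
    and pos: "\<And>\<omega> i. 0 \<le> x \<omega> i" "\<And>\<omega> i. 0 \<le> j \<omega> i"
  shows "(\<lambda>\<omega>. sojourn_upto (x \<omega>) (j \<omega>) K k) \<in> borel_measurable M"
proof -
  have [measurable]: "(\<lambda>\<omega>. vtime (x \<omega>) (j \<omega>) l) \<in> borel_measurable M" for l
    by (rule vtime_measurable) (use pos in auto)
  show ?thesis unfolding sojourn_upto_def arrival_def by measurable
qed

section \<open>Bounds for the sojourn time of one job\<close>

lemma busy_time_eq_arrival:
  assumes "\<And>l. 1 \<le> l \<Longrightarrow> l \<le> k \<Longrightarrow> arrival x l \<le> (\<Sum>i<l. j i)"
  shows "busy_time x j k = arrival x k"
  using assms
proof (induction k)
  case (Suc k)
  have "busy_time x j k = arrival x k" using Suc by auto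
  then show ?case using Suc.prems[of "Suc k"] by (simp add: arrival_Suc)
qed simp

text \<open>By \<open>clear\<close> all jobs up to \<open>k\<close> are finished when job
  \<open>Suc k\<close> arrives, so later jobs take no service before job \<open>k\<close> leaves,
  and the service handed out is at most the work brought by the jobs up to \<open>k\<close>.\<close>

lemma sojourn_upto_le:
  assumes x: "\<And>i. 0 \<le> x i" and j: "\<And>i. 0 \<le> j i" and k: "k < K"
    and work: "\<And>l. 1 \<le> l \<Longrightarrow> l \<le> k \<Longrightarrow> arrival x l \<le> (\<Sum>i<l. j i)"
    and clear: "(\<Sum>i<Suc k. j i) \<le> arrival x (Suc k)"
  shows "sojourn_upto x j K k \<le> (\<Sum>i<Suc k. j i) - arrival x k"
proof -
  let ?V = "vtime x j"
  have Z: "busy_time x j (Suc k) = (\<Sum>i<Suc k. j i)"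
    using clear busy_time_eq_arrival[of k x j, OF work] by (simp add: arrival_Suc)
  \<comment> \<open>The busy time is the entire work, so no term of \<open>served\<close> stays
    below its cap.\<close>
  have "?V i + j i \<le> ?V (Suc k)" if i: "i < Suc k" for i
  proof (rule ccontr)
    assume "\<not> ?V i + j i \<le> ?V (Suc k)"
    then have "served j ?V (Suc k) (?V (Suc k)) < (\<Sum>i<Suc k. j i)"
      unfolding served_def using i
      by (intro sum_strict_mono_ex1 bexI[of _ i]) (auto simp: algebra_simps min_def)
    then show False using served_vtime[of x j "Suc k", OF x j] Z by simp
  qed
  from this[of k] have late: "?V k + j k \<le> ?V i" if "Suc k \<le> i" for i
    using vtime_mono[of x j "Suc k" i, OF x j that] by simp
  have "(\<Sum>i<K. max 0 (min (j i) (?V k + j k - ?V i))) = (\<Sum>i<Suc k. max 0 (min (j i) (?V k + j k - ?V i)))"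
  proof (rule sum.mono_neutral_right)
    show "\<forall>i\<in>{..<K} - {..<Suc k}. max 0 (min (j i) (?V k + j k - ?V i)) = 0"
    proof
      fix i assume "i \<in> {..<K} - {..<Suc k}"
      then have "?V k + j k - ?V i \<le> 0" using late[of i] by simp
      then show "max 0 (min (j i) (?V k + j k - ?V i)) = 0" by (simp add: min.coboundedI2)
    qed
  qed (use k in auto)
  also have "\<dots> \<le> (\<Sum>i<Suc k. j i)"
    using j by (intro sum_mono) auto
  finally show ?thesis by (simp add: sojourn_upto_def)
qed

text \<open>While job \<open>k\<close> receives \<open>j k\<close>, a job with remaining work
  \<open>r\<close> receives the smaller of \<open>r\<close> and \<open>j k\<close>. As neither
  exceeds \<open>J\<close>, this is at least \<open>j k / J * r\<close>, and the remaining work adds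
  up to \<open>(\<Sum>i<k. j i) - arrival x k\<close>.\<close>

lemma sojourn_upto_ge:
  assumes x: "\<And>i. 0 \<le> x i" and j: "\<And>i. 0 \<le> j i" and k: "k < K"
    and work: "\<And>l. 1 \<le> l \<Longrightarrow> l \<le> k \<Longrightarrow> arrival x l \<le> (\<Sum>i<l. j i)"
    and J: "0 < J" "\<And>i. i \<le> k \<Longrightarrow> j i \<le> J"
  shows "j k / J * ((\<Sum>i<k. j i) - arrival x k) \<le> sojourn_upto x j K k"
proof -
  let ?V = "vtime x j"
  have Z: "(\<Sum>i<k. min (j i) (?V k - ?V i)) = arrival x k"
    using served_vtime[of x j k, OF x j] busy_time_eq_arrival[of k x j, OF work] by (simp add: served_def)
  have "j k / J * ((\<Sum>i<k. j i) - arrival x k) = (\<Sum>i<k. j k / J * (j i - min (j i) (?V k - ?V i)))"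
    unfolding Z[symmetric] by (simp add: sum_subtractf sum_distrib_left right_diff_distrib)
  also have "\<dots> \<le> (\<Sum>i<k. max 0 (min (j i) (?V k + j k - ?V i)) - min (j i) (?V k - ?V i))"
  proof (intro sum_mono)
    fix i assume "i \<in> {..<k}"
    then have i: "?V i \<le> ?V k" "j i \<le> J" using vtime_mono[of x j i k, OF x j] J by auto
    define r where "r = j i - min (j i) (?V k - ?V i)"
    have r: "0 \<le> r" "r \<le> J" using i j[of i] unfolding r_def by auto
    have "j k * r \<le> j k * J" by (intro mult_left_mono r j)
    then have "j k / J * r \<le> j k" using J by (simp add: divide_le_eq)
    moreover have "j k * r \<le> J * r" by (intro mult_right_mono r J) simp
    then have "j k / J * r \<le> r" using J by (simp add: divide_le_eq mult.commute)
    ultimately have "j k / J * r \<le> min r (j k)" by simp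
    also have "\<dots> \<le> max 0 (min (j i) (?V k + j k - ?V i)) - min (j i) (?V k - ?V i)"
      unfolding r_def by auto
    finally show "j k / J * (j i - min (j i) (?V k - ?V i)) \<le>
        max 0 (min (j i) (?V k + j k - ?V i)) - min (j i) (?V k - ?V i)" by (simp add: r_def)
  qed
  also have "\<dots> = (\<Sum>i<k. max 0 (min (j i) (?V k + j k - ?V i))) - arrival x k"
    by (simp add: sum_subtractf Z)
  also have "\<dots> \<le> sojourn_upto x j K k"
    unfolding sojourn_upto_def using k by (intro diff_right_mono sum_mono2) auto
  finally show ?thesis .
qed

section \<open>Agreement of the path with the recursion\<close>

lemma arrival_less_iff:
  assumes "\<And>i. 0 < x i"
  shows "arrival x i < arrival x k \<longleftrightarrow> i < k"
  using strict_mono_less[OF arrival_strict_mono[of x]] assms by blast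

lemma arrival_le_iff:
  assumes "\<And>i. 0 < x i"
  shows "arrival x i \<le> arrival x k \<longleftrightarrow> i \<le> k"
  using strict_mono_less_eq[OF arrival_strict_mono[of x]] assms by blast

lemma arrival_nonneg:
  assumes "\<And>i. 0 < x i"
  shows "0 \<le> arrival x i"
  unfolding arrival_def using assms by (intro sum_nonneg) (auto intro: less_imp_le)

lemma arrival_departure_less:
  assumes "processor_sharing_path x j t" "\<And>i. 0 < j i"
  shows "arrival x i < departure x t i"
  using sojourn_pos[OF assms, of i] by (simp add: departure_def)

text \<open>If the busy period had only \<open>b \<le> k\<close> arrivals, work conservation would
  make its last departure equal to the work of the first \<open>b\<close> jobs, which exceeds
  \<open>arrival x b\<close> by assumption.\<close>

lemma less_busy_arrivals_if_work:
  fixes x j t :: "nat \<Rightarrow> real"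
  assumes path: "processor_sharing_path x j t" and x: "\<And>i. 0 < x i" and j: "\<And>i. 0 < j i"
    and work: "\<And>l. 1 \<le> l \<Longrightarrow> l \<le> k \<Longrightarrow> arrival x l < (\<Sum>i<l. j i)"
  shows "enat k < busy_arrivals x t"
proof (rule ccontr)
  assume "\<not> enat k < busy_arrivals x t"
  then obtain b where b: "busy_arrivals x t = enat b" "b \<le> k"
    by (cases "busy_arrivals x t") auto
  then have b1: "1 \<le> b" and dep: "\<And>i. i < b \<Longrightarrow> departure x t i \<le> arrival x b"
    unfolding busy_arrivals_eq_iff by auto
  define H where "H = Max (departure x t ` {..<b})"
  have "H \<in> departure x t ` {..<b}" unfolding H_def using b1 by (intro Max_in) (auto simp: lessThan_empty_iff)
  then obtain i0 where i0: "i0 < b" "H = departure x t i0" by auto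
  have H: "departure x t i \<le> H" if "i < b" for i
    unfolding H_def using that by (intro Max_ge) auto
  note ad = arrival_departure_less[OF path j]
  have H0: "0 \<le> H" using ad[of i0] arrival_nonneg[of x i0, OF x] i0 by simp
  have "enat i0 < busy_arrivals x t" using b i0 by simp
  from virtual_clock_exists[OF path x j this H0, of b] dep[OF i0(1)] i0(2)
  obtain v where v: "virtual_clock x j t b H v" by auto
  note mono = virtual_clockD(2)[OF v] and fin = virtual_clockD(3)[OF v] and wk = virtual_clockD(5)[OF v]
  have "H = (\<Sum>i | i < b \<and> arrival x i \<le> H. min (j i) (v H - v (arrival x i)))"
    using wk[of H] H0 by simp
  also have "\<dots> = (\<Sum>i<b. j i)"
  proof (rule sum.cong)
    have "arrival x i \<le> H" if "i < b" for i using H[OF that] ad[of i] by linarith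
    then show "{i. i < b \<and> arrival x i \<le> H} = {..<b}" by auto
    fix i assume "i \<in> {..<b}"
    then show "min (j i) (v H - v (arrival x i)) = j i"
      using mono[of "departure x t i" H] H[of i] fin[of i] ad[of i] arrival_nonneg[of x i, OF x] by simp
  qed
  finally show False using work[of b] b b1 dep[OF i0(1)] i0 by simp
qed

text \<open>Job \<open>l\<close> itself contributes 0 at its arrival, so the set of arrived jobs may
  be cut down to the indices below \<open>l\<close>, the form of \<open>served\<close>.\<close>

lemma virtual_clock_arrival:
  assumes v: "virtual_clock x j t m H v" and x: "\<And>i. 0 < x i" and j: "\<And>i. 0 < j i"
    and H: "H \<le> arrival x m" and l: "arrival x l \<le> H"
  shows "(\<Sum>i<l. min (j i) (v (arrival x l) - v (arrival x i))) = arrival x l"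
proof -
  have lm: "l \<le> m" using H l arrival_le_iff[of x l m, OF x] by auto
  have "arrival x l = (\<Sum>i | i < m \<and> arrival x i \<le> arrival x l. min (j i) (v (arrival x l) - v (arrival x i)))"
    using virtual_clockD(5)[OF v, of "arrival x l"] l arrival_nonneg[of x l, OF x] by simp
  also have "\<dots> = (\<Sum>i<l. min (j i) (v (arrival x l) - v (arrival x i)))"
  proof (rule sum.mono_neutral_right)
    show "\<forall>i\<in>{i. i < m \<and> arrival x i \<le> arrival x l} - {..<l}. min (j i) (v (arrival x l) - v (arrival x i)) = 0"
    proof
      fix i assume "i \<in> {i. i < m \<and> arrival x i \<le> arrival x l} - {..<l}"
      then have "i = l" by (simp add: arrival_le_iff[of x, OF x])
      then show "min (j i) (v (arrival x l) - v (arrival x i)) = 0" using j[of l] by simp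
    qed
  qed (use lm in \<open>auto simp: arrival_le_iff[of x, OF x]\<close>)
  finally show ?thesis by simp
qed

text \<open>Supplies the unfinished job that makes the equation for the clock at
  \<open>arrival x l\<close> uniquely solvable.\<close>

lemma virtual_clock_unfinished:
  assumes v: "virtual_clock x j t m H v" and x: "\<And>i. 0 < x i"
    and k: "enat k < busy_arrivals x t"
    and l: "l \<noteq> 0" "arrival x l \<le> H" and lk: "l \<le> k \<or> arrival x l < departure x t k"
  shows "\<exists>i<l. v (arrival x l) \<le> v (arrival x i) + j i"
proof -
  have "\<exists>i<l. arrival x l < departure x t i"
  proof (cases "l \<le> k")
    case True
    then show ?thesis using k l unfolding less_busy_arrivals_iff by auto
  next
    case False
    then show ?thesis using lk by (intro exI[of _ k]) auto
  qed
  then obtain i where "i < l" "arrival x l < departure x t i" by blast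
  then show ?thesis
    using virtual_clockD(4)[OF v, of i "arrival x l"] l arrival_less_iff[of x i l, OF x]
    by (intro exI[of _ i]) auto
qed

lemma arrival_le_work:
  fixes x j t :: "nat \<Rightarrow> real"
  assumes path: "processor_sharing_path x j t" and x: "\<And>i. 0 < x i" and j: "\<And>i. 0 < j i"
    and l: "enat l < busy_arrivals x t"
  shows "arrival x l \<le> (\<Sum>i<l. j i)"
proof -
  have "arrival x l \<le> departure x t l"
    using arrival_departure_less[of x j t l, OF path j] by simp
  from virtual_clock_exists[OF path x j l arrival_nonneg[of x l, OF x] order_refl this]
  obtain v where v: "virtual_clock x j t l (arrival x l) v" by blast
  have "(\<Sum>i<l. min (j i) (v (arrival x l) - v (arrival x i))) = arrival x l"
    using virtual_clock_arrival[OF v x j] by simp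
  moreover have "(\<Sum>i<l. min (j i) (v (arrival x l) - v (arrival x i))) \<le> (\<Sum>i<l. j i)"
    by (intro sum_mono) auto
  ultimately show ?thesis by simp
qed

text \<open>At every arrival before the departure of job \<open>k\<close>, the clock of the path
  solves the same equation as \<open>vtime\<close>, and \<open>served_inj\<close> makes the solution
  unique. Jobs that arrive later have a value of \<open>vtime\<close> of at least
  \<open>vtime x j k + j k\<close> and drop out of \<open>sojourn_upto\<close>. By
  \<open>less\<close>, job \<open>k\<close> leaves no later than job \<open>K\<close>
  arrives.\<close>

lemma sojourn_eq_sojourn_upto:
  fixes x j t :: "nat \<Rightarrow> real"
  assumes path: "processor_sharing_path x j t" and x: "\<And>i. 0 < x i" and j: "\<And>i. 0 < j i"
    and k: "enat k < busy_arrivals x t" and K: "k < K"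
    and less: "sojourn_upto x j K k < arrival x K - arrival x k"
  shows "t k = sojourn_upto x j K k"
proof -
  let ?a = "arrival x" and ?V = "vtime x j"
  note al = arrival_less_iff[of x, OF x] and ale = arrival_le_iff[of x, OF x] and a0 = arrival_nonneg[of x, OF x]
  have x': "\<And>i. 0 \<le> x i" and j': "\<And>i. 0 \<le> j i" using x j by (auto intro: less_imp_le)
  note Vmono = vtime_mono[of x j, OF x' j'] and Vserved = served_vtime[of x j, OF x' j']
  note Vfin = vtime_le_finish[of x j, OF x' j']
  have adk: "?a k < departure x t k" by (rule arrival_departure_less[OF path j])
  define H where "H = min (departure x t k) (?a K)"
  have H: "0 \<le> H" "H \<le> ?a K" "H \<le> departure x t k" "?a k \<le> H"
    unfolding H_def using a0[of k] a0[of K] adk K by (auto simp: ale)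
  from virtual_clock_exists[OF path x j k H(1-3)] obtain v where v: "virtual_clock x j t K H v" by blast
  note v0 = virtual_clockD(1)[OF v] and mono = virtual_clockD(2)[OF v] and fin = virtual_clockD(3)[OF v]
    and le = virtual_clockD(4)[OF v] and wk = virtual_clockD(5)[OF v]
    and wa = virtual_clock_arrival[OF v x j H(2)] and ex = virtual_clock_unfinished[OF v x k]
  have work_le: "?a l \<le> (\<Sum>i<l. j i)" if "?a l \<le> H" for l
  proof -
    have "(\<Sum>i<l. min (j i) (v (?a l) - v (?a i))) \<le> (\<Sum>i<l. j i)" by (intro sum_mono) auto
    then show ?thesis using wa[OF that] by simp
  qed
  have Z: "busy_time x j l = ?a l" if "?a l \<le> H" for l
    by (rule busy_time_eq_arrival, rule work_le) (use that ale order_trans in blast)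
  have veq: "v (?a l) = ?V l" if "?a l \<le> H" "l \<le> k \<or> ?a l < departure x t k" for l
    using that
  proof (induction l rule: less_induct)
    case (less l)
    show ?case
    proof (cases "l = 0")
      case False
      have IH: "v (?a i) = ?V i" if "i < l" for i
        using less that al[of i l] by (intro less.IH) auto
      have "served j ?V l (v (?a l)) = (\<Sum>i<l. min (j i) (v (?a l) - v (?a i)))"
        unfolding served_def by (intro sum.cong) (auto simp: IH)
      also have "\<dots> = ?a l" by (rule wa[OF less.prems(1)])
      also have "\<dots> = served j ?V l (?V l)" using Vserved Z[OF less.prems(1)] by simp
      finally have eq: "served j ?V l (v (?a l)) = served j ?V l (?V l)" .
      obtain i where "i < l" "v (?a l) \<le> v (?a i) + j i" using ex[OF False less.prems] by blast
      moreover obtain i' where "i' < l" "?V l \<le> ?V i' + j i'" using Vfin[OF False] by blast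
      ultimately show ?thesis using served_inj[OF eq] IH by metis
    qed (simp add: v0)
  qed
  define F where "F = ?V k + j k"
  have vk: "v (?a k) = ?V k" using H by (intro veq) auto
  show ?thesis
  proof (cases "departure x t k \<le> ?a K")
    \<comment> \<open>Job \<open>k\<close> would still be present when job \<open>K\<close> arrives,
      so all time up to then would be counted in \<open>sojourn_upto\<close>, contradicting
      \<open>less\<close>.\<close>
    case False
    then have HK: "H = ?a K" by (simp add: H_def)
    have "?a K = (\<Sum>i<K. min (j i) (v (?a K) - v (?a i)))" using wa[of K] HK by simp
    also have "\<dots> \<le> (\<Sum>i<K. max 0 (min (j i) (F - ?V i)))"
    proof (intro sum_mono)
      fix i assume "i \<in> {..<K}"
      then have "v (?a i) = ?V i" using False al[of i K] by (intro veq) (auto simp: HK)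
      moreover have "v (?a K) \<le> F"
        using le[of k "?a K"] K False vk unfolding F_def HK by (simp add: ale)
      ultimately show "min (j i) (v (?a K) - v (?a i)) \<le> max 0 (min (j i) (F - ?V i))" by auto
    qed
    finally show ?thesis using less unfolding sojourn_upto_def F_def by simp
  next
    case True
    then have HD: "H = departure x t k" by (simp add: H_def)
    have vF: "v H = F" using fin[of k] vk unfolding HD F_def by simp
    \<comment> \<open>It suffices to consider the first arrival \<open>l\<close> from
      \<open>H\<close> on: busy time has reached \<open>H\<close> by then, so \<open>vtime\<close>
      has reached \<open>F\<close>.\<close>
    have late: "F \<le> ?V i" if i: "H \<le> ?a i" for i
    proof -
      define l where "l = (LEAST l. H \<le> ?a l)"
      have l: "H \<le> ?a l" "l \<le> i" unfolding l_def using i by (auto intro: LeastI Least_le)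
      have early: "?a i < H" if "i < l" for i
        using not_less_Least[of i "\<lambda>l. H \<le> ?a l"] that unfolding l_def by auto
      have kl: "k < l" using l(1) adk al[of k l] unfolding HD by auto
      have lK: "l \<le> K" unfolding l_def using H by (intro Least_le) auto
      have "served j ?V l F = (\<Sum>i | i < K \<and> ?a i \<le> H. min (j i) (v H - v (?a i)))"
        unfolding served_def
      proof (rule sum.mono_neutral_cong_left)
        show "\<forall>i\<in>{i. i < K \<and> ?a i \<le> H} - {..<l}. min (j i) (v H - v (?a i)) = 0"
        proof
          fix i assume i: "i \<in> {i. i < K \<and> ?a i \<le> H} - {..<l}"
          then have "?a l \<le> ?a i" by (simp add: ale)
          then have "?a i = H" using i l by simp
          then show "min (j i) (v H - v (?a i)) = 0" using j'[of i] by simp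
        qed
        show "min (j i) (F - ?V i) = min (j i) (v H - v (?a i))" if "i \<in> {..<l}" for i
          using veq[of i] early[of i] that vF by (simp add: HD)
      qed (use early lK in \<open>auto intro: less_imp_le\<close>)
      also have "\<dots> = H" by (rule wk) (use H in auto)
      finally have sF: "served j ?V l F = H" .
      obtain n where n: "l = Suc n" using kl by (cases l) auto
      have "H \<le> busy_time x j l"
      proof -
        have "H \<le> (\<Sum>i<l. j i)" using served_le[of j ?V l F] sF by simp
        moreover have "busy_time x j n = ?a n" using early[of n] n by (intro Z) auto
        ultimately show ?thesis using l(1) n by (simp add: arrival_Suc)
      qed
      then have "F \<le> ?V l"
        using Vserved[of l] served_slope[of "?V l" F k l ?V j] kl sF unfolding F_def by force
      then show ?thesis using Vmono[OF l(2)] by simp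
    qed
    have "(\<Sum>i<K. max 0 (min (j i) (F - ?V i))) = (\<Sum>i | i < K \<and> ?a i \<le> H. min (j i) (v H - v (?a i)))"
    proof (rule sum.mono_neutral_cong_right)
      show "\<forall>i\<in>{..<K} - {i. i < K \<and> ?a i \<le> H}. max 0 (min (j i) (F - ?V i)) = 0"
      proof
        fix i assume "i \<in> {..<K} - {i. i < K \<and> ?a i \<le> H}"
        then have "\<not> ?a i \<le> H" by auto
        then have "F - ?V i \<le> 0" using late[of i] by simp
        then show "max 0 (min (j i) (F - ?V i)) = 0" by (simp add: min.coboundedI2)
      qed
      fix i assume i: "i \<in> {i. i < K \<and> ?a i \<le> H}"
      show "max 0 (min (j i) (F - ?V i)) = min (j i) (v H - v (?a i))"
      proof (cases "?a i < H")
        case True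
        then have "v (?a i) = ?V i" by (intro veq) (auto simp: HD)
        moreover have "v (?a i) \<le> v H" using mono[of "?a i" H] a0[of i] True by simp
        ultimately show ?thesis using vF j'[of i] by simp
      next
        case False
        then have "?a i = H" using i by simp
        then show ?thesis using late[of i] j'[of i] by simp
      qed
    qed auto
    also have "\<dots> = H" by (rule wk) (use H in auto)
    finally show ?thesis by (simp add: sojourn_upto_def F_def HD departure_def)
  qed
qed

section \<open>Departure times as rational combinations of the inputs\<close>

text \<open>
  Each departure time is a rational combination of the inputs, with one of countably many
  coefficient vectors.  As the coefficient of the job's own length is nonzero, differences of
  departure and arrival times avoid null sets.
\<close>

definition rational_span :: "(nat \<Rightarrow> real) \<Rightarrow> (nat \<Rightarrow> real) \<Rightarrow> nat \<Rightarrow> nat \<Rightarrow> real set" where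
  "rational_span x j m k =
     {\<Sum>i<m. of_rat (c i) * j i + of_rat (e i) * x i | c e :: nat \<Rightarrow> rat. c k = 0}"

lemma rational_span_0: "0 \<in> rational_span x j m k"
  unfolding rational_span_def by (auto intro!: exI[of _ "\<lambda>_. 0"])

lemma rational_span_add:
  assumes "y \<in> rational_span x j m k" "z \<in> rational_span x j m k"
  shows "y + z \<in> rational_span x j m k"
proof -
  obtain c e c' e' where "y = (\<Sum>i<m. of_rat (c i) * j i + of_rat (e i) * x i)" "c k = 0"
    "z = (\<Sum>i<m. of_rat (c' i) * j i + of_rat (e' i) * x i)" "c' k = 0"
    using assms unfolding rational_span_def by auto
  then show ?thesis unfolding rational_span_def
    by (intro CollectI exI[of _ "\<lambda>i. c i + c' i"] exI[of _ "\<lambda>i. e i + e' i"])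
       (auto simp: sum.distrib[symmetric] of_rat_add algebra_simps)
qed

lemma rational_span_scale:
  assumes "y \<in> rational_span x j m k"
  shows "of_rat q * y \<in> rational_span x j m k"
proof -
  obtain c e where "y = (\<Sum>i<m. of_rat (c i) * j i + of_rat (e i) * x i)" "c k = 0"
    using assms unfolding rational_span_def by auto
  then show ?thesis unfolding rational_span_def
    by (intro CollectI exI[of _ "\<lambda>i. q * c i"] exI[of _ "\<lambda>i. q * e i"])
       (auto simp: sum_distrib_left of_rat_mult algebra_simps)
qed

lemma rational_span_diff:
  assumes "y \<in> rational_span x j m k" "z \<in> rational_span x j m k"
  shows "y - z \<in> rational_span x j m k"
  using rational_span_add[OF assms(1) rational_span_scale[OF assms(2), of "-1"]] by simp

lemma rational_span_sum:
  "(\<And>i. i \<in> A \<Longrightarrow> f i \<in> rational_span x j m k) \<Longrightarrow> sum f A \<in> rational_span x j m k"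
  by (induction A rule: infinite_finite_induct) (auto intro: rational_span_0 rational_span_add)

lemma rational_span_x:
  assumes "i < m"
  shows "x i \<in> rational_span x j m k"
proof -
  have "x i = (\<Sum>l<m. of_rat 0 * j l + of_rat (if l = i then 1 else 0) * x l)"
    using assms by (simp add: if_distrib[of of_rat] if_distrib[of "\<lambda>u. u * _"] cong: if_cong)
  then show ?thesis unfolding rational_span_def
    by (intro CollectI exI[of _ "\<lambda>_. 0"] exI[of _ "\<lambda>l. if l = i then 1 else 0"]) auto
qed

lemma rational_span_j:
  assumes "i < m" "i \<noteq> k"
  shows "j i \<in> rational_span x j m k"
proof -
  have "j i = (\<Sum>l<m. of_rat (if l = i then 1 else 0) * j l + of_rat 0 * x l)"
    using assms by (simp add: if_distrib[of of_rat] if_distrib[of "\<lambda>u. u * _"] cong: if_cong)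
  then show ?thesis using assms unfolding rational_span_def
    by (intro CollectI exI[of _ "\<lambda>_. 0"] exI[of _ "\<lambda>l. if l = i then 1 else 0"]) auto
qed

lemma rational_span_arrival: "l \<le> m \<Longrightarrow> arrival x l \<in> rational_span x j m k"
  unfolding arrival_def by (intro rational_span_sum rational_span_x) auto

text \<open>Work conservation at the departure time is a linear equation, in which \<open>n\<close>
  counts the jobs present and not finished before that moment, \<open>k\<close> included. Each of
  them contributes the clock reading \<open>v (arrival x k) + j k\<close>, and earlier readings do
  not involve \<open>j k\<close> because job \<open>k\<close> is unfinished until then.\<close>

lemma departure_rational_span:
  fixes x j t :: "nat \<Rightarrow> real"
  assumes path: "processor_sharing_path x j t" and x: "\<And>i. 0 < x i" and j: "\<And>i. 0 < j i"
    and b: "busy_arrivals x t = enat b" and k: "k < b"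
  shows "\<exists>n\<ge>1. departure x t k - real n * j k \<in> rational_span x j b k"
proof -
  let ?a = "arrival x" and ?R = "rational_span x j b k"
  define H where "H = departure x t k"
  have adk: "?a k < H" unfolding H_def by (rule arrival_departure_less[OF path j])
  have H0: "0 \<le> H" using adk arrival_nonneg[of x k, OF x] by simp
  have Hb: "H \<le> ?a b" using b k unfolding busy_arrivals_eq_iff H_def by auto
  have kb: "enat k < busy_arrivals x t" using b k by simp
  from virtual_clock_exists[OF path x j kb H0 Hb] obtain v where v: "virtual_clock x j t b H v"
    unfolding H_def by blast
  note v0 = virtual_clockD(1)[OF v] and mono = virtual_clockD(2)[OF v] and fin = virtual_clockD(3)[OF v]
    and wk = virtual_clockD(5)[OF v] and wa = virtual_clock_arrival[OF v x j Hb]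
    and ex = virtual_clock_unfinished[OF v x kb]
  have split: "(\<Sum>i\<in>A. min (j i) (w - v (?a i))) =
      real (card {i\<in>A. w - v (?a i) \<le> j i}) * w - (\<Sum>i | i \<in> A \<and> w - v (?a i) \<le> j i. v (?a i)) +
      (\<Sum>i | i \<in> A \<and> \<not> w - v (?a i) \<le> j i. j i)" if "finite A" for A w
  proof -
    have "(\<Sum>i\<in>A. min (j i) (w - v (?a i))) = (\<Sum>i\<in>A. if w - v (?a i) \<le> j i then w - v (?a i) else j i)"
      by (intro sum.cong) auto
    also have "\<dots> = (\<Sum>i\<in>A \<inter> {i. w - v (?a i) \<le> j i}. w - v (?a i)) + (\<Sum>i\<in>A \<inter> - {i. w - v (?a i) \<le> j i}. j i)"
      using that by (rule sum.If_cases)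
    also have "A \<inter> {i. w - v (?a i) \<le> j i} = {i\<in>A. w - v (?a i) \<le> j i}" by auto
    also have "A \<inter> - {i. w - v (?a i) \<le> j i} = {i\<in>A. \<not> w - v (?a i) \<le> j i}" by auto
    finally show ?thesis by (simp add: sum_subtractf)
  qed
  have vR: "v (?a l) \<in> ?R" if "?a l < H" for l
    using that
  proof (induction l rule: less_induct)
    case (less l)
    show ?case
    proof (cases "l = 0")
      case True
      then show ?thesis by (simp add: v0 rational_span_0)
    next
      case False
      have lb: "l < b" using less.prems Hb arrival_less_iff[of x l b, OF x] by auto
      have IH: "v (?a i) \<in> ?R" if "i < l" for i
        using less that arrival_less_iff[of x i l, OF x] by auto
      define I where "I = {i\<in>{..<l}. v (?a l) - v (?a i) \<le> j i}"
      define I' where "I' = {i\<in>{..<l}. \<not> v (?a l) - v (?a i) \<le> j i}"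
      obtain i where "i < l" "v (?a l) \<le> v (?a i) + j i" using ex[of l] False less.prems by (auto simp: H_def)
      then have "i \<in> I" by (auto simp: I_def)
      then have I: "card I \<noteq> 0" by (auto simp: I_def)
      have "k \<notin> I'"
      proof
        assume "k \<in> I'"
        moreover have "v (?a l) \<le> v H" using mono[of "?a l" H] less.prems arrival_nonneg[of x l, OF x] by simp
        moreover have "v H = v (?a k) + j k" using fin[of k] unfolding H_def by simp
        ultimately show False by (auto simp: I'_def)
      qed
      then have jR: "j i \<in> ?R" if "i \<in> I'" for i
        using that lb by (intro rational_span_j) (auto simp: I'_def)
      have "?a l = real (card I) * v (?a l) - (\<Sum>i\<in>I. v (?a i)) + (\<Sum>i\<in>I'. j i)"
        using wa[of l] less.prems split[of "{..<l}" "v (?a l)"] unfolding I_def I'_def by simp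
      then have "v (?a l) = of_rat (1 / of_nat (card I)) * (?a l + (\<Sum>i\<in>I. v (?a i)) - (\<Sum>i\<in>I'. j i))"
        using I by (simp add: of_rat_divide field_simps)
      moreover have "?a l + (\<Sum>i\<in>I. v (?a i)) - (\<Sum>i\<in>I'. j i) \<in> ?R"
        using lb IH jR
        by (intro rational_span_diff rational_span_add rational_span_sum rational_span_arrival)
           (auto simp: I_def)
      ultimately show ?thesis using rational_span_scale by metis
    qed
  qed
  define A where "A = {i. i < b \<and> ?a i \<le> H}"
  define I where "I = {i\<in>A. v H - v (?a i) \<le> j i}"
  define I' where "I' = {i\<in>A. \<not> v H - v (?a i) \<le> j i}"
  have fA: "finite A" by (simp add: A_def)
  have vH: "v H = v (?a k) + j k" using fin[of k] unfolding H_def by simp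
  have kI: "k \<in> I" "k \<notin> I'" using k adk vH by (auto simp: I_def I'_def A_def)
  \<comment> \<open>A job arriving exactly at \<open>H\<close> contributes 0, but its clock reading
    \<open>v H\<close> contains \<open>j k\<close>; without these jobs all remaining readings are
    covered by \<open>vR\<close>.\<close>
  define I1 where "I1 = {i\<in>I. ?a i < H}"
  define n where "n = card I1"
  have fI: "finite I" "finite I1" using fA by (auto simp: I_def I1_def)
  have kI1: "k \<in> I1" using kI adk by (simp add: I1_def)
  have n: "1 \<le> n" unfolding n_def using kI1 fI by (metis One_nat_def Suc_leI card_gt_0_iff empty_iff)
  have "H = real (card I) * v H - (\<Sum>i\<in>I. v (?a i)) + (\<Sum>i\<in>I'. j i)"
    using wk[of H] H0 split[OF fA, of "v H"] unfolding I_def I'_def A_def by simp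
  also have "real (card I) * v H - (\<Sum>i\<in>I. v (?a i)) = (\<Sum>i\<in>I. v H - v (?a i))"
    by (simp add: sum_subtractf)
  also have "\<dots> = (\<Sum>i\<in>I1. v H - v (?a i))"
    using fI by (intro sum.mono_neutral_right) (auto simp: I1_def I_def A_def not_less dest: antisym)
  also have "\<dots> = real n * v H - (\<Sum>i\<in>I1. v (?a i))"
    by (simp add: sum_subtractf n_def)
  finally have "H - real n * j k = of_rat (of_nat n) * v (?a k) - (\<Sum>i\<in>I1. v (?a i)) + (\<Sum>i\<in>I'. j i)"
    by (simp add: vH algebra_simps)
  moreover have "\<dots> \<in> ?R"
  proof (intro rational_span_diff rational_span_add rational_span_sum rational_span_scale)
    show "v (?a k) \<in> ?R" by (rule vR[OF adk])
    show "v (?a i) \<in> ?R" if "i \<in> I1" for i using that by (intro vR) (simp add: I1_def)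
    show "j i \<in> ?R" if "i \<in> I'" for i
      using that kI(2) by (intro rational_span_j) (auto simp: I'_def A_def)
  qed
  ultimately show ?thesis using n unfolding H_def by metis
qed

section \<open>Counting matchings\<close>

text \<open>Departures are indexed by job and not by rank. Composition with the sorting permutation
  is a bijection from the valid matchings, so the count is the same, and comparing two queues
  involves no sorting. \<open>P\<close> will be positivity of a density or
  \<open>(\<le>) \<alpha>\<close>.\<close>

definition feasible_matchings :: "(real \<Rightarrow> bool) \<Rightarrow> nat \<Rightarrow> (nat \<Rightarrow> real) \<Rightarrow> (nat \<Rightarrow> real) \<Rightarrow> (nat \<Rightarrow> nat) set" where
  "feasible_matchings P b x t =
     {p. p permutes {..<b} \<and> (\<forall>i<b. P (departure x t (p i) - arrival x i))}"

lemma finite_feasible_matchings: "finite (feasible_matchings P b x t)"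
  by (rule finite_subset[OF _ finite_permutations[of "{..<b}"]]) (auto simp: feasible_matchings_def)

lemma id_feasible: "(\<And>i. i < b \<Longrightarrow> P (t i)) \<Longrightarrow> id \<in> feasible_matchings P b x t"
  by (auto simp: feasible_matchings_def departure_def permutes_id)

lemma card_feasible_pos: "(\<And>i. i < b \<Longrightarrow> P (t i)) \<Longrightarrow> 0 < card (feasible_matchings P b x t)"
  using id_feasible[of b P t x] finite_feasible_matchings[of P b x t] card_gt_0_iff by blast

lemma ordered_departure_permutation:
  "\<exists>q. q permutes {..<b} \<and> (\<forall>k<b. ordered_departure b x t k = departure x t (q k))"
proof -
  let ?l = "map (departure x t) [0..<b]"
  obtain q where q: "q permutes {..<length ?l}" "permute_list q ?l = sort ?l"
    using mset_eq_permutation[of "sort ?l" ?l] by auto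
  have "ordered_departure b x t k = departure x t (q k)" if "k < b" for k
  proof -
    have "q k < b" using q(1) that permutes_in_image[of q "{..<b}" k] by auto
    moreover have "sort ?l ! k = ?l ! q k"
      using permute_list_nth[OF q(1), of k] q(2) that by simp
    ultimately show ?thesis by (simp add: ordered_departure_def)
  qed
  then show ?thesis using q(1) by auto
qed

lemma valid_matchings_bij:
  assumes f: "\<And>u. 0 \<le> f u"
    and q: "q permutes {..<b}" "\<And>k. k < b \<Longrightarrow> ordered_departure b x t k = departure x t (q k)"
  shows "bij_betw (\<lambda>p. q \<circ> p) (valid_matchings f b x t) (feasible_matchings (\<lambda>u. 0 < f u) b x t)"
proof (rule bij_betwI[where g = "\<lambda>p. inv q \<circ> p"])
  have pos: "(0 < (\<Prod>i<b. f (h i))) \<longleftrightarrow> (\<forall>i<b. 0 < f (h i))" for h :: "nat \<Rightarrow> real"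
  proof -
    have "0 \<le> (\<Prod>i<b. f (h i))" using f by (intro prod_nonneg) auto
    then have "(0 < (\<Prod>i<b. f (h i))) \<longleftrightarrow> (\<Prod>i<b. f (h i)) \<noteq> 0" by linarith
    also have "\<dots> \<longleftrightarrow> (\<forall>i<b. f (h i) \<noteq> 0)" by auto
    also have "\<dots> \<longleftrightarrow> (\<forall>i<b. 0 < f (h i))" using f by (simp add: less_le)
    finally show ?thesis .
  qed
  have lt: "p i < b" if "p permutes {..<b}" "i < b" for p i
    using permutes_in_image[OF that(1), of i] that(2) by simp
  show "(\<lambda>p. q \<circ> p) \<in> valid_matchings f b x t \<rightarrow> feasible_matchings (\<lambda>u. 0 < f u) b x t"
    unfolding valid_matchings_def feasible_matchings_def pos
    using q lt by (auto intro: permutes_compose)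
  show "(\<lambda>p. inv q \<circ> p) \<in> feasible_matchings (\<lambda>u. 0 < f u) b x t \<rightarrow> valid_matchings f b x t"
  proof
    fix p assume p: "p \<in> feasible_matchings (\<lambda>u. 0 < f u) b x t"
    then have pp: "p permutes {..<b}" by (simp add: feasible_matchings_def)
    have "ordered_departure b x t (inv q (p i)) = departure x t (p i)" if "i < b" for i
      using q(2)[of "inv q (p i)"] lt[OF permutes_inv[OF q(1)]] lt[OF pp that] permutes_inverses(1)[OF q(1)]
      by simp
    then show "inv q \<circ> p \<in> valid_matchings f b x t"
      using p permutes_compose[OF pp permutes_inv[OF q(1)]]
      unfolding valid_matchings_def feasible_matchings_def pos by auto
  qed
qed (use permutes_inv_o[OF q(1)] in \<open>auto simp: o_assoc\<close>)

lemma card_valid_matchings: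
  assumes "\<And>u. 0 \<le> f u"
  shows "card (valid_matchings f b x t) = card (feasible_matchings (\<lambda>u. 0 < f u) b x t)"
proof -
  obtain q where "q permutes {..<b}" "\<And>k. k < b \<Longrightarrow> ordered_departure b x t k = departure x t (q k)"
    using ordered_departure_permutation by blast
  from bij_betw_same_card[OF valid_matchings_bij[of f, OF assms this]] show ?thesis .
qed

lemma finite_valid_matchings: "finite (valid_matchings f b x t)"
  by (rule finite_subset[OF _ finite_permutations[of "{..<b}"]]) (auto simp: valid_matchings_def)

lemma card_feasible_mono:
  assumes "\<And>i k. i < b \<Longrightarrow> k < b \<Longrightarrow> P (departure x t k - arrival x i) \<Longrightarrow> Q (departure x t k - arrival x i)"
  shows "card (feasible_matchings P b x t) \<le> card (feasible_matchings Q b x t)"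
proof (intro card_mono finite_feasible_matchings subsetI)
  fix p assume p: "p \<in> feasible_matchings P b x t"
  then have pp: "p permutes {..<b}" by (simp add: feasible_matchings_def)
  have "p i < b" if "i < b" for i
    using permutes_in_image[OF pp, of i] that by simp
  then show "p \<in> feasible_matchings Q b x t"
    using p assms unfolding feasible_matchings_def by auto
qed

text \<open>The uniform law gives any \<open>p\<close> at most the reciprocal of the number of valid
  matchings, and there are at least as many of these as \<open>P\<close>-feasible ones. The identity
  is feasible, so the set is not empty and \<open>pmf_of_set\<close> is indeed uniform.\<close>

lemma pmf_random_matching_le:
  assumes f: "\<And>u. 0 \<le> f u" and P: "\<And>i. i < b \<Longrightarrow> P (t i)"
    and imp: "\<And>i k. i < b \<Longrightarrow> k < b \<Longrightarrow> P (departure x t k - arrival x i) \<Longrightarrow> 0 < f (departure x t k - arrival x i)"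
  shows "pmf (random_matching f b x t) p \<le> 1 / real (card (feasible_matchings P b x t))"
proof -
  let ?V = "valid_matchings f b x t" and ?F = "feasible_matchings P b x t"
  have c: "0 < card ?F" using P by (rule card_feasible_pos)
  have le: "card ?F \<le> card ?V"
    unfolding card_valid_matchings[of f, OF f] using imp by (rule card_feasible_mono)
  have ne: "?V \<noteq> {}" using c le by auto
  have "pmf (random_matching f b x t) p = indicator ?V p / real (card ?V)"
    unfolding random_matching_def by (rule pmf_of_set[OF ne finite_valid_matchings])
  also have "\<dots> \<le> 1 / real (card ?V)" by (auto simp: indicator_def divide_right_mono)
  also have "\<dots> \<le> 1 / real (card ?F)" using c le by (intro divide_left_mono) auto
  finally show ?thesis .
qed

lemma true_matching_valid:
  assumes f: "\<And>u. 0 \<le> f u" and pos: "\<And>i. i < b \<Longrightarrow> 0 < f (t i)"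
    and inj: "inj_on (departure x t) {..<b}"
  shows "true_matching b x t \<in> valid_matchings f b x t"
proof -
  obtain q where q: "q permutes {..<b}" "\<And>k. k < b \<Longrightarrow> ordered_departure b x t k = departure x t (q k)"
    using ordered_departure_permutation by blast
  have lt: "p i < b" if "p permutes {..<b}" "i < b" for p i
    using permutes_in_image[OF that(1), of i] that(2) by simp
  \<comment> \<open>Distinct departure times make the permutation unique, so the description in
    \<open>true_matching\<close> defines it.\<close>
  have iff: "(\<forall>i<b. t i = ordered_departure b x t (p i) - arrival x i) \<longleftrightarrow> p = inv q"
    if p: "p permutes {..<b}" for p
  proof
    assume eq: "\<forall>i<b. t i = ordered_departure b x t (p i) - arrival x i"
    have "q (p i) = i" for i
    proof (cases "i < b")
      case True
      then have "departure x t i = departure x t (q (p i))"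
        using eq q(2)[of "p i"] lt[OF p True] by (simp add: departure_def)
      moreover have "q (p i) < b" using True lt p q(1) by blast
      ultimately show ?thesis using inj True by (auto simp: inj_on_def)
    next
      case False
      then show ?thesis using p q(1) by (simp add: permutes_def)
    qed
    then show "p = inv q" using permutes_inverses(2)[OF q(1)] by (metis ext)
  next
    assume p: "p = inv q"
    have "inv q i < b" if "i < b" for i using lt[OF permutes_inv[OF q(1)] that] .
    then show "\<forall>i<b. t i = ordered_departure b x t (p i) - arrival x i"
      unfolding p using q(2) permutes_inverses(1)[OF q(1)] by (simp add: departure_def)
  qed
  have "true_matching b x t = inv q"
    unfolding true_matching_def
    by (rule the_equality) (use iff permutes_inv[OF q(1)] in blast)+
  then have eq: "\<forall>i<b. ordered_departure b x t (true_matching b x t i) - arrival x i = t i"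
    using iff[OF permutes_inv[OF q(1)]] by simp
  have "(\<Prod>i<b. f (ordered_departure b x t (true_matching b x t i) - arrival x i)) = (\<Prod>i<b. f (t i))"
    using eq by (intro prod.cong) auto
  also have "\<dots> > 0" using pos by (intro prod_pos) auto
  finally show ?thesis
    unfolding valid_matchings_def using \<open>true_matching b x t = inv q\<close> permutes_inv[OF q(1)] by simp
qed

lemma pmf_random_matching_ge:
  assumes f: "\<And>u. 0 \<le> f u" and pos: "\<And>i. i < b \<Longrightarrow> 0 < f (t i)"
    and inj: "inj_on (departure x t) {..<b}"
    and imp: "\<And>u. 0 < f u \<Longrightarrow> P u"
  shows "1 / real (card (feasible_matchings P b x t)) \<le> pmf (random_matching f b x t) (true_matching b x t)"
proof -
  let ?V = "valid_matchings f b x t" and ?F = "feasible_matchings P b x t"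
  have tv: "true_matching b x t \<in> ?V" using f pos inj by (rule true_matching_valid)
  then have ne: "?V \<noteq> {}" by auto
  then have c: "0 < card ?V" using finite_valid_matchings[of f b x t] by (simp add: card_gt_0_iff)
  have le: "card ?V \<le> card ?F"
    unfolding card_valid_matchings[of f, OF f] using imp by (rule card_feasible_mono)
  have "1 / real (card ?F) \<le> 1 / real (card ?V)" using c le by (intro divide_left_mono) auto
  also have "\<dots> = pmf (random_matching f b x t) (true_matching b x t)"
    unfolding random_matching_def using tv pmf_of_set[OF ne finite_valid_matchings] by simp
  finally show ?thesis .
qed

text \<open>A series with at most one nonzero term, 0 for an infinite busy period. In this form
  measurability is immediate, and exchanging sum and integral leads to the shape of
  \<open>rand_accuracy\<close>.\<close>

definition feasible_accuracy :: "real \<Rightarrow> (nat \<Rightarrow> real) \<Rightarrow> (nat \<Rightarrow> real) \<Rightarrow> ennreal" where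
  "feasible_accuracy \<alpha> x t =
     (\<Sum>n. if busy_arrivals x t = enat (Suc n)
           then ennreal (1 / real (card (feasible_matchings ((\<le>) \<alpha>) (Suc n) x t))) else 0)"

lemma feasible_accuracy_eq:
  assumes "busy_arrivals x t = enat b"
  shows "feasible_accuracy \<alpha> x t = ennreal (1 / real (card (feasible_matchings ((\<le>) \<alpha>) b x t)))"
proof -
  have "1 \<le> b" using assms unfolding busy_arrivals_eq_iff by simp
  then obtain n where n: "b = Suc n" by (cases b) auto
  have "feasible_accuracy \<alpha> x t =
      (\<Sum>m. if m = n then ennreal (1 / real (card (feasible_matchings ((\<le>) \<alpha>) b x t))) else 0)"
    unfolding feasible_accuracy_def assms n by (intro suminf_cong) auto
  also have "\<dots> = ennreal (1 / real (card (feasible_matchings ((\<le>) \<alpha>) b x t)))"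
    using sums_single[of n "\<lambda>_. ennreal (1 / real (card (feasible_matchings ((\<le>) \<alpha>) b x t)))"]
    by (intro sums_unique[symmetric]) auto
  finally show ?thesis .
qed

lemma arrival_diff_mono:
  assumes "\<And>i. x i \<le> x' i" "i \<le> k"
  shows "arrival x k - arrival x i \<le> arrival x' k - arrival x' i"
  unfolding arrival_diff[OF assms(2)] using assms(1) by (rule sum_mono)

text \<open>
  An assignment that is feasible for the second pair of sequences, extended by the identity to the
  longer busy period, is feasible for the first.
\<close>

lemma feasible_accuracy_mono:
  assumes x: "\<And>i. 0 \<le> x i" "\<And>i. x i \<le> x' i" and t: "\<And>i. \<alpha> \<le> t' i" "\<And>i. t' i \<le> t i"
  shows "feasible_accuracy \<alpha> x t \<le> feasible_accuracy \<alpha> x' t'"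
proof (cases "busy_arrivals x t")
  case infinity
  then show ?thesis by (simp add: feasible_accuracy_def)
next
  case (enat b)
  note am = arrival_diff_mono[of x x', OF x(2)]
  have am0: "arrival x i \<le> arrival x k" if "i \<le> k" for i k
    using arrival_diff_mono[of "\<lambda>_. 0" x i k] x(1) that by (simp add: arrival_def)
  have dep: "departure x' t' i \<le> arrival x' k" if "departure x t i \<le> arrival x k" "i < k" for i k
    using that am[of i k] t(2)[of i] by (simp add: departure_def)
  have "\<not> enat b < busy_arrivals x t" using enat by simp
  then have "\<not> enat b < busy_arrivals x' t'"
    unfolding less_busy_arrivals_iff using dep by (meson not_less)
  then obtain b' where b': "busy_arrivals x' t' = enat b'" "b' \<le> b"
    by (cases "busy_arrivals x' t'") auto
  let ?F = "feasible_matchings ((\<le>) \<alpha>) b x t" and ?F' = "feasible_matchings ((\<le>) \<alpha>) b' x' t'"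
  have "?F' \<subseteq> ?F"
  proof
    fix p assume p: "p \<in> ?F'"
    then have pp: "p permutes {..<b'}" by (simp add: feasible_matchings_def)
    have "\<alpha> \<le> departure x t (p i) - arrival x i" if "i < b" for i
    \<comment> \<open>If \<open>p i\<close> arrives no earlier than \<open>i\<close>, its sojourn
      time alone gives \<open>\<alpha>\<close>. Otherwise \<open>p\<close> moves \<open>i\<close>,
      so \<open>i\<close> lies in the shorter busy period, and the time between the two arrivals
      only shrinks when passing to \<open>x\<close>.\<close>
    proof (cases "i \<le> p i")
      case True
      then show ?thesis using am0[OF True] t(1,2)[of "p i"] by (simp add: departure_def)
    next
      case False
      then have "i < b'" using pp by (metis lessThan_iff order_refl permutes_def)
      then have "\<alpha> \<le> departure x' t' (p i) - arrival x' i"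
        using p by (simp add: feasible_matchings_def)
      then show ?thesis using am[of "p i" i] False t(2)[of "p i"] by (simp add: departure_def)
    qed
    moreover have "p permutes {..<b}" using permutes_subset[OF pp] b'(2) by auto
    ultimately show "p \<in> ?F" by (simp add: feasible_matchings_def)
  qed
  then have "card ?F' \<le> card ?F" by (intro card_mono finite_feasible_matchings)
  moreover have "0 < card ?F'" using t by (intro card_feasible_pos) auto
  ultimately have "1 / real (card ?F) \<le> 1 / real (card ?F')" by (intro divide_left_mono) auto
  then show ?thesis
    unfolding feasible_accuracy_eq[OF enat] feasible_accuracy_eq[OF b'(1)] by (rule ennreal_leI)
qed

lemma arrival_measurable [measurable]:
  assumes [measurable]: "\<And>i. (\<lambda>\<omega>. x \<omega> i) \<in> borel_measurable M"
  shows "(\<lambda>\<omega>. arrival (x \<omega>) i) \<in> borel_measurable M"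
  unfolding arrival_def by measurable

lemma departure_measurable [measurable]:
  assumes [measurable]: "\<And>i. (\<lambda>\<omega>. x \<omega> i) \<in> borel_measurable M" "\<And>i. (\<lambda>\<omega>. t \<omega> i) \<in> borel_measurable M"
  shows "(\<lambda>\<omega>. departure (x \<omega>) (t \<omega>) i) \<in> borel_measurable M"
  unfolding departure_def by measurable

lemma less_busy_arrivals_measurable [measurable]:
  assumes [measurable]: "\<And>i. (\<lambda>\<omega>. x \<omega> i) \<in> borel_measurable M" "\<And>i. (\<lambda>\<omega>. t \<omega> i) \<in> borel_measurable M"
  shows "Measurable.pred M (\<lambda>\<omega>. enat k < busy_arrivals (x \<omega>) (t \<omega>))"
  unfolding less_busy_arrivals_iff by measurable

lemma busy_arrivals_eq_measurable [measurable]: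
  assumes [measurable]: "\<And>i. (\<lambda>\<omega>. x \<omega> i) \<in> borel_measurable M" "\<And>i. (\<lambda>\<omega>. t \<omega> i) \<in> borel_measurable M"
  shows "Measurable.pred M (\<lambda>\<omega>. busy_arrivals (x \<omega>) (t \<omega>) = enat b)"
  unfolding busy_arrivals_eq_iff by measurable

lemma card_feasible_measurable [measurable]:
  assumes [measurable]: "\<And>i. (\<lambda>\<omega>. x \<omega> i) \<in> borel_measurable M" "\<And>i. (\<lambda>\<omega>. t \<omega> i) \<in> borel_measurable M"
  shows "(\<lambda>\<omega>. real (card (feasible_matchings ((\<le>) \<alpha>) b (x \<omega>) (t \<omega>)))) \<in> borel_measurable M"
proof -
  have "real (card (feasible_matchings ((\<le>) \<alpha>) b (x \<omega>) (t \<omega>))) =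
      (\<Sum>p | p permutes {..<b}. if \<forall>i<b. \<alpha> \<le> departure (x \<omega>) (t \<omega>) (p i) - arrival (x \<omega>) i then 1 else 0)" for \<omega>
    using finite_permutations[of "{..<b}"]
    by (subst sum.inter_filter[symmetric]) (auto simp: feasible_matchings_def)
  then show ?thesis by simp
qed

lemma feasible_accuracy_measurable [measurable]:
  assumes [measurable]: "\<And>i. (\<lambda>\<omega>. x \<omega> i) \<in> borel_measurable M" "\<And>i. (\<lambda>\<omega>. t \<omega> i) \<in> borel_measurable M"
  shows "(\<lambda>\<omega>. feasible_accuracy \<alpha> (x \<omega>) (t \<omega>)) \<in> borel_measurable M"
  unfolding feasible_accuracy_def by measurable

section \<open>Positivity of the sojourn time density\<close>

locale queue_primitives =
  fixes M :: "'a measure" and X S :: "nat \<Rightarrow> 'a \<Rightarrow> real" and f g :: "real \<Rightarrow> real"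
  assumes input: "queue_input M X S f g"
begin

sublocale prob_space M
  using input by (simp add: queue_input_def)

abbreviation Z :: "nat + nat \<Rightarrow> 'a \<Rightarrow> real" where "Z \<equiv> case_sum X S"

abbreviation pdf :: "nat + nat \<Rightarrow> real \<Rightarrow> real" where "pdf s \<equiv> case_sum (\<lambda>_. f) (\<lambda>_. g) s"

lemma indep: "indep_vars (\<lambda>_. borel) Z UNIV"
  using input by (simp add: queue_input_def)

lemma positive_pdf: "positive_with_pdf M (Z s) (pdf s)"
  using input by (cases s) (auto simp: queue_input_def)

lemma Z_measurable [measurable]: "Z s \<in> borel_measurable M"
  using indep by (auto simp: indep_vars_def)

lemma X_measurable [measurable]: "X i \<in> borel_measurable M"
  using Z_measurable[of "Inl i"] by simp

lemma S_measurable [measurable]: "S i \<in> borel_measurable M"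
  using Z_measurable[of "Inr i"] by simp

lemma pdf_nonneg: "0 \<le> pdf s y"
  using positive_pdf[of s] by (simp add: positive_with_pdf_def)

lemma pdf_nonpos: "y \<le> 0 \<Longrightarrow> pdf s y = 0"
  using positive_pdf[of s] by (simp add: positive_with_pdf_def)

lemma distributed_Z: "distributed M lborel (Z s) (\<lambda>y. ennreal (pdf s y))"
  using positive_pdf[of s] by (simp add: positive_with_pdf_def)

lemma distr_Z: "distr M borel (Z s) = density lborel (\<lambda>y. ennreal (pdf s y))"
proof -
  have "distr M borel (Z s) = distr M lborel (Z s)" by (intro distr_cong) auto
  then show ?thesis using distributed_distr_eq_density[OF distributed_Z[of s]] by simp
qed

lemma AE_distr_Z_iff: "(AE y in distr M borel (Z s). P y) \<longleftrightarrow> (AE y in lborel. 0 < pdf s y \<longrightarrow> P y)"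
  unfolding distr_Z using distributed_borel_measurable[OF distributed_Z[of s]]
  by (subst AE_density) auto

lemma AE_Z:
  assumes "AE y in lborel. 0 < pdf s y \<longrightarrow> P y"
  shows "AE \<omega> in M. P (Z s \<omega>)"
  using assms unfolding AE_distr_Z_iff[symmetric] by (rule AE_distrD[rotated]) simp

lemma AE_pos: "AE \<omega> in M. \<forall>i. 0 < X i \<omega> \<and> 0 < S i \<omega>"
proof -
  have "AE \<omega> in M. 0 < Z s \<omega>" for s
  proof (intro AE_Z AE_I2 impI)
    show "0 < y" if "0 < pdf s y" for y
      using pdf_nonpos[of y s] that by (cases "y \<le> 0") auto
  qed
  from this[of "Inl _"] this[of "Inr _"] show ?thesis
    by (simp add: AE_all_countable)
qed

lemma AE_update:
  assumes "Measurable.pred (PiM UNIV (\<lambda>_. borel)) Q"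
  shows "(AE \<omega> in M. Q (\<lambda>s. Z s \<omega>)) \<longleftrightarrow>
         (AE \<omega> in M. AE y in lborel. 0 < pdf a y \<longrightarrow> Q ((\<lambda>s. Z s \<omega>)(a := y)))"
  using AE_indep_vars_update[OF prob_space_axioms indep assms, of a] unfolding AE_distr_Z_iff .

text \<open>Conditionally on the other inputs \<open>r\<close> is a constant, and a nonconstant
  affine image of a variable with a density avoids a null set.\<close>

lemma AE_affine_notin:
  assumes A: "A \<in> null_sets lborel" and c: "c \<noteq> 0"
    and r: "r \<in> borel_measurable (PiM UNIV (\<lambda>_. borel))" "\<And>z y. r (z(a := y)) = r z"
  shows "AE \<omega> in M. c * Z a \<omega> + r (\<lambda>s. Z s \<omega>) \<notin> A"
proof -
  have [measurable]: "A \<in> sets borel" "r \<in> borel_measurable (PiM UNIV (\<lambda>_. borel))"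
    using A r by auto
  have "Measurable.pred (PiM UNIV (\<lambda>_. borel)) (\<lambda>z. c * z a + r z \<notin> A)" by measurable
  from AE_update[OF this, of a]
  have "(AE \<omega> in M. c * Z a \<omega> + r (\<lambda>s. Z s \<omega>) \<notin> A) \<longleftrightarrow>
    (AE \<omega> in M. AE y in lborel. 0 < pdf a y \<longrightarrow> c * y + r (\<lambda>s. Z s \<omega>) \<notin> A)"
    unfolding r(2) by simp
  moreover have "AE y in lborel. 0 < pdf a y \<longrightarrow> c * y + r (\<lambda>s. Z s \<omega>) \<notin> A" for \<omega>
  proof -
    have "AE y in lborel. y \<notin> A" by (rule AE_not_in[OF A])
    from AE_borel_affine[OF c _ this, of "r (\<lambda>s. Z s \<omega>)"]
    have "AE y in lborel. r (\<lambda>s. Z s \<omega>) + c * y \<notin> A" by simp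
    then show ?thesis by (rule eventually_mono) (simp add: add.commute)
  qed
  ultimately show ?thesis by simp
qed

lemma prob_near_pos:
  assumes "continuous_on {0<..} (pdf s)" "0 < y" "0 < pdf s y" "0 < d"
  shows "0 < prob {\<omega>\<in>space M. Z s \<omega> \<in> {y - d<..<y + d}}"
proof (rule ccontr)
  assume "\<not> ?thesis"
  then have "prob {\<omega>\<in>space M. Z s \<omega> \<in> {y - d<..<y + d}} = 0"
    using measure_nonneg[of M] by (metis less_le)
  then have "AE \<omega> in M. Z s \<omega> \<notin> {y - d<..<y + d}"
    by (subst AE_iff_measurable[OF _ refl]) (auto simp: emeasure_eq_measure)
  then have "AE u in distr M borel (Z s). u \<notin> {y - d<..<y + d}"
    by (subst AE_distr_iff) auto
  then have ae: "AE u in lborel. 0 < pdf s u \<longrightarrow> u \<notin> {y - d<..<y + d}"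
    unfolding AE_distr_Z_iff .
  have "isCont (pdf s) y"
    using assms(1,2) by (simp add: continuous_on_eq_continuous_at)
  then have "\<forall>\<^sub>F u in nhds y. 0 < pdf s u"
    unfolding isCont_def tendsto_at_iff_tendsto_nhds using assms(3) by (rule order_tendstoD(1))
  then obtain e where e: "0 < e" "\<And>u. dist u y < e \<Longrightarrow> 0 < pdf s u"
    unfolding eventually_nhds_metric by auto
  define h where "h = min d e"
  have h: "0 < h" using e assms(4) by (simp add: h_def)
  have "AE u in lborel. u \<notin> {y - h<..<y + h}"
    using ae
  proof (rule eventually_mono)
    fix u assume u: "0 < pdf s u \<longrightarrow> u \<notin> {y - d<..<y + d}"
    show "u \<notin> {y - h<..<y + h}"
    proof
      assume "u \<in> {y - h<..<y + h}"
      then have "dist u y < e" "u \<in> {y - d<..<y + d}"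
        by (auto simp: h_def dist_real_def abs_less_iff)
      then show False using u e(2) by blast
    qed
  qed
  then have "emeasure lborel {y - h<..<y + h} = 0"
    by (subst (asm) AE_iff_measurable[OF _ refl]) (auto simp: greaterThanLessThan_eq Int_def)
  then show False using h by simp
qed

lemma AE_exists_in_box:
  assumes I: "finite I" and A: "\<And>s. s \<in> I \<Longrightarrow> A s \<in> sets borel"
    and pos: "\<And>s. s \<in> I \<Longrightarrow> 0 < prob {\<omega>\<in>space M. Z s \<omega> \<in> A s}"
    and ae: "AE \<omega> in M. P \<omega>"
  shows "\<exists>\<omega>. P \<omega> \<and> (\<forall>s\<in>I. Z s \<omega> \<in> A s)"
proof (rule ccontr)
  assume none: "\<not> ?thesis"
  have m: "{\<omega>\<in>space M. \<forall>s\<in>I. Z s \<omega> \<in> A s} \<in> sets M"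
  proof -
    have "{\<omega>\<in>space M. Z s \<omega> \<in> A s} \<in> sets M" if "s \<in> I" for s
      using measurable_sets[OF Z_measurable A[OF that]] by (simp add: vimage_def Int_def conj_commute)
    then show ?thesis using I by (intro sets.sets_Collect_finite_All) auto
  qed
  have "AE \<omega> in M. \<not> (\<forall>s\<in>I. Z s \<omega> \<in> A s)"
    using ae by (rule eventually_mono) (use none in blast)
  then have "emeasure M {\<omega>\<in>space M. \<forall>s\<in>I. Z s \<omega> \<in> A s} = 0"
    using m by (subst (asm) AE_iff_measurable[OF _ refl]) auto
  moreover have "0 < prob {\<omega>\<in>space M. \<forall>s\<in>I. Z s \<omega> \<in> A s}"
    by (rule prob_indep_box_pos[OF prob_space_axioms indep I A pos])
  ultimately show False by (simp add: measure_def)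
qed

end

locale processor_sharing =
  fixes M :: "'a measure" and X J T :: "nat \<Rightarrow> 'a \<Rightarrow> real" and f_X f_J :: "real \<Rightarrow> real"
  assumes PS: "processor_sharing_queue M X J T f_X f_J"
begin

sublocale queue_primitives M X J f_X f_J
  using PS by unfold_locales (simp add: processor_sharing_queue_def)

lemma T_measurable [measurable]: "T i \<in> borel_measurable M"
  using PS by (simp add: processor_sharing_queue_def)

lemma f_X_continuous: "continuous_on {0<..} f_X"
  using input by (simp add: queue_input_def)

abbreviation B :: "'a \<Rightarrow> enat" where
  "B \<omega> \<equiv> busy_arrivals (\<lambda>i. X i \<omega>) (\<lambda>i. T i \<omega>)"

definition good :: "'a \<Rightarrow> bool" where
  "good \<omega> \<longleftrightarrow> processor_sharing_path (\<lambda>i. X i \<omega>) (\<lambda>i. J i \<omega>) (\<lambda>i. T i \<omega>) \<and>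
     (\<forall>i. 0 < X i \<omega>) \<and> (\<forall>i. 0 < J i \<omega>)"

lemma AE_good: "AE \<omega> in M. good \<omega>"
  using PS AE_pos unfolding processor_sharing_queue_def good_def by auto

text \<open>Fixed coefficients give an affine function of \<open>J k\<close> with slope at least 1,
  so \<open>AE_affine_notin\<close> applies; by \<open>departure_rational_span\<close> countably
  many coefficient vectors suffice.\<close>

lemma AE_departure_notin:
  assumes A: "A \<in> null_sets lborel"
  shows "AE \<omega> in M. \<forall>b i k. B \<omega> = enat b \<longrightarrow> i < b \<longrightarrow> k < b \<longrightarrow>
    departure (\<lambda>i. X i \<omega>) (\<lambda>i. T i \<omega>) k - arrival (\<lambda>i. X i \<omega>) i \<notin> A"
proof -
  \<comment> \<open>The coefficients are lists of rationals, a countable type, unlike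
    \<open>nat \<Rightarrow> rat\<close>.\<close>
  define L where "L b cs es \<omega> =
    (\<Sum>i<b. of_rat ((cs :: rat list) ! i) * J i \<omega> + of_rat ((es :: rat list) ! i) * X i \<omega>)" for b cs es \<omega>
  have "AE \<omega> in M. n \<noteq> 0 \<longrightarrow> cs ! k = 0 \<longrightarrow> real n * J k \<omega> + L b cs es \<omega> \<notin> A" for n k b cs es
  proof (cases "n \<noteq> 0 \<and> cs ! k = 0")
    case True
    define r where "r z = (\<Sum>i<b. of_rat (cs ! i) * z (Inr i) + of_rat (es ! i) * z (Inl i))"
      for z :: "nat + nat \<Rightarrow> real"
    have "AE \<omega> in M. real n * Z (Inr k) \<omega> + r (\<lambda>s. Z s \<omega>) \<notin> A"
    proof (rule AE_affine_notin[OF A])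
      show "r \<in> borel_measurable (PiM UNIV (\<lambda>_. borel))" unfolding r_def by measurable
      show "r (z(Inr k := y)) = r z" for z y
        unfolding r_def using True by (intro sum.cong) auto
    qed (use True in simp)
    then show ?thesis by (simp add: r_def L_def)
  qed auto
  then have "AE \<omega> in M. \<forall>n k b cs es. n \<noteq> 0 \<longrightarrow> cs ! k = 0 \<longrightarrow> real n * J k \<omega> + L b cs es \<omega> \<notin> A"
    by (simp add: AE_all_countable)
  with AE_good show ?thesis
  proof eventually_elim
    case (elim \<omega>)
    let ?x = "\<lambda>i. X i \<omega>" and ?j = "\<lambda>i. J i \<omega>" and ?t = "\<lambda>i. T i \<omega>"
    have path: "processor_sharing_path ?x ?j ?t" "\<And>i. 0 < ?x i" "\<And>i. 0 < ?j i"
      using elim(1) by (auto simp: good_def)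
    show ?case
    proof (intro allI impI)
      fix b i k assume b: "B \<omega> = enat b" and i: "i < b" and k: "k < b"
      obtain n where n: "n \<ge> 1" "departure ?x ?t k - real n * ?j k \<in> rational_span ?x ?j b k"
        using departure_rational_span[OF path b k] by blast
      from rational_span_diff[OF n(2) rational_span_arrival[of i b ?x ?j k]] i
      have "departure ?x ?t k - arrival ?x i - real n * ?j k \<in> rational_span ?x ?j b k"
        by (simp add: algebra_simps)
      then obtain c e where ce: "c k = 0"
        "departure ?x ?t k - arrival ?x i - real n * ?j k = (\<Sum>i<b. of_rat (c i) * ?j i + of_rat (e i) * ?x i)"
        unfolding rational_span_def by auto
      have "(\<Sum>i<b. of_rat (c i) * ?j i + of_rat (e i) * ?x i) = L b (map c [0..<b]) (map e [0..<b]) \<omega>"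
        unfolding L_def by (intro sum.cong) auto
      then have "departure ?x ?t k - arrival ?x i = real n * ?j k + L b (map c [0..<b]) (map e [0..<b]) \<omega>"
        using ce(2) by simp
      moreover have "map c [0..<b] ! k = 0" using ce(1) k by simp
      ultimately show "departure ?x ?t k - arrival ?x i \<notin> A" using elim(2) n(1) by force
    qed
  qed
qed

end

section \<open>Tools for crossing arguments\<close>

lemma sum_two_level:
  "(\<Sum>i<l. if i < m then c else e) = real (min l m) * c + real (l - m) * (e :: real)"
  by (induction l) (auto simp: min_def algebra_simps Suc_diff_le)

lemma negligible_iff_null_sets_borel:
  "A \<in> sets borel \<Longrightarrow> negligible A \<longleftrightarrow> emeasure lborel A = 0" for A :: "real set"
  by (simp add: negligible_iff_emeasure0 emeasure_completion)

text \<open>Countably many rational intervals cover the range, so one of them meets \<open>A\<close>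
  in positive measure. The strict margin at both ends leaves room for perturbations.\<close>

lemma nonnegligible_subinterval:
  fixes A :: "real set" and lo hi :: "ereal"
  assumes A: "A \<in> sets borel" "emeasure lborel {u\<in>A. lo < ereal u \<and> ereal u < hi} \<noteq> 0"
  shows "\<exists>a b. lo < ereal a \<and> ereal b < hi \<and> emeasure lborel (A \<inter> {a<..<b}) \<noteq> 0"
proof (rule ccontr)
  assume none: "\<not> ?thesis"
  let ?I = "{(a, b). a \<in> \<rat> \<and> b \<in> \<rat> \<and> lo < ereal a \<and> ereal b < hi}"
  have c: "countable ?I"
    by (rule countable_subset[of _ "\<rat> \<times> \<rat>"]) (auto intro: countable_rat)
  have sub: "{u\<in>A. lo < ereal u \<and> ereal u < hi} \<subseteq> (\<Union>(a, b)\<in>?I. A \<inter> {a<..<b})"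
  proof
    fix u assume u: "u \<in> {u\<in>A. lo < ereal u \<and> ereal u < hi}"
    obtain a' where a': "lo < ereal a'" "a' < u"
      using ereal_dense2[of lo "ereal u"] u by auto
    obtain b' where b': "ereal b' < hi" "u < b'"
      using ereal_dense2[of "ereal u" hi] u by auto
    obtain a where a: "a \<in> \<rat>" "a' < a" "a < u" using Rats_dense_in_real[OF a'(2)] by auto
    obtain b where b: "b \<in> \<rat>" "u < b" "b < b'" using Rats_dense_in_real[OF b'(2)] by auto
    have "lo < ereal a" using a'(1) a(2) by (meson less_ereal.simps(1) less_trans)
    moreover have "ereal b < hi" using b'(1) b(3) by (meson less_ereal.simps(1) less_trans)
    ultimately show "u \<in> (\<Union>(a, b)\<in>?I. A \<inter> {a<..<b})" using a b u by auto
  qed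
  have "(\<Union>(a, b)\<in>?I. A \<inter> {a<..<b}) \<in> null_sets lborel"
    using c none A(1) by (intro null_sets_UN') (auto simp: null_sets_def)
  then have "{u\<in>A. lo < ereal u \<and> ereal u < hi} \<in> null_sets lborel"
    using A(1) by (intro null_sets_subset[OF _ _ sub]) auto
  then show False using A(2) by auto
qed

lemma discrete_upcrossing:
  fixes \<tau> :: "nat \<Rightarrow> real"
  assumes "\<tau> 0 \<le> u" "u < \<tau> m"
  shows "\<exists>r<m. \<tau> r \<le> u \<and> u < \<tau> (Suc r)"
  using assms(2)
proof (induction m)
  case 0
  then show ?case using assms(1) by simp
next
  case (Suc m)
  then show ?case by (cases "u < \<tau> m") (auto intro: less_SucI)
qed

text \<open>By the intermediate value theorem \<open>D\<close> lies in the image of its preimage,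
  and a Lipschitz map sends a null preimage to a null set. \<open>cover\<close> puts the larger
  value at the left end, as for a sojourn time that grows when a gap shrinks.\<close>

lemma lipschitz_image_not_null:
  fixes \<phi> :: "real \<Rightarrow> real"
  assumes ab: "a \<le> b" and lip: "\<And>y y'. a \<le> y \<Longrightarrow> y \<le> b \<Longrightarrow> a \<le> y' \<Longrightarrow> y' \<le> b \<Longrightarrow> \<bar>\<phi> y - \<phi> y'\<bar> \<le> C * \<bar>y - y'\<bar>"
    and cover: "\<And>u. u \<in> D \<Longrightarrow> \<phi> b \<le> u \<and> u \<le> \<phi> a"
    and D: "D \<in> sets borel" "emeasure lborel D \<noteq> 0"
    and ae: "AE y in lborel. y \<in> {a..b} \<longrightarrow> \<phi> y \<notin> D"
  shows False
proof -
  define S where "S = {y\<in>{a..b}. \<phi> y \<in> D}"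
  have lip': "\<bar>\<phi> y - \<phi> y'\<bar> \<le> \<bar>C\<bar> * \<bar>y - y'\<bar>" if "y \<in> {a..b}" "y' \<in> {a..b}" for y y'
  proof -
    have "\<bar>\<phi> y - \<phi> y'\<bar> \<le> C * \<bar>y - y'\<bar>" using lip that by auto
    also have "\<dots> \<le> \<bar>C\<bar> * \<bar>y - y'\<bar>" by (intro mult_right_mono) auto
    finally show ?thesis .
  qed
  have "\<bar>C\<bar>-lipschitz_on {a..b} \<phi>"
    using lip' by (intro lipschitz_onI) (auto simp: dist_real_def)
  then have cont: "continuous_on {a..b} \<phi>" by (rule lipschitz_on_continuous_on)
  have "D \<subseteq> \<phi> ` S"
  proof
    fix u assume u: "u \<in> D"
    then obtain y where "a \<le> y" "y \<le> b" "\<phi> y = u"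
      using IVT2'[of \<phi> b u a] cover[OF u] ab cont by auto
    then show "u \<in> \<phi> ` S" using u by (auto simp: S_def)
  qed
  moreover have "negligible S"
  proof -
    from ae obtain N where N: "N \<in> null_sets lborel" "{y. \<not> (y \<in> {a..b} \<longrightarrow> \<phi> y \<notin> D)} \<subseteq> N"
      by (auto simp: eventually_ae_filter)
    then have "negligible N"
      by (subst negligible_iff_null_sets_borel) auto
    moreover have "S \<subseteq> N" using N(2) by (auto simp: S_def)
    ultimately show ?thesis by (rule negligible_subset)
  qed
  moreover have "negligible (\<phi> ` S)" if "negligible S"
  proof (rule negligible_locally_Lipschitz_image)
    fix y assume "y \<in> S"
    then show "\<exists>U E. open U \<and> y \<in> U \<and> (\<forall>y'\<in>S \<inter> U. norm (\<phi> y' - \<phi> y) \<le> E * norm (y' - y))"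
      using lip' by (intro exI[of _ UNIV] exI[of _ "\<bar>C\<bar>"]) (auto simp: S_def)
  qed (use that in auto)
  ultimately have "negligible D" by (meson negligible_subset)
  then show False using D negligible_iff_null_sets_borel by blast
qed

text \<open>
  Jobs \<open>0..<m\<close> have length \<open>j0\<close> and gaps at most \<open>x0 < j0\<close>, so work builds up; then gaps \<open>x1\<close>
  exceed the lengths \<open>j1\<close>, so work drains and job \<open>k\<close> finds as little as \<open>w / 2\<close>.  With the fast gaps
  shortened one at a time from \<open>x0 - \<theta>\<close> to \<open>x0 - \<epsilon>\<close>, the sojourn time of job \<open>k\<close> moves from
  below \<open>p\<close> to above \<open>q\<close>.
\<close>

lemma crossing_scenario:
  fixes x0 j0 x1 j1 \<epsilon> p q :: real
  assumes pos: "0 < \<epsilon>" "\<epsilon> < x0" "x0 < j0" "0 < j1" "j1 < x1" "j1 < p" "p < q"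
  obtains m k K :: nat and \<theta> w :: real where
    "m \<le> k" "k < K" "0 < \<theta>" "\<theta> < \<epsilon>" "0 < w"
    "q + 1 < real (K - k) * (x1 / 2)"
    "\<And>x l. (\<And>i. i < m \<Longrightarrow> x i \<le> x0 - \<theta>) \<Longrightarrow> (\<And>i. m \<le> i \<Longrightarrow> i < k \<Longrightarrow> x i \<le> x1) \<Longrightarrow>
       1 \<le> l \<Longrightarrow> l \<le> k \<Longrightarrow> arrival x l + w \<le> (\<Sum>i<l. if i < m then j0 else j1)"
    "sojourn_upto (\<lambda>i. if i < m then x0 - \<theta> else x1) (\<lambda>i. if i < m then j0 else j1) K k < p"
    "q < sojourn_upto (\<lambda>i. if i < m then x0 - \<epsilon> else x1) (\<lambda>i. if i < m then j0 else j1) K k"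
proof -
  \<comment> \<open>With gap \<open>x0\<close> a fast job adds \<open>a\<close> to the work in the
    queue; a slow one removes \<open>b\<close>. The bounds on \<open>v\<close> let job
    \<open>k\<close>, when it finds work \<open>v / 2\<close>, leave before the next arrival and
    with a sojourn time below \<open>p\<close>.\<close>
  define a where "a = j0 - x0"
  define b where "b = x1 - j1"
  define v where "v = min (p - j1) b"
  define Jm where "Jm = max j0 j1"
  have a: "0 < a" and b: "0 < b" and v: "0 < v" "v \<le> b" "v \<le> p - j1" and Jm: "0 < Jm" "j0 \<le> Jm" "j1 \<le> Jm"
    using pos by (auto simp: a_def b_def v_def Jm_def)
  have q0: "0 < q" using pos by simp
  \<comment> \<open>Two lower bounds: the first gives \<open>\<theta> < \<epsilon> / 2\<close>, the
    second a sojourn time above \<open>q\<close> when the fast gaps are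
    \<open>x0 - \<epsilon>\<close>.\<close>
  define m where "m = Suc (nat \<lceil>2 * (b + v) / \<epsilon> + 2 * q * Jm / (j1 * \<epsilon>)\<rceil>)"
  have "2 * (b + v) / \<epsilon> + 2 * q * Jm / (j1 * \<epsilon>) < real m"
    unfolding m_def by linarith
  moreover have "0 < 2 * (b + v) / \<epsilon>" "0 < 2 * q * Jm / (j1 * \<epsilon>)"
    using pos b v q0 Jm by auto
  ultimately have m1: "2 * (b + v) / \<epsilon> < real m" and m2: "2 * q * Jm / (j1 * \<epsilon>) < real m" by linarith+
  have m0: "0 < real m" by (simp add: m_def)
  \<comment> \<open>As many slow jobs as it takes to drain the surplus \<open>m * a\<close> of the
    fast phase; rounding up overshoots by less than \<open>b\<close>.\<close>
  define n where "n = nat \<lceil>real m * a / b\<rceil>"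
  have "real m * a / b \<le> real n" "real n < real m * a / b + 1"
  proof -
    have "0 \<le> real m * a / b" using a b by simp
    then have "real n = of_int \<lceil>real m * a / b\<rceil>" by (simp add: n_def)
    then show "real m * a / b \<le> real n" "real n < real m * a / b + 1" by linarith+
  qed
  then have n: "real m * a \<le> real n * b" "real n * b < real m * a + b"
    using b by (auto simp: field_simps)
  \<comment> \<open>Shortening each fast gap by \<open>\<theta>\<close> cancels the overshoot and
    leaves exactly \<open>v / 2\<close> for job \<open>k\<close>.\<close>
  define \<theta> where "\<theta> = (real n * b + v / 2) / real m - a"
  have m\<theta>: "real m * (a + \<theta>) = real n * b + v / 2"
    using m0 by (simp add: \<theta>_def)
  then have m\<theta>': "real m * \<theta> = real n * b + v / 2 - real m * a" by (simp add: algebra_simps)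
  have "0 < real m * \<theta>" using m\<theta>' n v by linarith
  then have \<theta>0: "0 < \<theta>" using m0 by (simp add: zero_less_mult_iff)
  have "real m * \<theta> < b + v" using m\<theta>' n v by linarith
  also have "b + v < real m * (\<epsilon> / 2)" using m1 pos by (simp add: field_simps)
  finally have \<theta>\<epsilon>: "\<theta> < \<epsilon> / 2" using m0 by simp
  define k where "k = m + n"
  define K where "K = k + Suc (nat \<lceil>2 * (q + 1) / x1\<rceil>)"
  define js where "js = (\<lambda>i. if i < m then j0 else j1)"
  \<comment> \<open>The surplus of work first rises and then falls, so it is least after the first
    job or at the arrival of job \<open>k\<close>.\<close>
  define w where "w = min (a + \<theta>) (v / 2)"
  have w: "0 < w" using a \<theta>0 v by (simp add: w_def)
  have x1: "0 < x1" using pos by simp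
  have js0: "0 \<le> js i" for i using pos by (auto simp: js_def)
  have Kk: "q + 1 < real (K - k) * (x1 / 2)"
  proof -
    have "2 * (q + 1) / x1 < real (K - k)" unfolding K_def by simp linarith
    then show ?thesis using x1 by (simp add: field_simps)
  qed
  have work: "arrival x l + w \<le> (\<Sum>i<l. js i)"
    if x: "\<And>i. i < m \<Longrightarrow> x i \<le> x0 - \<theta>" "\<And>i. m \<le> i \<Longrightarrow> i < k \<Longrightarrow> x i \<le> x1" and l: "1 \<le> l" "l \<le> k" for x l
  proof -
    have "w \<le> real (min l m) * (a + \<theta>) + real (l - m) * (- b)"
    proof (cases "l \<le> m")
      case True
      have "1 * (a + \<theta>) \<le> real l * (a + \<theta>)" using l a \<theta>0 by (intro mult_right_mono) auto
      then show ?thesis using True by (simp add: w_def min_def)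
    next
      case False
      then have "real (l - m) * b \<le> real n * b" using l b by (intro mult_right_mono) (auto simp: k_def)
      then show ?thesis using False m\<theta> by (simp add: w_def min_def)
    qed
    also have "\<dots> = (\<Sum>i<l. if i < m then a + \<theta> else - b)" by (rule sum_two_level[symmetric])
    also have "\<dots> \<le> (\<Sum>i<l. js i - x i)"
      using x l by (intro sum_mono) (auto simp: js_def a_def b_def algebra_simps)
    finally show ?thesis by (simp add: sum_subtractf arrival_def)
  qed
  have W: "(\<Sum>i<k. js i) - arrival (\<lambda>i. if i < m then x0 - \<delta> else x1) k = v / 2 + real m * (\<delta> - \<theta>)" for \<delta>
  proof -
    have "(\<Sum>i<k. js i) - arrival (\<lambda>i. if i < m then x0 - \<delta> else x1) k = (\<Sum>i<k. if i < m then a + \<delta> else - b)"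
      unfolding arrival_def sum_subtractf[symmetric] by (intro sum.cong) (auto simp: js_def a_def b_def)
    also have "\<dots> = real m * (a + \<delta>) + real n * (- b)"
      unfolding sum_two_level by (simp add: k_def)
    also have "\<dots> = v / 2 + real m * (\<delta> - \<theta>)" using m\<theta> by (simp add: algebra_simps)
    finally show ?thesis .
  qed
  have kK: "k < K" by (simp add: K_def)
  have jsk: "js k = j1" by (simp add: js_def k_def)
  let ?xP = "\<lambda>i. if i < m then x0 - \<theta> else x1" and ?xQ = "\<lambda>i. if i < m then x0 - \<epsilon> else x1"
  have "sojourn_upto ?xP js K k \<le> (\<Sum>i<Suc k. js i) - arrival ?xP k"
  proof (rule sojourn_upto_le)
    show "arrival ?xP l \<le> (\<Sum>i<l. js i)" if "1 \<le> l" "l \<le> k" for l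
      using work[of ?xP l] that w by auto
    show "(\<Sum>i<Suc k. js i) \<le> arrival ?xP (Suc k)"
    proof -
      have "\<not> k < m" by (simp add: k_def)
      then show ?thesis using W[of \<theta>] v by (simp add: arrival_Suc jsk b_def)
    qed
  qed (use pos \<theta>\<epsilon> js0 kK in auto)
  also have "\<dots> < p" using W[of \<theta>] v by (simp add: jsk)
  finally have P: "sojourn_upto ?xP js K k < p" .
  have "q < j1 / Jm * (real m * (\<epsilon> / 2))"
    using m2 pos Jm by (simp add: field_simps)
  also have "\<dots> \<le> j1 / Jm * (v / 2 + real m * (\<epsilon> - \<theta>))"
  proof (intro mult_left_mono)
    have "real m * (\<epsilon> / 2) \<le> real m * (\<epsilon> - \<theta>)" using \<theta>\<epsilon> by (intro mult_left_mono) auto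
    then show "real m * (\<epsilon> / 2) \<le> v / 2 + real m * (\<epsilon> - \<theta>)" using v by simp
  qed (use pos Jm in auto)
  also have "\<dots> = js k / Jm * ((\<Sum>i<k. js i) - arrival ?xQ k)" by (simp only: W jsk)
  also have "\<dots> \<le> sojourn_upto ?xQ js K k"
  proof (rule sojourn_upto_ge)
    show "arrival ?xQ l \<le> (\<Sum>i<l. js i)" if "1 \<le> l" "l \<le> k" for l
      using work[of ?xQ l] that w \<theta>\<epsilon> pos by auto
    show "js i \<le> Jm" for i using Jm by (simp add: js_def)
  qed (use pos js0 kK Jm in auto)
  finally have Q: "q < sojourn_upto ?xQ js K k" .
  show thesis
    by (rule that[of m k K \<theta> w]) (use kK \<theta>0 \<theta>\<epsilon> w Kk work P Q pos in \<open>auto simp: k_def js_def\<close>)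
qed

section \<open>Sojourn times reach every set of positive measure\<close>

context processor_sharing
begin

text \<open>Cutting off at 0 gives nonnegative sequences for every \<open>z\<close>, as
  \<open>sojourn_upto_measurable\<close> requires; on positive inputs nothing changes.\<close>

lemma sojourn_upto_box_measurable:
  assumes D: "D \<in> sets borel" and I: "finite I" and A: "\<And>s. s \<in> I \<Longrightarrow> A s \<in> sets borel" and E: "E \<in> sets borel"
  shows "Measurable.pred (PiM UNIV (\<lambda>_. borel)) (\<lambda>z :: nat + nat \<Rightarrow> real. (\<forall>s\<in>I. z s \<in> A s) \<and> z a \<in> E \<longrightarrow>
    sojourn_upto (\<lambda>i. max 0 (z (Inl i))) (\<lambda>i. max 0 (z (Inr i))) K k \<notin> D)"
proof -
  let ?P = "PiM UNIV (\<lambda>_. borel) :: (nat + nat \<Rightarrow> real) measure"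
  have [measurable]: "(\<lambda>z. sojourn_upto (\<lambda>i. max 0 (z (Inl i))) (\<lambda>i. max 0 (z (Inr i))) K k) \<in> borel_measurable ?P"
    by (rule sojourn_upto_measurable) auto
  have 1: "Measurable.pred ?P (\<lambda>z. z s \<in> A s)" if "s \<in> I" for s
    using measurable_sets[OF measurable_component_singleton[of s UNIV "\<lambda>_. borel"] A[OF that]]
    by (simp add: pred_def vimage_def Int_def conj_commute)
  have [measurable]: "Measurable.pred ?P (\<lambda>z. \<forall>s\<in>I. z s \<in> A s)"
    by (rule pred_intros_finite(3)[OF I 1])
  have [measurable]: "D \<in> sets borel" "E \<in> sets borel" by fact+
  show ?thesis by measurable
qed

text \<open>
  The sojourn time of job \<open>k\<close> is a Lipschitz function of a single gap and crosses an interval that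
  \<open>A\<close> meets in positive measure.  Lipschitz images of null sets are null and gaps have a positive
  density there, so the sojourn time hits \<open>A\<close>.
\<close>

lemma sojourn_hits:
  fixes \<beta> :: ereal
  assumes x0: "0 < x0" "0 < f_X x0" "ereal x0 < \<beta>" and x1: "0 < f_X x1" "\<alpha> < x1"
    and \<alpha>: "0 \<le> \<alpha>" "ereal \<alpha> < \<beta>"
    and J: "\<And>i y d. \<alpha> < y \<Longrightarrow> ereal y < \<beta> \<Longrightarrow> 0 < d \<Longrightarrow> 0 < prob {\<omega>\<in>space M. J i \<omega> \<in> {y - d<..<y + d}}"
    and A: "A \<in> sets borel" "A \<subseteq> {\<alpha><..}" "emeasure lborel A \<noteq> 0"
  shows "\<exists>k. \<not> (AE \<omega> in M. \<not> (enat k < B \<omega> \<and> T k \<omega> \<in> A))"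
proof -
  have "{u\<in>A. ereal \<alpha> < ereal u \<and> ereal u < \<infinity>} = A" using A by auto
  then obtain p q where pq: "\<alpha> < p" "emeasure lborel (A \<inter> {p<..<q}) \<noteq> 0"
    using nonnegligible_subinterval[of A "ereal \<alpha>" \<infinity>] A by auto
  define A' where "A' = A \<inter> {p<..<q}"
  have A': "A' \<in> sets borel" using A by (simp add: A'_def)
  have "p < q"
  proof (rule ccontr)
    assume "\<not> p < q" then have "A \<inter> {p<..<q} = {}" by auto
    then show False using pq by simp
  qed
  have "isCont f_X x0"
    using f_X_continuous x0 by (simp add: continuous_on_eq_continuous_at)
  then have "\<forall>\<^sub>F u in nhds x0. 0 < f_X u"
    unfolding isCont_def tendsto_at_iff_tendsto_nhds using x0(2) by (rule order_tendstoD(1))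
  then obtain e where e: "0 < e" "\<And>u. dist u x0 < e \<Longrightarrow> 0 < f_X u"
    unfolding eventually_nhds_metric by auto
  define \<epsilon> where "\<epsilon> = min e x0 / 2"
  have \<epsilon>: "0 < \<epsilon>" "\<epsilon> < x0" using e x0 by (auto simp: \<epsilon>_def)
  have f_pos: "0 < f_X u" if "x0 - \<epsilon> \<le> u" "u \<le> x0" for u
    using e(2)[of u] that e(1) x0 by (auto simp: \<epsilon>_def dist_real_def)
  \<comment> \<open>The long length \<open>j0\<close> exceeds the gap \<open>x0\<close>; the short
    one \<open>j1\<close> is above \<open>\<alpha>\<close> but below \<open>x1\<close> and
    \<open>p\<close>. Both lie strictly between the bounds of the support.\<close>
  have "ereal (max \<alpha> x0) < \<beta>" using x0 \<alpha> by (simp add: max_def)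
  from ereal_dense2[OF this] obtain j0 where "ereal (max \<alpha> x0) < ereal j0" and j0': "ereal j0 < \<beta>"
    by blast
  then have j0: "max \<alpha> x0 < j0" "ereal j0 < \<beta>"
    unfolding less_ereal.simps by auto
  have "ereal \<alpha> < min \<beta> (ereal (min p x1))" using \<alpha> x1 pq by simp
  from ereal_dense2[OF this] obtain j1 where "ereal \<alpha> < ereal j1" "ereal j1 < min \<beta> (ereal (min p x1))"
    by blast
  then have j1: "\<alpha> < j1" "ereal j1 < min \<beta> (ereal (min p x1))" by simp_all
  then have j1': "j1 < p" "j1 < x1" "ereal j1 < \<beta>" by auto
  obtain m k K \<theta> w where
    mk: "m \<le> k" "k < K" and \<theta>: "0 < \<theta>" "\<theta> < \<epsilon>" and w: "0 < w" and
    K: "q + 1 < real (K - k) * (x1 / 2)" and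
    work: "\<And>x l. (\<And>i. i < m \<Longrightarrow> x i \<le> x0 - \<theta>) \<Longrightarrow> (\<And>i. m \<le> i \<Longrightarrow> i < k \<Longrightarrow> x i \<le> x1) \<Longrightarrow>
       1 \<le> l \<Longrightarrow> l \<le> k \<Longrightarrow> arrival x l + w \<le> (\<Sum>i<l. if i < m then j0 else j1)" and
    P: "sojourn_upto (\<lambda>i. if i < m then x0 - \<theta> else x1) (\<lambda>i. if i < m then j0 else j1) K k < p" and
    Q: "q < sojourn_upto (\<lambda>i. if i < m then x0 - \<epsilon> else x1) (\<lambda>i. if i < m then j0 else j1) K k"
    by (rule crossing_scenario[of \<epsilon> x0 j0 j1 x1 p q]) (use \<epsilon> j0 j1 j1' \<alpha> \<open>p < q\<close> in auto)
  define js where "js = (\<lambda>i. if i < m then j0 else j1)"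
  \<comment> \<open>In \<open>xs r\<close> the first \<open>r\<close> fast gaps are already
    shortened, so consecutive profiles differ in one gap only.\<close>
  define xs where "xs r i = (if i < m then if i < r then x0 - \<epsilon> else x0 - \<theta> else x1)" for r i
  define \<tau> where "\<tau> r = sojourn_upto (xs r) js K k" for r
  have "xs 0 = (\<lambda>i. if i < m then x0 - \<theta> else x1)" by (auto simp: xs_def)
  then have \<tau>0: "\<tau> 0 < p" using P by (simp add: \<tau>_def js_def)
  have "xs m = (\<lambda>i. if i < m then x0 - \<epsilon> else x1)" by (auto simp: xs_def)
  then have \<tau>m: "q < \<tau> m" using Q by (simp add: \<tau>_def js_def)
  \<comment> \<open>The ranges from \<open>\<tau> r\<close> to \<open>\<tau> (Suc r)\<close> cover
    \<open>A'\<close> up to the finitely many points \<open>\<tau> r\<close>, so one of them meets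
    \<open>A'\<close> in positive measure.\<close>
  obtain r where r: "r < m" "emeasure lborel {u\<in>A'. ereal (\<tau> r) < ereal u \<and> ereal u < ereal (\<tau> (Suc r))} \<noteq> 0"
  proof (rule ccontr)
    assume no: "\<not> thesis"
    note hyp = that
    have none: "{u\<in>A'. ereal (\<tau> r) < ereal u \<and> ereal u < ereal (\<tau> (Suc r))} \<in> null_sets lborel" if "r < m" for r
      using hyp[of r] no that A' by (auto simp: null_sets_def)
    have "A' \<subseteq> (\<Union>r<m. {u\<in>A'. ereal (\<tau> r) < ereal u \<and> ereal u < ereal (\<tau> (Suc r))} \<union> {\<tau> r})"
    proof
      fix u assume u: "u \<in> A'"
      then have "p < u" "u < q" by (auto simp: A'_def)
      then obtain r where "r < m" "\<tau> r \<le> u" "u < \<tau> (Suc r)"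
        using discrete_upcrossing[of \<tau> u m] \<tau>0 \<tau>m by auto
      then show "u \<in> (\<Union>r<m. {u\<in>A'. ereal (\<tau> r) < ereal u \<and> ereal u < ereal (\<tau> (Suc r))} \<union> {\<tau> r})"
        using u by (auto intro!: bexI[of _ r])
    qed
    moreover have "(\<Union>r<m. {u\<in>A'. ereal (\<tau> r) < ereal u \<and> ereal u < ereal (\<tau> (Suc r))} \<union> {\<tau> r}) \<in> null_sets lborel"
      using none by (intro null_sets_UN' null_sets.Un) auto
    ultimately have "A' \<in> null_sets lborel" using A' by (intro null_sets_subset[of _ lborel A']) auto
    then show False using pq by (simp add: A'_def null_sets_def)
  qed
  obtain c d where cd: "\<tau> r < c" "d < \<tau> (Suc r)" "emeasure lborel (A' \<inter> {c<..<d}) \<noteq> 0"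
    using nonnegligible_subinterval[OF A' r(2)] by auto
  define D where "D = A' \<inter> {c<..<d}"
  have D: "D \<in> sets borel" "emeasure lborel D \<noteq> 0" using A' cd by (auto simp: D_def)
  obtain C where C: "0 < C" and lip: "input_lipschitz K (\<lambda>x j. sojourn_upto x j K k) C"
    using sojourn_upto_lipschitz[OF mk(2)] by blast
  \<comment> \<open>Tolerance for all inputs but gap \<open>r\<close>. Its four bounds keep the work
    surplus positive, the two end values on either side of \<open>{c<..<d}\<close>, and the slow
    gaps at least \<open>x1 / 2\<close>.\<close>
  define \<delta> where "\<delta> = Min {w / (2 * real (Suc K)), (c - \<tau> r) / C, (\<tau> (Suc r) - d) / C, x1 / 2}"
  have x1p: "0 < x1" using x1 \<alpha> by simp
  have \<delta>: "0 < \<delta>" "\<delta> \<le> w / (2 * real (Suc K))" "\<delta> \<le> (c - \<tau> r) / C" "\<delta> \<le> (\<tau> (Suc r) - d) / C" "\<delta> \<le> x1 / 2"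
  proof -
    let ?U = "{w / (2 * real (Suc K)), (c - \<tau> r) / C, (\<tau> (Suc r) - d) / C, x1 / 2}"
    show "0 < \<delta>" unfolding \<delta>_def using w cd C x1p by (subst Min_gr_iff) auto
    have "\<delta> \<le> y" if "y \<in> ?U" for y unfolding \<delta>_def by (rule Min_le) (use that in simp_all)
    then show "\<delta> \<le> w / (2 * real (Suc K))" "\<delta> \<le> (c - \<tau> r) / C" "\<delta> \<le> (\<tau> (Suc r) - d) / C" "\<delta> \<le> x1 / 2"
      by blast+
  qed
  have C\<delta>: "\<tau> r + C * \<delta> \<le> c" "d \<le> \<tau> (Suc r) - C * \<delta>"
    using \<delta>(3,4) C by (simp_all add: field_simps)
  have l\<delta>: "2 * (real l * \<delta>) < w" if "l \<le> k" for l
  proof -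
    have "real l * \<delta> < real (Suc K) * \<delta>" using that mk \<delta>(1) by (intro mult_strict_right_mono) auto
    also have "real (Suc K) * \<delta> \<le> real (Suc K) * (w / (2 * real (Suc K)))" using \<delta>(2) by (intro mult_left_mono) auto
    also have "\<dots> = w / 2" by (simp del: of_nat_Suc)
    finally show ?thesis by simp
  qed
  define nom where "nom = case_sum (xs r) js"
  define I where "I = Inl ` ({..<K} - {r}) \<union> Inr ` {..<K}"
  define Bx where "Bx s = {nom s - \<delta><..<nom s + \<delta>}" for s
  define E where "E = {x0 - \<epsilon>..x0 - \<theta>}"
  define QQ where "QQ = (\<lambda>z :: nat + nat \<Rightarrow> real. (\<forall>s\<in>I. z s \<in> Bx s) \<and> z (Inl r) \<in> E \<longrightarrow>
    sojourn_upto (\<lambda>i. max 0 (z (Inl i))) (\<lambda>i. max 0 (z (Inr i))) K k \<notin> D)"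
  have fI: "finite I" by (simp add: I_def)
  have II: "i < K \<Longrightarrow> i \<noteq> r \<Longrightarrow> Inl i \<in> I" "i < K \<Longrightarrow> Inr i \<in> I" for i by (auto simp: I_def)
  have QQm: "Measurable.pred (PiM UNIV (\<lambda>_. borel)) QQ"
    unfolding QQ_def by (rule sojourn_upto_box_measurable[OF D(1) fI]) (auto simp: Bx_def E_def)
  have hit: "enat k < B \<omega> \<and> T k \<omega> \<in> A" if g: "good \<omega>" and nQ: "\<not> QQ (\<lambda>s. Z s \<omega>)" for \<omega>
  proof -
    let ?x = "\<lambda>i. X i \<omega>" and ?j = "\<lambda>i. J i \<omega>" and ?t = "\<lambda>i. T i \<omega>"
    have path: "processor_sharing_path ?x ?j ?t" and xp: "\<And>i. 0 < ?x i" and jp: "\<And>i. 0 < ?j i"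
      using g by (auto simp: good_def)
    have bxI: "\<forall>s\<in>I. Z s \<omega> \<in> Bx s" and Er: "X r \<omega> \<in> E" and
      hD: "sojourn_upto (\<lambda>i. max 0 (?x i)) (\<lambda>i. max 0 (?j i)) K k \<in> D"
      using nQ by (auto simp: QQ_def)
    have bx: "\<bar>?x i - xs r i\<bar> < \<delta>" if "i < K" "i \<noteq> r" for i
      using bspec[OF bxI II(1)[OF that]] by (auto simp: Bx_def nom_def abs_less_iff)
    have bj: "\<bar>?j i - js i\<bar> < \<delta>" if "i < K" for i
      using bspec[OF bxI II(2)[OF that]] by (auto simp: Bx_def nom_def abs_less_iff)
    have \<Phi>: "sojourn_upto ?x ?j K k \<in> D"
      using hD xp jp by (simp add: max_absorb2 less_imp_le)
    \<comment> \<open>The scenario allows gaps up to the nominal ones, hence the shift by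
      \<open>\<delta>\<close>; the margin \<open>w\<close> absorbs the shift and the deviations of
      the job lengths.\<close>
    have "arrival ?x l < (\<Sum>i<l. ?j i)" if l: "1 \<le> l" "l \<le> k" for l
    proof -
      have "arrival (\<lambda>i. ?x i - \<delta>) l + w \<le> (\<Sum>i<l. if i < m then j0 else j1)"
      proof (rule work)
        show "?x i - \<delta> \<le> x0 - \<theta>" if "i < m" for i
          using bx[of i] that mk Er \<delta>(1) \<theta> by (cases "i = r") (auto simp: xs_def E_def abs_less_iff split: if_splits)
        show "?x i - \<delta> \<le> x1" if "m \<le> i" "i < k" for i
          using bx[of i] that mk r(1) by (auto simp: xs_def abs_less_iff)
      qed (use l in auto)
      moreover have "arrival (\<lambda>i. ?x i - \<delta>) l = arrival ?x l - real l * \<delta>"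
        by (simp add: arrival_def sum_subtractf)
      moreover have "(\<Sum>i<l. js i) \<le> (\<Sum>i<l. ?j i + \<delta>)"
      proof (rule sum_mono)
        fix i assume "i \<in> {..<l}"
        then show "js i \<le> ?j i + \<delta>" using bj[of i] l mk by simp
      qed
      moreover have "(\<Sum>i<l. ?j i + \<delta>) = (\<Sum>i<l. ?j i) + real l * \<delta>" by (simp add: sum.distrib)
      ultimately show ?thesis using l\<delta>[OF l(2)] by (simp add: js_def)
    qed
    then have kB: "enat k < B \<omega>" by (rule less_busy_arrivals_if_work[OF path xp jp])
    \<comment> \<open>The gaps from job \<open>k\<close> to job \<open>K\<close> add up to more than
      \<open>q\<close>, so the truncation at \<open>K\<close> is harmless.\<close>
    have "real (K - k) * (x1 / 2) = (\<Sum>i\<in>{k..<K}. x1 / 2)" by simp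
    also have "\<dots> \<le> (\<Sum>i\<in>{k..<K}. ?x i)"
    proof (intro sum_mono)
      fix i assume "i \<in> {k..<K}"
      then show "x1 / 2 \<le> ?x i"
        using bx[of i] mk r(1) \<delta>(5) by (auto simp: xs_def abs_less_iff)
    qed
    also have "\<dots> = arrival ?x K - arrival ?x k" using mk by (simp add: arrival_diff)
    finally have "sojourn_upto ?x ?j K k < arrival ?x K - arrival ?x k"
      using \<Phi> K by (simp add: D_def A'_def)
    from sojourn_eq_sojourn_upto[OF path xp jp kB mk(2) this] have "T k \<omega> \<in> D" using \<Phi> by simp
    then show ?thesis using kB by (simp add: D_def A'_def)
  qed
  show ?thesis
  proof (intro exI notI)
    assume "AE \<omega> in M. \<not> (enat k < B \<omega> \<and> T k \<omega> \<in> A)"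
    with AE_good have "AE \<omega> in M. QQ (\<lambda>s. Z s \<omega>)"
      by eventually_elim (use hit in blast)
    \<comment> \<open>Gap \<open>r\<close> is resampled; afterwards the other inputs are frozen at
      one sample point in the box.\<close>
    then have "AE \<omega> in M. AE y in lborel. 0 < f_X y \<longrightarrow> QQ ((\<lambda>s. Z s \<omega>)(Inl r := y))"
      using AE_update[OF QQm, of "Inl r"] by simp
    with AE_good have "AE \<omega> in M. good \<omega> \<and> (AE y in lborel. 0 < f_X y \<longrightarrow> QQ ((\<lambda>s. Z s \<omega>)(Inl r := y)))"
      by eventually_elim blast
    moreover have "0 < prob {\<omega>\<in>space M. Z s \<omega> \<in> Bx s}" if s: "s \<in> I" for s
    proof (cases s)
      case (Inl i)
      have "0 < f_X (xs r i)" "0 < xs r i"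
        using f_pos x1 x1p \<theta> \<epsilon> by (auto simp: xs_def)
      then show ?thesis
        using prob_near_pos[of s "nom s" \<delta>] f_X_continuous \<delta>(1) Inl by (simp add: Bx_def nom_def)
    next
      case (Inr i)
      have "\<alpha> < js i" "ereal (js i) < \<beta>" using j0 j1 j1' by (auto simp: js_def)
      then show ?thesis using J[of "js i" \<delta> i] \<delta>(1) Inr by (simp add: Bx_def nom_def)
    qed
    ultimately obtain \<omega> where g: "good \<omega>" and bx: "\<forall>s\<in>I. Z s \<omega> \<in> Bx s"
      and ae: "AE y in lborel. 0 < f_X y \<longrightarrow> QQ ((\<lambda>s. Z s \<omega>)(Inl r := y))"
      using AE_exists_in_box[OF fI, of Bx] unfolding Bx_def by (metis (no_types, lifting) borel_open open_greaterThanLessThan)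
    let ?x = "\<lambda>i. X i \<omega>" and ?j = "\<lambda>i. J i \<omega>"
    have xp: "\<And>i. 0 < ?x i" and jp: "\<And>i. 0 < ?j i" using g by (auto simp: good_def)
    have near_x: "\<bar>?x i - xs r i\<bar> \<le> \<delta>" if "i < K" "i \<noteq> r" for i
      using bspec[OF bx II(1)[OF that]] by (auto simp: Bx_def nom_def abs_le_iff)
    have near_j: "\<bar>?j i - js i\<bar> \<le> \<delta>" if "i < K" for i
      using bspec[OF bx II(2)[OF that]] by (auto simp: Bx_def nom_def abs_le_iff)
    note near = near_x near_j
    define \<phi> where "\<phi> y = sojourn_upto (?x(r := y)) ?j K k" for y
    have nonneg: "0 \<le> y" if "y \<in> E" for y using that \<epsilon> by (auto simp: E_def)
    have js0: "0 \<le> js i" and xs0: "0 \<le> xs r' i" for i r'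
      using j0 j1 \<alpha> \<epsilon> \<theta> x1p by (auto simp: js_def xs_def)
    have ends: "x0 - \<epsilon> \<in> E" "x0 - \<theta> \<in> E" using \<theta> by (auto simp: E_def)
    have E_lip: "\<bar>\<phi> y - \<phi> y'\<bar> \<le> C * \<bar>y - y'\<bar>" if "y \<in> E" "y' \<in> E" for y y'
      unfolding \<phi>_def
      by (rule input_lipschitzD[OF lip]) (use nonneg that xp jp in \<open>auto simp: less_imp_le\<close>)
    have xsr: "xs r r = x0 - \<theta>" "xs (Suc r) r = x0 - \<epsilon>" "\<And>i. i \<noteq> r \<Longrightarrow> xs (Suc r) i = xs r i"
      using r by (auto simp: xs_def)
    have end_lip: "\<bar>\<phi> y - sojourn_upto (xs r') js K k\<bar> \<le> C * \<delta>"
      if y: "y \<in> E" "xs r' r = y" "\<And>i. i \<noteq> r \<Longrightarrow> xs r' i = xs r i" for y r'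
      unfolding \<phi>_def
    proof (rule input_lipschitzD[OF lip])
      show "\<forall>i. 0 \<le> (?x(r := y)) i \<and> 0 \<le> ?j i \<and> 0 \<le> xs r' i \<and> 0 \<le> js i"
        using nonneg[OF y(1)] xp jp xs0 js0 by (auto simp: less_imp_le)
      show "\<forall>i<K. \<bar>(?x(r := y)) i - xs r' i\<bar> \<le> \<delta> \<and> \<bar>?j i - js i\<bar> \<le> \<delta>"
        using near y(2,3) \<delta>(1) by auto
    qed
    have "\<bar>\<phi> (x0 - \<theta>) - \<tau> r\<bar> \<le> C * \<delta>"
      unfolding \<tau>_def by (rule end_lip) (use ends xsr in auto)
    moreover have "\<bar>\<phi> (x0 - \<epsilon>) - \<tau> (Suc r)\<bar> \<le> C * \<delta>"
      unfolding \<tau>_def by (rule end_lip) (use ends xsr in auto)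
    ultimately have cover: "\<phi> (x0 - \<theta>) \<le> u \<and> u \<le> \<phi> (x0 - \<epsilon>)" if "u \<in> D" for u
      using that C\<delta> by (auto simp: D_def abs_le_iff)
    have "AE y in lborel. y \<in> {x0 - \<epsilon>..x0 - \<theta>} \<longrightarrow> \<phi> y \<notin> D"
      using ae
    proof (rule eventually_mono)
      fix y assume y: "0 < f_X y \<longrightarrow> QQ ((\<lambda>s. Z s \<omega>)(Inl r := y))"
      show "y \<in> {x0 - \<epsilon>..x0 - \<theta>} \<longrightarrow> \<phi> y \<notin> D"
      proof
        assume yE: "y \<in> {x0 - \<epsilon>..x0 - \<theta>}"
        then have "QQ ((\<lambda>s. Z s \<omega>)(Inl r := y))" using y f_pos[of y] \<theta> by auto
        moreover have "\<forall>s\<in>I. ((\<lambda>s. Z s \<omega>)(Inl r := y)) s \<in> Bx s" using bx by (auto simp: I_def)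
        moreover have "(\<lambda>i. max 0 (((\<lambda>s. Z s \<omega>)(Inl r := y)) (Inl i))) = ?x(r := y)"
          using xp nonneg[of y] yE by (auto simp: fun_eq_iff E_def max_def not_le less_imp_le)
        moreover have "(\<lambda>i. max 0 (((\<lambda>s. Z s \<omega>)(Inl r := y)) (Inr i))) = ?j"
          using jp by (auto simp: fun_eq_iff max_def not_le less_imp_le)
        ultimately show "\<phi> y \<notin> D" using yE unfolding QQ_def \<phi>_def E_def by simp
      qed
    qed
    then show False
      using lipschitz_image_not_null[of "x0 - \<epsilon>" "x0 - \<theta>" \<phi> C D] E_lip cover D \<theta> by (auto simp: E_def)
  qed
qed

end

section \<open>Comparison of the two queues\<close>

lemma Collect_near_eq: "{\<omega>\<in>A. \<bar>h \<omega> - x\<bar> < e} = {\<omega>\<in>A. h \<omega> \<in> {x - e<..<x + e}}" for h :: "_ \<Rightarrow> real"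
  by (auto simp: abs_less_iff)

text \<open>A value outside the support lies in an interval of probability 0 with rational end
  points, and there are countably many of these.\<close>

lemma (in prob_space) AE_law_support:
  assumes [measurable]: "W \<in> borel_measurable M"
  shows "AE \<omega> in M. W \<omega> \<in> law_support M W"
proof -
  have "AE \<omega> in M. prob {\<omega>\<in>space M. W \<omega> \<in> {a<..<b}} = 0 \<longrightarrow> W \<omega> \<notin> {a<..<b}" for a b
  proof (cases "prob {\<omega>\<in>space M. W \<omega> \<in> {a<..<b}} = 0")
    case True
    then have "AE \<omega> in M. W \<omega> \<notin> {a<..<b}"
      by (subst AE_iff_measurable[OF _ refl]) (auto simp: emeasure_eq_measure)
    then show ?thesis by auto
  qed simp
  then have "AE \<omega> in M. \<forall>a b :: rat. prob {\<omega>\<in>space M. W \<omega> \<in> {of_rat a<..<of_rat b}} = 0 \<longrightarrow>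
      W \<omega> \<notin> {of_rat a<..<of_rat b}"
    by (simp add: AE_all_countable)
  then show ?thesis
  proof (rule eventually_mono)
    fix \<omega> assume *: "\<forall>a b :: rat. prob {\<omega>\<in>space M. W \<omega> \<in> {of_rat a<..<of_rat b}} = 0 \<longrightarrow>
      W \<omega> \<notin> {of_rat a<..<of_rat b}"
    show "W \<omega> \<in> law_support M W"
      unfolding law_support_def mem_Collect_eq
    proof (intro allI impI)
      fix e :: real assume e: "0 < e"
      obtain a where a: "W \<omega> - e < of_rat a" "of_rat a < W \<omega>"
        using of_rat_dense[of "W \<omega> - e" "W \<omega>"] e by auto
      obtain b where b: "W \<omega> < of_rat b" "of_rat b < W \<omega> + e"
        using of_rat_dense[of "W \<omega>" "W \<omega> + e"] e by auto
      have "prob {\<omega>'\<in>space M. W \<omega>' \<in> {of_rat a<..<of_rat b}} \<noteq> 0"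
        using *[rule_format, of a b] a b by auto
      then have "0 < prob {\<omega>'\<in>space M. W \<omega>' \<in> {of_rat a<..<of_rat b}}"
        by (simp add: zero_less_measure_iff)
      also have "\<dots> \<le> prob {\<omega>'\<in>space M. \<bar>W \<omega>' - W \<omega>\<bar> < e}"
        using a b by (intro finite_measure_mono) (auto simp: abs_less_iff)
      finally show "0 < prob {\<omega>'\<in>space M. \<bar>W \<omega>' - W \<omega>\<bar> < e}" .
    qed
  qed
qed

text \<open>The test functions are indicators of upper half-lines, open ones for the first claim and
  closed ones for the second, which orders the negated variables.\<close>

lemma st_le_tails:
  assumes M: "prob_space M" and N: "prob_space N"
    and [measurable]: "Z \<in> borel_measurable M" "W \<in> borel_measurable N"
    and le: "st_le M Z N W"
  shows "measure N {\<omega>\<in>space N. W \<omega> \<le> c} \<le> measure M {\<omega>\<in>space M. Z \<omega> \<le> c}"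
    and "measure M {\<omega>\<in>space M. - Z \<omega> \<le> c} \<le> measure N {\<omega>\<in>space N. - W \<omega> \<le> c}"
proof -
  interpret M: prob_space M by fact
  interpret N: prob_space N by fact
  have *: "measure M {\<omega>\<in>space M. Z \<omega> \<in> U} \<le> measure N {\<omega>\<in>space N. W \<omega> \<in> U}"
    if [measurable]: "U \<in> sets borel" and U: "mono (indicator U :: real \<Rightarrow> real)" for U
  proof -
    have iM: "(\<lambda>\<omega>. indicator U (Z \<omega>) :: real) = indicator (Z -` U)" by (auto simp: indicator_def)
    have iN: "(\<lambda>\<omega>. indicator U (W \<omega>) :: real) = indicator (W -` U)" by (auto simp: indicator_def)
    have "integrable M (\<lambda>\<omega>. indicator U (Z \<omega>) :: real)"
      by (rule M.integrable_const_bound[of _ 1]) auto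
    moreover have "integrable N (\<lambda>\<omega>. indicator U (W \<omega>) :: real)"
      by (rule N.integrable_const_bound[of _ 1]) auto
    ultimately have "(\<integral>\<omega>. indicator U (Z \<omega>) \<partial>M) \<le> (\<integral>\<omega>. indicator U (W \<omega>) \<partial>N :: real)"
      using le U unfolding st_le_def by blast
    then show ?thesis
      unfolding iM iN by (simp add: vimage_def Int_def conj_commute)
  qed
  have "measure M {\<omega>\<in>space M. Z \<omega> \<in> {c<..}} \<le> measure N {\<omega>\<in>space N. W \<omega> \<in> {c<..}}"
    by (rule *) (auto simp: mono_def indicator_def)
  moreover have "measure M {\<omega>\<in>space M. Z \<omega> \<in> {c<..}} = 1 - measure M {\<omega>\<in>space M. Z \<omega> \<le> c}"
    by (subst M.prob_compl[symmetric]) (auto intro!: arg_cong[where f="measure M"])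
  moreover have "measure N {\<omega>\<in>space N. W \<omega> \<in> {c<..}} = 1 - measure N {\<omega>\<in>space N. W \<omega> \<le> c}"
    by (subst N.prob_compl[symmetric]) (auto intro!: arg_cong[where f="measure N"])
  ultimately show "measure N {\<omega>\<in>space N. W \<omega> \<le> c} \<le> measure M {\<omega>\<in>space M. Z \<omega> \<le> c}"
    by simp
  have "measure M {\<omega>\<in>space M. Z \<omega> \<in> {-c..}} \<le> measure N {\<omega>\<in>space N. W \<omega> \<in> {-c..}}"
    by (rule *) (auto simp: mono_def indicator_def)
  then show "measure M {\<omega>\<in>space M. - Z \<omega> \<le> c} \<le> measure N {\<omega>\<in>space N. - W \<omega> \<le> c}"
    by (simp add: minus_le_iff)
qed

section \<open>Accuracy in the infinite-server queue\<close>

context queue_primitives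
begin

lemma prob_Z_eq:
  assumes "pdf s = pdf s'" "U \<in> sets borel"
  shows "prob {\<omega>\<in>space M. Z s \<omega> \<in> U} = prob {\<omega>\<in>space M. Z s' \<omega> \<in> U}"
proof -
  have "prob {\<omega>\<in>space M. Z u \<omega> \<in> U} = measure (distr M borel (Z u)) U" for u
    using assms(2) by (subst measure_distr) (auto simp: vimage_def Int_def conj_commute)
  then show ?thesis using assms(1) by (simp add: distr_Z)
qed

lemma law_support_S: "law_support M (S i) = law_support M (S 0)"
proof -
  have "prob {\<omega>\<in>space M. \<bar>S i \<omega> - x\<bar> < e} = prob {\<omega>\<in>space M. \<bar>S 0 \<omega> - x\<bar> < e}" for x e
    using prob_Z_eq[of "Inr i" "Inr 0" "{x - e<..<x + e}"] unfolding Collect_near_eq by simp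
  then show ?thesis by (simp add: law_support_def)
qed

lemma law_support_nonneg: "u \<in> law_support M (S i) \<Longrightarrow> 0 \<le> u"
proof (rule ccontr)
  assume u: "u \<in> law_support M (S i)" and "\<not> 0 \<le> u"
  then have "0 < prob {\<omega>\<in>space M. \<bar>S i \<omega> - u\<bar> < - u}"
    by (auto simp: law_support_def)
  moreover have "AE \<omega> in M. \<not> \<bar>S i \<omega> - u\<bar> < - u"
    using AE_pos by (rule eventually_mono) (auto simp: abs_less_iff dest: spec[of _ i])
  then have "emeasure M {\<omega>\<in>space M. \<bar>S i \<omega> - u\<bar> < - u} = 0"
    by (subst (asm) AE_iff_measurable[OF _ refl]) auto
  ultimately show False by (simp add: measure_def)
qed

text \<open>Continuity puts every point with \<open>g u > 0\<close> into the support, so valid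
  matchings are feasible for \<open>\<alpha>\<close>. Departure times are almost surely distinct, so
  the true matching is well defined and has the full uniform weight.\<close>

lemma feasible_accuracy_le_rand_accuracy:
  assumes g: "continuous_on {0<..} g" and \<alpha>: "\<alpha> \<le> Inf (law_support M (S 0))"
  shows "(\<integral>\<^sup>+\<omega>. feasible_accuracy \<alpha> (\<lambda>i. X i \<omega>) (\<lambda>i. S i \<omega>) \<partial>M) \<le> rand_accuracy M g X S"
proof -
  have low: "\<alpha> \<le> u" if u: "0 < g u" for u
  proof -
    have u0: "0 < u" using u pdf_nonpos[of u "Inr 0"] by (cases "u \<le> 0") auto
    have "u \<in> law_support M (S 0)"
      unfolding law_support_def mem_Collect_eq
    proof (intro allI impI)
      fix e :: real assume "0 < e"
      with prob_near_pos[of "Inr 0" u e] g u u0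
      show "0 < prob {\<omega>\<in>space M. \<bar>S 0 \<omega> - u\<bar> < e}"
        unfolding Collect_near_eq by simp
    qed
    moreover have "bdd_below (law_support M (S 0))"
      using law_support_nonneg by (intro bdd_belowI[of _ 0])
    ultimately show ?thesis using \<alpha> cInf_lower by (meson order_trans)
  qed
  have "AE \<omega> in M. i \<noteq> k \<longrightarrow> departure (\<lambda>i. X i \<omega>) (\<lambda>i. S i \<omega>) i \<noteq> departure (\<lambda>i. X i \<omega>) (\<lambda>i. S i \<omega>) k" for i k
  proof (cases "i = k")
    case False
    define r where "r z = (\<Sum>l<i. z (Inl l)) - z (Inr k) - (\<Sum>l<k. z (Inl l))" for z :: "nat + nat \<Rightarrow> real"
    have "AE \<omega> in M. 1 * Z (Inr i) \<omega> + r (\<lambda>s. Z s \<omega>) \<notin> {0}"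
    proof (rule AE_affine_notin)
      show "r \<in> borel_measurable (PiM UNIV (\<lambda>_. borel))" unfolding r_def by measurable
      show "r (z(Inr i := y)) = r z" for z y using False by (simp add: r_def)
    qed auto
    then show ?thesis
      by (rule eventually_mono) (auto simp: r_def departure_def arrival_def)
  qed simp
  then have "AE \<omega> in M. \<forall>i k. i \<noteq> k \<longrightarrow> departure (\<lambda>i. X i \<omega>) (\<lambda>i. S i \<omega>) i \<noteq> departure (\<lambda>i. X i \<omega>) (\<lambda>i. S i \<omega>) k"
    by (simp add: AE_all_countable)
  moreover have "AE \<omega> in M. 0 < g (S i \<omega>)" for i
    using AE_Z[of "Inr i" "\<lambda>y. 0 < g y"] by simp
  then have "AE \<omega> in M. \<forall>i. 0 < g (S i \<omega>)" by (simp add: AE_all_countable)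
  ultimately have ae: "AE \<omega> in M. \<forall>b. ennreal (1 / real (card (feasible_matchings ((\<le>) \<alpha>) b (\<lambda>i. X i \<omega>) (\<lambda>i. S i \<omega>)))) \<le>
      ennreal (pmf (random_matching g b (\<lambda>i. X i \<omega>) (\<lambda>i. S i \<omega>)) (true_matching b (\<lambda>i. X i \<omega>) (\<lambda>i. S i \<omega>)))"
  proof eventually_elim
    case (elim \<omega>)
    show ?case
    proof (intro allI ennreal_leI pmf_random_matching_ge)
      show "0 \<le> g u" for u using pdf_nonneg[of "Inr 0" u] by simp
      show "inj_on (departure (\<lambda>i. X i \<omega>) (\<lambda>i. S i \<omega>)) {..<b}" for b
        using elim(1) by (auto simp: inj_on_def)
    qed (use elim(2) low in auto)
  qed
  have "(\<integral>\<^sup>+\<omega>. feasible_accuracy \<alpha> (\<lambda>i. X i \<omega>) (\<lambda>i. S i \<omega>) \<partial>M) =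
    (\<Sum>n. \<integral>\<^sup>+\<omega>. (if busy_arrivals (\<lambda>i. X i \<omega>) (\<lambda>i. S i \<omega>) = enat (Suc n)
       then ennreal (1 / real (card (feasible_matchings ((\<le>) \<alpha>) (Suc n) (\<lambda>i. X i \<omega>) (\<lambda>i. S i \<omega>)))) else 0) \<partial>M)"
    unfolding feasible_accuracy_def by (rule nn_integral_suminf) measurable
  also have "\<dots> \<le> rand_accuracy M g X S"
    unfolding rand_accuracy_def Let_def
    using ae by (intro suminf_le nn_integral_mono_AE summableI) (auto elim!: eventually_mono)
  finally show ?thesis .
qed

end

section \<open>Monotone comparison of the inputs\<close>

lemma case_sum_measurable:
  "(\<lambda>z :: 'i + 'j \<Rightarrow> real. case_sum (\<lambda>i. z (Inl i)) (\<lambda>i. - z (Inr i)))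
     \<in> measurable (PiM UNIV (\<lambda>_. borel)) (PiM UNIV (\<lambda>_. borel))"
proof (rule measurable_PiM_single')
  fix s :: "'i + 'j"
  show "(\<lambda>z :: 'i + 'j \<Rightarrow> real. case_sum (\<lambda>i. z (Inl i)) (\<lambda>i. - z (Inr i)) s) \<in> borel_measurable (PiM UNIV (\<lambda>_. borel))"
    by (cases s) auto
qed auto

lemma ennreal_inverse_antimono: "a \<le> b \<Longrightarrow> inverse b \<le> inverse a" for a b :: ennreal
proof (cases "a = 0 \<or> b = top")
  case False
  assume "a \<le> b"
  moreover from this False obtain r q where "a = ennreal r" "0 < r" "b = ennreal q" "0 \<le> q"
    by (cases a; cases b) (auto simp: top_unique less_le)
  ultimately show ?thesis by (auto simp: inverse_ennreal intro!: ennreal_leI le_imp_inverse_le)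
qed auto

text \<open>Only the inputs of two queues, without a service discipline; in the application
  \<open>S\<close> are the job lengths of the processor-sharing queue and \<open>S'\<close> the
  service times.\<close>

locale dominated_queues =
  P: queue_primitives M X S f g + Q: queue_primitives N X' S' f' g'
  for M :: "'a measure" and X S f g and N :: "'b measure" and X' S' f' g' +
  assumes X_le: "st_le M (X 0) N (X' 0)" and S_ge: "st_le N (S' 0) M (S 0)"
begin

text \<open>Gaps and service times are ordered in opposite directions, so in either direction a
  coupling of all inputs has to negate one of the two sequences.\<close>

lemma tails:
  "measure N {\<omega>\<in>space N. X' i \<omega> \<le> c} \<le> measure M {\<omega>\<in>space M. X i \<omega> \<le> c}"
  "measure M {\<omega>\<in>space M. - X i \<omega> \<le> c} \<le> measure N {\<omega>\<in>space N. - X' i \<omega> \<le> c}"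
  "measure M {\<omega>\<in>space M. S i \<omega> \<le> c} \<le> measure N {\<omega>\<in>space N. S' i \<omega> \<le> c}"
  "measure N {\<omega>\<in>space N. - S' i \<omega> \<le> c} \<le> measure M {\<omega>\<in>space M. - S i \<omega> \<le> c}"
proof -
  have eqX: "measure M {\<omega>\<in>space M. X i \<omega> \<in> U} = measure M {\<omega>\<in>space M. X 0 \<omega> \<in> U}"
    "measure N {\<omega>\<in>space N. X' i \<omega> \<in> U} = measure N {\<omega>\<in>space N. X' 0 \<omega> \<in> U}"
    "measure M {\<omega>\<in>space M. S i \<omega> \<in> U} = measure M {\<omega>\<in>space M. S 0 \<omega> \<in> U}"
    "measure N {\<omega>\<in>space N. S' i \<omega> \<in> U} = measure N {\<omega>\<in>space N. S' 0 \<omega> \<in> U}" if "U \<in> sets borel" for U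
    using P.prob_Z_eq[of "Inl i" "Inl 0", OF _ that] Q.prob_Z_eq[of "Inl i" "Inl 0", OF _ that]
      P.prob_Z_eq[of "Inr i" "Inr 0", OF _ that] Q.prob_Z_eq[of "Inr i" "Inr 0", OF _ that] by auto
  have l: "{\<omega>\<in>A. h \<omega> \<le> c} = {\<omega>\<in>A. h \<omega> \<in> {..c}}" "{\<omega>\<in>A. - h \<omega> \<le> c} = {\<omega>\<in>A. h \<omega> \<in> {-c..}}"
    for A and h :: "_ \<Rightarrow> real" by (auto simp: minus_le_iff)
  have l': "{\<omega>\<in>A. h \<omega> \<le> c} = {\<omega>\<in>A. h \<omega> \<in> {..c}}" "{\<omega>\<in>A. - h \<omega> \<le> c} = {\<omega>\<in>A. h \<omega> \<in> {-c..}}"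
    for A :: "'b set" and h :: "_ \<Rightarrow> real" by (auto simp: minus_le_iff)
  note X = st_le_tails[OF P.prob_space_axioms Q.prob_space_axioms P.X_measurable Q.X_measurable X_le, of c]
  note S = st_le_tails[OF Q.prob_space_axioms P.prob_space_axioms Q.S_measurable P.S_measurable S_ge, of c]
  show "measure N {\<omega>\<in>space N. X' i \<omega> \<le> c} \<le> measure M {\<omega>\<in>space M. X i \<omega> \<le> c}"
    using X(1) unfolding l(1) l'(1) by (simp only: eqX borel_closed closed_atMost)
  show "measure M {\<omega>\<in>space M. - X i \<omega> \<le> c} \<le> measure N {\<omega>\<in>space N. - X' i \<omega> \<le> c}"
    using X(2) unfolding l(2) l'(2) by (simp only: eqX borel_closed closed_atLeast)
  show "measure M {\<omega>\<in>space M. S i \<omega> \<le> c} \<le> measure N {\<omega>\<in>space N. S' i \<omega> \<le> c}"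
    using S(1) unfolding l(1) l'(1) by (simp only: eqX borel_closed closed_atMost)
  show "measure N {\<omega>\<in>space N. - S' i \<omega> \<le> c} \<le> measure M {\<omega>\<in>space M. - S i \<omega> \<le> c}"
    using S(2) unfolding l(2) l'(2) by (simp only: eqX borel_closed closed_atLeast)
qed

text \<open>Negating the service times makes the functional increasing in all coordinates, and the
  negated variables are again ordered from the first queue to the second.\<close>

lemma nn_integral_comparison:
  assumes H: "(\<lambda>z. H (\<lambda>i. z (Inl i)) (\<lambda>i. z (Inr i))) \<in> borel_measurable (PiM UNIV (\<lambda>_. borel))"
    and mono: "\<And>x s x' s'. (\<And>i. x i \<le> x' i) \<Longrightarrow> (\<And>i. s' i \<le> s i) \<Longrightarrow> H x s \<le> H x' s'"
  shows "(\<integral>\<^sup>+\<omega>. H (\<lambda>i. X i \<omega>) (\<lambda>i. S i \<omega>) \<partial>M) \<le> (\<integral>\<^sup>+\<omega>. H (\<lambda>i. X' i \<omega>) (\<lambda>i. S' i \<omega>) \<partial>N)"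
proof -
  let ?sg = "case_sum (\<lambda>_. 1) (\<lambda>_. - 1) :: nat + nat \<Rightarrow> real"
  define G where "G z = H (\<lambda>i. z (Inl i)) (\<lambda>i. - z (Inr i))" for z :: "nat + nat \<Rightarrow> real"
  have "(\<integral>\<^sup>+\<omega>. G (\<lambda>s. ?sg s * P.Z s \<omega>) \<partial>M) \<le> (\<integral>\<^sup>+\<omega>. G (\<lambda>s. ?sg s * Q.Z s \<omega>) \<partial>N)"
  proof (rule nn_integral_mono_coupling[of M N "\<lambda>s \<omega>. ?sg s * P.Z s \<omega>" "\<lambda>s \<omega>. ?sg s * Q.Z s \<omega>" G])
    show "P.indep_vars (\<lambda>_. borel) (\<lambda>s \<omega>. ?sg s * P.Z s \<omega>) UNIV"
      by (rule P.indep_vars_compose2[OF P.indep]) auto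
    show "Q.indep_vars (\<lambda>_. borel) (\<lambda>s \<omega>. ?sg s * Q.Z s \<omega>) UNIV"
      by (rule Q.indep_vars_compose2[OF Q.indep]) auto
    show "measure N {\<omega>\<in>space N. ?sg s * Q.Z s \<omega> \<le> c} \<le> measure M {\<omega>\<in>space M. ?sg s * P.Z s \<omega> \<le> c}" for s c
      using tails(1,4) by (cases s) auto
    show "G \<in> borel_measurable (PiM UNIV (\<lambda>_. borel))"
      using measurable_compose[OF case_sum_measurable H] by (simp add: G_def[abs_def])
    show "G z \<le> G w" if "\<And>s. z s \<le> w s" for z w
      unfolding G_def using that by (intro mono) auto
  qed (rule P.prob_space_axioms Q.prob_space_axioms)+
  then show ?thesis by (simp add: G_def)
qed

lemma mean_arrival_le: "(\<integral>\<^sup>+\<omega>. ennreal (X 0 \<omega>) \<partial>M) \<le> (\<integral>\<^sup>+\<omega>. ennreal (X' 0 \<omega>) \<partial>N)"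
  by (rule nn_integral_comparison[of "\<lambda>x s. ennreal (x 0)"]) (auto intro: ennreal_leI)

text \<open>The mean length increases with the service times, so the two queues exchange roles in
  the coupling and the gaps are negated instead.\<close>

lemma mean_length_ge: "(\<integral>\<^sup>+\<omega>. ennreal (S' 0 \<omega>) \<partial>N) \<le> (\<integral>\<^sup>+\<omega>. ennreal (S 0 \<omega>) \<partial>M)"
proof -
  let ?sg = "case_sum (\<lambda>_. - 1) (\<lambda>_. 1) :: nat + nat \<Rightarrow> real"
  have "(\<integral>\<^sup>+\<omega>. (\<lambda>z. ennreal (z (Inr 0))) (\<lambda>s. ?sg s * Q.Z s \<omega>) \<partial>N) \<le>
      (\<integral>\<^sup>+\<omega>. (\<lambda>z. ennreal (z (Inr 0))) (\<lambda>s. ?sg s * P.Z s \<omega>) \<partial>M)"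
  proof (rule nn_integral_mono_coupling[of N M "\<lambda>s \<omega>. ?sg s * Q.Z s \<omega>" "\<lambda>s \<omega>. ?sg s * P.Z s \<omega>" "\<lambda>z. ennreal (z (Inr 0))"])
    show "P.indep_vars (\<lambda>_. borel) (\<lambda>s \<omega>. ?sg s * P.Z s \<omega>) UNIV"
      by (rule P.indep_vars_compose2[OF P.indep]) auto
    show "Q.indep_vars (\<lambda>_. borel) (\<lambda>s \<omega>. ?sg s * Q.Z s \<omega>) UNIV"
      by (rule Q.indep_vars_compose2[OF Q.indep]) auto
    show "measure M {\<omega>\<in>space M. ?sg s * P.Z s \<omega> \<le> c} \<le> measure N {\<omega>\<in>space N. ?sg s * Q.Z s \<omega> \<le> c}" for s c
      using tails(2,3) by (cases s) auto
  qed (auto intro: ennreal_leI P.prob_space_axioms Q.prob_space_axioms)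
  then show ?thesis by simp
qed

lemma load_factor_ge: "load_factor N X' S' \<le> load_factor M X S"
  unfolding load_factor_def divide_ennreal_def
  by (intro mult_mono mean_length_ge ennreal_inverse_antimono mean_arrival_le) auto

lemma prob_single_le:
  "measure M {\<omega>\<in>space M. S 0 \<omega> \<le> X 0 \<omega>} \<le> measure N {\<omega>\<in>space N. S' 0 \<omega> \<le> X' 0 \<omega>}"
proof -
  have "(\<integral>\<^sup>+\<omega>. (\<lambda>x s. indicator {..x 0} (s 0)) (\<lambda>i. X i \<omega>) (\<lambda>i. S i \<omega>) \<partial>M) \<le>
    (\<integral>\<^sup>+\<omega>. (\<lambda>x s. indicator {..x 0} (s 0)) (\<lambda>i. X' i \<omega>) (\<lambda>i. S' i \<omega>) \<partial>N)"
  proof (rule nn_integral_comparison)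
    let ?P = "PiM UNIV (\<lambda>_. borel) :: (nat + nat \<Rightarrow> real) measure"
    have [measurable]: "(\<lambda>z. z s) \<in> borel_measurable ?P" for s
      by (rule measurable_component_singleton) simp
    show "(\<lambda>z. indicator {..z (Inl 0)} (z (Inr 0))) \<in> borel_measurable ?P"
      unfolding indicator_def of_bool_def atMost_iff by measurable
    show "indicator {..x 0} (s 0) \<le> (indicator {..x' 0} (s' 0) :: ennreal)"
      if "\<And>i. x i \<le> x' i" "\<And>i. s' i \<le> s i" for x s x' s' :: "nat \<Rightarrow> real"
      using that(1)[of 0] that(2)[of 0] by (auto simp: indicator_def)
  qed
  moreover have "(\<integral>\<^sup>+\<omega>. indicator {..X 0 \<omega>} (S 0 \<omega>) \<partial>M) = emeasure M {\<omega>\<in>space M. S 0 \<omega> \<le> X 0 \<omega>}"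
  proof -
    have "(\<integral>\<^sup>+\<omega>. indicator {..X 0 \<omega>} (S 0 \<omega>) \<partial>M) =
        (\<integral>\<^sup>+\<omega>. indicator {\<omega>\<in>space M. S 0 \<omega> \<le> X 0 \<omega>} \<omega> \<partial>M)"
      by (rule nn_integral_cong) (auto simp: indicator_def)
    also have "\<dots> = emeasure M {\<omega>\<in>space M. S 0 \<omega> \<le> X 0 \<omega>}"
      by (rule nn_integral_indicator) measurable
    finally show ?thesis .
  qed
  moreover have "(\<integral>\<^sup>+\<omega>. indicator {..X' 0 \<omega>} (S' 0 \<omega>) \<partial>N) = emeasure N {\<omega>\<in>space N. S' 0 \<omega> \<le> X' 0 \<omega>}"
  proof -
    have "(\<integral>\<^sup>+\<omega>. indicator {..X' 0 \<omega>} (S' 0 \<omega>) \<partial>N) =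
        (\<integral>\<^sup>+\<omega>. indicator {\<omega>\<in>space N. S' 0 \<omega> \<le> X' 0 \<omega>} \<omega> \<partial>N)"
      by (rule nn_integral_cong) (auto simp: indicator_def)
    also have "\<dots> = emeasure N {\<omega>\<in>space N. S' 0 \<omega> \<le> X' 0 \<omega>}"
      by (rule nn_integral_indicator) measurable
    finally show ?thesis .
  qed
  ultimately show ?thesis by (simp add: P.emeasure_eq_measure Q.emeasure_eq_measure)
qed

end

lemma busy_arrivals_eq_1_iff: "busy_arrivals x t = 1 \<longleftrightarrow> t 0 \<le> x 0"
  unfolding one_enat_def busy_arrivals_eq_iff by (auto simp: departure_def arrival_Suc)

section \<open>Accuracy in the processor-sharing queue\<close>

context processor_sharing
begin

text \<open>The expected number of visits to \<open>A\<close> within a busy period is 0: the factor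
  with \<open>f_T\<close> vanishes, and in \<open>ennreal\<close> even infinity times 0 is
  0.\<close>

lemma AE_sojourn_typical:
  assumes f_T: "typical_sojourn_pdf M X T f_T" and A: "A \<in> sets borel" "\<And>u. u \<in> A \<Longrightarrow> f_T u = 0"
  shows "AE \<omega> in M. \<forall>i. enat i < B \<omega> \<longrightarrow> T i \<omega> \<notin> A"
proof -
  have [measurable]: "A \<in> sets borel" by fact
  have 0: "(\<integral>\<^sup>+ x. ennreal (f_T x) * indicator A x \<partial>lborel) = 0"
    using A(2) by (intro nn_integral_zero') (auto simp: indicator_def)
  have "(\<integral>\<^sup>+ \<omega>. (\<Sum>i. if enat i < B \<omega> then indicator A (T i \<omega>) else 0) \<partial>M) = 0"
    using f_T A(1) unfolding typical_sojourn_pdf_def by (simp add: 0)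
  then have "AE \<omega> in M. (\<Sum>i. if enat i < B \<omega> then indicator A (T i \<omega>) else 0 :: ennreal) = 0"
    by (subst (asm) nn_integral_0_iff_AE) measurable
  then show ?thesis
  proof (rule eventually_mono)
    fix \<omega> assume "(\<Sum>i. if enat i < B \<omega> then indicator A (T i \<omega>) else 0 :: ennreal) = 0"
    then have "\<forall>i. (if enat i < B \<omega> then indicator A (T i \<omega>) else 0 :: ennreal) = 0"
      by (subst (asm) suminf_eq_zero_iff) auto
    then show "\<forall>i. enat i < B \<omega> \<longrightarrow> T i \<omega> \<notin> A"
      by (auto simp: indicator_def split: if_splits)
  qed
qed

context
  fixes \<alpha> :: real and \<beta> :: ereal
  assumes J_support: "law_support M (J 0) = {x. \<alpha> \<le> x \<and> ereal x \<le> \<beta>}"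
    and load: "load_factor M X J < 1"
begin

lemma AE_length_bounds: "AE \<omega> in M. \<forall>i. \<alpha> \<le> J i \<omega> \<and> ereal (J i \<omega>) \<le> \<beta>"
proof -
  have "AE \<omega> in M. J i \<omega> \<in> law_support M (J 0)" for i
    using AE_law_support[of "J i"] unfolding law_support_S[of i] by simp
  then show ?thesis
    unfolding J_support by (simp add: AE_all_countable)
qed

text \<open>A length with a density differs from \<open>\<alpha>\<close> almost surely, which
  excludes a one-point support.\<close>

lemma support_bounds: "0 \<le> \<alpha>" "ereal \<alpha> < \<beta>"
proof -
  have "AE \<omega> in M. 1 * Z (Inr 0) \<omega> + 0 \<notin> {\<alpha>}" by (rule AE_affine_notin) auto
  with AE_length_bounds have "AE \<omega> in M. ereal \<alpha> < \<beta>"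
  proof eventually_elim
    case (elim \<omega>)
    then have "\<alpha> < J 0 \<omega>" by (auto simp: less_le)
    then have "ereal \<alpha> < ereal (J 0 \<omega>)" by simp
    also have "\<dots> \<le> \<beta>" using elim(1) by simp
    finally show ?case .
  qed
  then show lt: "ereal \<alpha> < \<beta>" by simp
  show "0 \<le> \<alpha>"
    using lt law_support_nonneg[of \<alpha> 0] unfolding J_support by simp
qed

lemma prob_length_near_pos:
  assumes "\<alpha> < y" "ereal y < \<beta>" "0 < d"
  shows "0 < prob {\<omega>\<in>space M. J i \<omega> \<in> {y - d<..<y + d}}"
proof -
  have "y \<in> law_support M (J i)" using assms unfolding law_support_S[of i] J_support by simp
  then show ?thesis using assms(3) unfolding law_support_def Collect_near_eq by simp
qed

text \<open>If all gaps were at most \<open>\<alpha>\<close>, a lower bound of the lengths, the mean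
  gap would be at most the mean length, contrary to the load.\<close>

lemma slow_gap: "\<exists>x1. 0 < f_X x1 \<and> \<alpha> < x1"
proof (rule ccontr)
  assume none: "\<not> ?thesis"
  have "AE \<omega> in M. X 0 \<omega> \<le> \<alpha>"
  proof -
    have "AE y in lborel. 0 < pdf (Inl 0) y \<longrightarrow> y \<le> \<alpha>" using none by (intro AE_I2) force
    from AE_Z[OF this] show ?thesis by simp
  qed
  then have "(\<integral>\<^sup>+\<omega>. ennreal (X 0 \<omega>) \<partial>M) \<le> (\<integral>\<^sup>+\<omega>. ennreal \<alpha> \<partial>M)"
    by (intro nn_integral_mono_AE) (auto intro: ennreal_leI)
  then have X: "(\<integral>\<^sup>+\<omega>. ennreal (X 0 \<omega>) \<partial>M) \<le> ennreal \<alpha>" by (simp add: emeasure_space_1)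
  have "(\<integral>\<^sup>+\<omega>. ennreal \<alpha> \<partial>M) \<le> (\<integral>\<^sup>+\<omega>. ennreal (J 0 \<omega>) \<partial>M)"
    using AE_length_bounds by (intro nn_integral_mono_AE) (auto intro: ennreal_leI)
  then have J: "ennreal \<alpha> \<le> (\<integral>\<^sup>+\<omega>. ennreal (J 0 \<omega>) \<partial>M)" by (simp add: emeasure_space_1)
  have "(\<integral>\<^sup>+\<omega>. ennreal (X 0 \<omega>) \<partial>M) \<noteq> 0"
  proof
    assume "(\<integral>\<^sup>+\<omega>. ennreal (X 0 \<omega>) \<partial>M) = 0"
    then have "AE \<omega> in M. ennreal (X 0 \<omega>) = 0"
      by (subst (asm) nn_integral_0_iff_AE) auto
    with AE_pos have "AE \<omega> in M. False"
      by eventually_elim (simp add: ennreal_eq_0_iff not_le[symmetric])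
    then show False by simp
  qed
  then have "1 = (\<integral>\<^sup>+\<omega>. ennreal (X 0 \<omega>) \<partial>M) / (\<integral>\<^sup>+\<omega>. ennreal (X 0 \<omega>) \<partial>M)"
    using X by (intro ennreal_divide_self[symmetric]) (auto intro: le_less_trans)
  also have "\<dots> \<le> load_factor M X J"
    unfolding load_factor_def using X J by (intro divide_right_mono_ennreal) simp
  finally show False using load by simp
qed

lemma AE_feasible_valid:
  assumes f_T: "typical_sojourn_pdf M X T f_T"
  shows "AE \<omega> in M. \<forall>b i k. B \<omega> = enat b \<longrightarrow> i < b \<longrightarrow> k < b \<longrightarrow>
    \<alpha> \<le> departure (\<lambda>i. X i \<omega>) (\<lambda>i. T i \<omega>) k - arrival (\<lambda>i. X i \<omega>) i \<longrightarrow>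
    0 < f_T (departure (\<lambda>i. X i \<omega>) (\<lambda>i. T i \<omega>) k - arrival (\<lambda>i. X i \<omega>) i)"
proof (cases "\<exists>x0>0. 0 < f_X x0 \<and> ereal x0 < \<beta>")
  case True
  then obtain x0 where x0: "0 < x0" "0 < f_X x0" "ereal x0 < \<beta>" by blast
  obtain x1 where x1: "0 < f_X x1" "\<alpha> < x1" using slow_gap by blast
  have [measurable]: "f_T \<in> borel_measurable borel" and f0: "\<And>u. 0 \<le> f_T u"
    using f_T by (auto simp: typical_sojourn_pdf_def)
  define A where "A = {u\<in>{\<alpha><..}. f_T u = 0}"
  have A: "A \<in> sets borel" unfolding A_def by measurable
  have "emeasure lborel A = 0"
  proof (rule ccontr)
    assume "emeasure lborel A \<noteq> 0"
    then obtain k where "\<not> (AE \<omega> in M. \<not> (enat k < B \<omega> \<and> T k \<omega> \<in> A))"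
      using sojourn_hits[OF x0 x1 support_bounds prob_length_near_pos A] by (auto simp: A_def)
    moreover have "AE \<omega> in M. \<forall>i. enat i < B \<omega> \<longrightarrow> T i \<omega> \<notin> A"
      by (rule AE_sojourn_typical[OF f_T A]) (simp add: A_def)
    then have "AE \<omega> in M. \<not> (enat k < B \<omega> \<and> T k \<omega> \<in> A)"
      by (rule eventually_mono) blast
    ultimately show False by blast
  qed
  \<comment> \<open>Differences equal to \<open>\<alpha>\<close> are excluded as well, since
    \<open>f_T\<close> may vanish there.\<close>
  then have "A \<union> {\<alpha>} \<in> null_sets lborel" using A by (intro null_sets.Un) (auto simp: null_sets_def)
  from AE_departure_notin[OF this] show ?thesis
  proof (rule eventually_mono)
    fix \<omega> assume *: "\<forall>b i k. B \<omega> = enat b \<longrightarrow> i < b \<longrightarrow> k < b \<longrightarrow>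
      departure (\<lambda>i. X i \<omega>) (\<lambda>i. T i \<omega>) k - arrival (\<lambda>i. X i \<omega>) i \<notin> A \<union> {\<alpha>}"
    have pos: "0 < f_T u" if "u \<notin> A \<union> {\<alpha>}" "\<alpha> \<le> u" for u
      using that f0[of u] by (auto simp: A_def less_le)
    show "\<forall>b i k. B \<omega> = enat b \<longrightarrow> i < b \<longrightarrow> k < b \<longrightarrow>
      \<alpha> \<le> departure (\<lambda>i. X i \<omega>) (\<lambda>i. T i \<omega>) k - arrival (\<lambda>i. X i \<omega>) i \<longrightarrow>
      0 < f_T (departure (\<lambda>i. X i \<omega>) (\<lambda>i. T i \<omega>) k - arrival (\<lambda>i. X i \<omega>) i)"
      by (intro allI impI pos) (use * in blast)+
  qed
next
  case False
  \<comment> \<open>The first gap is at least \<open>\<beta>\<close>, and equality has probability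
    0, so it exceeds the first length and job 0 alone makes up the busy period.\<close>
  have "AE \<omega> in M. \<beta> \<le> ereal (X 0 \<omega>)"
  proof -
    have "\<beta> \<le> ereal y" if "0 < f_X y" for y
    proof -
      have "0 < y" using that pdf_nonpos[of y "Inl 0"] by (cases "y \<le> 0") auto
      then show ?thesis using False that by (meson not_less)
    qed
    then show ?thesis using AE_Z[of "Inl 0" "\<lambda>y. \<beta> \<le> ereal y"] by simp
  qed
  moreover have "AE \<omega> in M. X 0 \<omega> \<notin> {real_of_ereal \<beta>}"
  proof -
    have "AE \<omega> in M. 1 * Z (Inl 0) \<omega> + 0 \<notin> {real_of_ereal \<beta>}" by (rule AE_affine_notin) auto
    then show ?thesis by simp
  qed
  moreover have "AE \<omega> in M. \<forall>i. enat i < B \<omega> \<longrightarrow> T i \<omega> \<notin> {u. f_T u = 0}"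
  proof (rule AE_sojourn_typical[OF f_T])
    have [measurable]: "f_T \<in> borel_measurable borel" using f_T by (simp add: typical_sojourn_pdf_def)
    show "{u. f_T u = 0} \<in> sets borel" by measurable
  qed simp
  ultimately show ?thesis
    using AE_good AE_length_bounds
  proof eventually_elim
    case (elim \<omega>)
    have path: "processor_sharing_path (\<lambda>i. X i \<omega>) (\<lambda>i. J i \<omega>) (\<lambda>i. T i \<omega>)"
      "\<And>i. 0 < X i \<omega>" "\<And>i. 0 < J i \<omega>" using elim(4) by (auto simp: good_def)
    have f0: "0 \<le> f_T u" for u using f_T by (auto simp: typical_sojourn_pdf_def)
    have "J 0 \<omega> < X 0 \<omega>"
    proof (rule ccontr)
      assume "\<not> J 0 \<omega> < X 0 \<omega>"
      then have "ereal (X 0 \<omega>) \<le> \<beta>" using elim(5) by (meson ereal_less_eq(3) not_less order_trans)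
      with elim(1) have "\<beta> = ereal (X 0 \<omega>)" by simp
      then show False using elim(2) by simp
    qed
    then have "\<not> enat 1 < B \<omega>"
      using arrival_le_work[of "\<lambda>i. X i \<omega>" "\<lambda>i. J i \<omega>" "\<lambda>i. T i \<omega>" 1, OF path] by (auto simp: arrival_def)
    show ?case
    proof (intro allI impI)
      fix b i k assume b: "B \<omega> = enat b" "i < b" "k < b"
      then have "b = 1" using \<open>\<not> enat 1 < B \<omega>\<close> by simp
      then have "i = 0" "k = 0" using b by auto
      moreover have "T 0 \<omega> \<notin> {u. f_T u = 0}" using elim(3) b by (metis enat_ord_simps(2) gr_implies_not0 not_gr_zero)
      ultimately show "0 < f_T (departure (\<lambda>i. X i \<omega>) (\<lambda>i. T i \<omega>) k - arrival (\<lambda>i. X i \<omega>) i)"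
        using f0[of "T 0 \<omega>"] by (simp add: departure_def less_le)
    qed
  qed
qed

lemma rand_accuracy_le_feasible_accuracy:
  assumes f_T: "typical_sojourn_pdf M X T f_T"
  shows "rand_accuracy M f_T X T \<le> (\<integral>\<^sup>+\<omega>. feasible_accuracy \<alpha> (\<lambda>i. X i \<omega>) (\<lambda>i. J i \<omega>) \<partial>M)"
proof -
  have f0: "0 \<le> f_T u" for u using f_T by (auto simp: typical_sojourn_pdf_def)
  have T_ge: "AE \<omega> in M. \<forall>i. J i \<omega> \<le> T i \<omega>"
    using AE_good
  proof (rule eventually_mono)
    fix \<omega> assume "good \<omega>"
    then have "J i \<omega> \<le> T i \<omega>" for i unfolding good_def by (intro length_le_sojourn[of _ "\<lambda>i. J i \<omega>"]) auto
    then show "\<forall>i. J i \<omega> \<le> T i \<omega>" by blast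
  qed
  have "AE \<omega> in M. \<forall>b. B \<omega> = enat b \<longrightarrow>
      ennreal (pmf (random_matching f_T b (\<lambda>i. X i \<omega>) (\<lambda>i. T i \<omega>)) (true_matching b (\<lambda>i. X i \<omega>) (\<lambda>i. T i \<omega>))) \<le>
      ennreal (1 / real (card (feasible_matchings ((\<le>) \<alpha>) b (\<lambda>i. X i \<omega>) (\<lambda>i. T i \<omega>))))"
    using AE_feasible_valid[OF f_T] T_ge AE_length_bounds
  proof eventually_elim
    case (elim \<omega>)
    show ?case
    proof (intro allI impI ennreal_leI pmf_random_matching_le f0)
      show "\<alpha> \<le> T i \<omega>" for i using elim(2,3) order_trans by blast
    qed (use elim(1) in blast)
  qed
  then have "rand_accuracy M f_T X T \<le>
    (\<Sum>n. \<integral>\<^sup>+\<omega>. (if B \<omega> = enat (Suc n)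
       then ennreal (1 / real (card (feasible_matchings ((\<le>) \<alpha>) (Suc n) (\<lambda>i. X i \<omega>) (\<lambda>i. T i \<omega>)))) else 0) \<partial>M)"
    unfolding rand_accuracy_def Let_def
    by (intro suminf_le nn_integral_mono_AE summableI) (auto elim!: eventually_mono)
  also have "\<dots> = (\<integral>\<^sup>+\<omega>. feasible_accuracy \<alpha> (\<lambda>i. X i \<omega>) (\<lambda>i. T i \<omega>) \<partial>M)"
    unfolding feasible_accuracy_def by (rule nn_integral_suminf[symmetric]) measurable
  also have "\<dots> \<le> (\<integral>\<^sup>+\<omega>. feasible_accuracy \<alpha> (\<lambda>i. X i \<omega>) (\<lambda>i. J i \<omega>) \<partial>M)"
  proof (rule nn_integral_mono_AE)
    show "AE \<omega> in M. feasible_accuracy \<alpha> (\<lambda>i. X i \<omega>) (\<lambda>i. T i \<omega>) \<le> feasible_accuracy \<alpha> (\<lambda>i. X i \<omega>) (\<lambda>i. J i \<omega>)"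
      using T_ge AE_length_bounds AE_pos
      by eventually_elim (intro feasible_accuracy_mono, auto simp: less_imp_le)
  qed
  finally show ?thesis .
qed

end

lemma prob_busy_one_le: "prob_busy_one M X T \<le> prob {\<omega>\<in>space M. J 0 \<omega> \<le> X 0 \<omega>}"
  unfolding prob_busy_one_def busy_arrivals_eq_1_iff
proof (rule finite_measure_mono_AE)
  show "AE \<omega> in M. \<omega> \<in> {\<omega>\<in>space M. T 0 \<omega> \<le> X 0 \<omega>} \<longrightarrow> \<omega> \<in> {\<omega>\<in>space M. J 0 \<omega> \<le> X 0 \<omega>}"
    using AE_good
  proof (rule eventually_mono)
    fix \<omega> assume "good \<omega>"
    then have "J 0 \<omega> \<le> T 0 \<omega>" unfolding good_def by (intro length_le_sojourn[of _ "\<lambda>i. J i \<omega>"]) auto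
    then show "\<omega> \<in> {\<omega>\<in>space M. T 0 \<omega> \<le> X 0 \<omega>} \<longrightarrow> \<omega> \<in> {\<omega>\<in>space M. J 0 \<omega> \<le> X 0 \<omega>}" by auto
  qed
qed measurable

end

theorem theorem6:
  fixes M :: "'a measure" and X J T :: "nat \<Rightarrow> 'a \<Rightarrow> real"
    and f_X f_J f_T :: "real \<Rightarrow> real"
    and \<alpha> :: real and \<beta> :: ereal
    and N :: "'b measure" and X' T' :: "nat \<Rightarrow> 'b \<Rightarrow> real"
    and f_X' f_T' :: "real \<Rightarrow> real"
    and \<alpha>' :: real
  assumes PS: "processor_sharing_queue M X J T f_X f_J"
    and f_T: "typical_sojourn_pdf M X T f_T"
    and J_support: "law_support M (J 0) = {x. \<alpha> \<le> x \<and> ereal x \<le> \<beta>}"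
    and J_mean: "(\<integral>\<^sup>+ \<omega>. ennreal (J 0 \<omega>) \<partial>M) < \<infinity>"
    and load: "load_factor M X J < 1"
    and INF: "infinite_server_queue N X' T' f_X' f_T'"
    and T'_support: "\<alpha>' = Inf (law_support N (T' 0))"
    and X_le: "st_le M (X 0) N (X' 0)"
    and J_ge: "st_le N (T' 0) M (J 0)"
    and \<alpha>_le: "\<alpha> \<le> \<alpha>'"
  shows "load_factor M X J \<ge> load_factor N X' T' \<and>
         prob_busy_one M X T \<le> prob_busy_one N X' T' \<and>
         rand_accuracy M f_T X T \<le> rand_accuracy N f_T' X' T'"
proof -
  interpret P: processor_sharing M X J T f_X f_J
    using PS by (rule processor_sharing.intro)
  interpret Q: queue_primitives N X' T' f_X' f_T'
    using INF by unfold_locales (simp add: infinite_server_queue_def)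
  interpret dominated_queues M X J f_X f_J N X' T' f_X' f_T'
    by unfold_locales (fact X_le, fact J_ge)
  have g: "continuous_on {0<..} f_T'" using INF by (simp add: infinite_server_queue_def)
  have low: "AE \<omega> in M. \<forall>i. 0 < X i \<omega> \<and> \<alpha> \<le> J i \<omega>"
    using P.AE_pos P.AE_length_bounds[OF J_support load] by eventually_elim auto
  have "prob_busy_one M X T \<le> measure M {\<omega>\<in>space M. J 0 \<omega> \<le> X 0 \<omega>}"
    by (rule P.prob_busy_one_le)
  also have "\<dots> \<le> measure N {\<omega>\<in>space N. T' 0 \<omega> \<le> X' 0 \<omega>}" by (rule prob_single_le)
  also have "\<dots> = prob_busy_one N X' T'"
    unfolding prob_busy_one_def busy_arrivals_eq_1_iff ..
  finally have single: "prob_busy_one M X T \<le> prob_busy_one N X' T'" .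
  \<comment> \<open>The coupling asks for a functional that is monotone on all sequences, whereas
    \<open>feasible_accuracy_mono\<close> needs nonnegative gaps and times of at least
    \<open>\<alpha>\<close>. The cut-offs enforce this and almost surely change nothing in either
    queue.\<close>
  let ?H = "\<lambda>x t. feasible_accuracy \<alpha> (\<lambda>i. max 0 (x i)) (\<lambda>i. max \<alpha> (t i))"
  have "rand_accuracy M f_T X T \<le> (\<integral>\<^sup>+\<omega>. feasible_accuracy \<alpha> (\<lambda>i. X i \<omega>) (\<lambda>i. J i \<omega>) \<partial>M)"
    by (rule P.rand_accuracy_le_feasible_accuracy[OF J_support load f_T])
  also have "\<dots> = (\<integral>\<^sup>+\<omega>. ?H (\<lambda>i. X i \<omega>) (\<lambda>i. J i \<omega>) \<partial>M)"
  proof (rule nn_integral_cong_AE)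
    show "AE \<omega> in M. feasible_accuracy \<alpha> (\<lambda>i. X i \<omega>) (\<lambda>i. J i \<omega>) = ?H (\<lambda>i. X i \<omega>) (\<lambda>i. J i \<omega>)"
      using low by (rule eventually_mono) (simp add: max_absorb2 less_imp_le)
  qed
  also have "\<dots> \<le> (\<integral>\<^sup>+\<omega>. ?H (\<lambda>i. X' i \<omega>) (\<lambda>i. T' i \<omega>) \<partial>N)"
  proof (rule nn_integral_comparison[of ?H])
    have [measurable]: "(\<lambda>z. z s) \<in> borel_measurable (PiM UNIV (\<lambda>_. borel) :: (nat + nat \<Rightarrow> real) measure)" for s
      by (rule measurable_component_singleton) simp
    show "(\<lambda>z. ?H (\<lambda>i. z (Inl i)) (\<lambda>i. z (Inr i))) \<in> borel_measurable (PiM UNIV (\<lambda>_. borel))"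
      by (rule feasible_accuracy_measurable) measurable
    show "?H x s \<le> ?H x' s'" if "\<And>i. x i \<le> x' i" "\<And>i. s' i \<le> s i" for x s x' s'
      using that by (intro feasible_accuracy_mono max.mono) auto
  qed
  also have "\<dots> = (\<integral>\<^sup>+\<omega>. feasible_accuracy \<alpha> (\<lambda>i. X' i \<omega>) (\<lambda>i. T' i \<omega>) \<partial>N)"
  proof (rule nn_integral_cong_AE)
    have "AE \<omega> in N. T' i \<omega> \<in> law_support N (T' 0)" for i
      using Q.AE_law_support[of "T' i"] unfolding Q.law_support_S[of i] by simp
    then have "AE \<omega> in N. \<forall>i. T' i \<omega> \<in> law_support N (T' 0)"
      by (simp add: AE_all_countable)
    with Q.AE_pos show "AE \<omega> in N. ?H (\<lambda>i. X' i \<omega>) (\<lambda>i. T' i \<omega>) = feasible_accuracy \<alpha> (\<lambda>i. X' i \<omega>) (\<lambda>i. T' i \<omega>)"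
    proof eventually_elim
      case (elim \<omega>)
      have "bdd_below (law_support N (T' 0))" by (rule bdd_belowI[of _ 0]) (rule Q.law_support_nonneg)
      then have "\<alpha>' \<le> T' i \<omega>" for i unfolding T'_support using elim(2) by (intro cInf_lower) auto
      then have "\<alpha> \<le> T' i \<omega>" for i using \<alpha>_le order_trans by blast
      then show ?case using elim(1) by (simp add: max_absorb2 less_imp_le)
    qed
  qed
  also have "\<dots> \<le> rand_accuracy N f_T' X' T'"
    using Q.feasible_accuracy_le_rand_accuracy[OF g] \<alpha>_le unfolding T'_support .
  finally show ?thesis using load_factor_ge single by blast
qed

end
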